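(* Assume that $n\ge 2$ and $1\le m\le n$. Let $\beta>0$ and let $A\in\mathbb{C}^{n\times n}$ be a skew-Hermitian matrix such that $$\delta(A)^2>\frac{6}{(2-\sqrt2)^2}\sqrt{\frac nm}\,\beta^2.$$ Let $w=e^{-i\frac{2\pi}{n}}$ and let $\widehat B\in\mathbb{C}^{n\times m}$ be the matrix which, represented in the orthonormal basis $\{v_j\}$ of eigenvectors of $A$ in $\mathbb{C}^n$ (and the standard basis of $\mathbb{C}^m$), has entries $\widehat B_{j,l}=\frac{\beta}{\sqrt n}w^{(j-1)(l-1)}$, $1\le j\le n$, $1\le l\le m$. Then $$\gamma_{\mathrm{decay}}(A,\widehat B)>\frac12\sup_{\|B\|=\beta}\gamma_{\mathrm{decay}}(A,B).$$
   Context: $\|\cdot\|$ is the Euclidean norm of vectors and the induced operator norm of matrices. For a skew-Hermitian $A\in\mathbb{C}^{n\times n}$ ($A^*=-A$), the eigenvalues listed with multiplicity are $i\lambda_1,\dots,i\lambda_n$ with $\lambda_1\le\dots\le\lambda_n$ real, $v_1,\dots,v_n$ is an orthonormal basis of $\mathbb{C}^n$ with $Av_j=i\lambda_jv_j$, and $\delta(A)=\min_{j\ne k}|\lambda_j-\lambda_k|$. For $B\in\mathbb{C}^{n\times m}$ with $\ker B=\{0\}$ and $(A,B)$ stabilizable, $\gamma_{\mathrm{decay}}(A,B)$ is defined via the linear quadratic regulator problem of minimizing $\int_0^\infty x(t)^*x(t)+u(t)^*u(t)\,dt$ subject to $x'=Ax+Bu$, $x(0)=x_0$: the optimal control is $u=-B^*Xx$,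 where $X$ is the unique nonnegative solution of $XBB^*X-XA-A^*X-I=0$, the closed-loop matrix $A_{\mathrm{cl.loop}}=A-BB^*X$ is stable, and $\gamma_{\mathrm{decay}}(A,B)=\min\{|\operatorname{Re}\nu|:\nu\text{ an eigenvalue of }A_{\mathrm{cl.loop}}\}$. The supremum is taken over all such $B\in\mathbb{C}^{n\times m}$ (with $\ker B=\{0\}$ and $(A,B)$ stabilizable) with $\|B\|=\beta$. *)

theory Defs
  imports
    "HOL-Library.Extended_Real"
    "Jordan_Normal_Form.Schur_Decomposition"
    "Jordan_Normal_Form.Matrix_Kernel"
begin

definition vec_norm2 :: "complex Matrix.vec \<Rightarrow> real" where
  "vec_norm2 x = sqrt (\<Sum>i<dim_vec x. (cmod (x $ i))\<^sup>2)"

definition op_norm :: "complex Matrix.mat \<Rightarrow> real" where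
  "op_norm B = Sup {vec_norm2 (B *\<^sub>v x) | x. x \<in> carrier_vec (dim_col B) \<and> vec_norm2 x \<le> 1}"

definition skew_hermitian :: "complex Matrix.mat \<Rightarrow> bool" where
  "skew_hermitian A \<longleftrightarrow> mat_adjoint A = - A"

text \<open>The order on \<^typ>\<open>complex\<close> used here is the one of the library: \<open>0 \<le> z\<close> means that
  \<open>z\<close> is real and nonnegative.\<close>

definition nonneg_mat :: "complex Matrix.mat \<Rightarrow> bool" where
  "nonneg_mat X \<longleftrightarrow> mat_adjoint X = X \<and>
     (\<forall>x \<in> carrier_vec (dim_row X). 0 \<le> (X *\<^sub>v x) \<bullet>c x)"

definition stable_mat :: "complex Matrix.mat \<Rightarrow> bool" where
  "stable_mat F \<longleftrightarrow> (\<forall>\<nu>. eigenvalue F \<nu> \<longrightarrow> Re \<nu> < 0)"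

definition stabilizable :: "complex Matrix.mat \<Rightarrow> complex Matrix.mat \<Rightarrow> bool" where
  "stabilizable A B \<longleftrightarrow> (\<exists>K \<in> carrier_mat (dim_col B) (dim_row A). stable_mat (A + B * K))"

text \<open>The nonnegative solutions of the algebraic Riccati equation of the linear quadratic
  regulator problem of minimizing \<open>\<integral>\<^sub>0\<^sup>\<infinity> x(t)\<^sup>* x(t) + u(t)\<^sup>* u(t) dt\<close> subject to
  \<open>x' = A x + B u\<close>, \<open>x(0) = x\<^sub>0\<close>. If \<open>(A, B)\<close> is stabilizable, there is exactly one, and the
  optimal control is \<open>u = - B\<^sup>* X x\<close>.\<close>

definition riccati_sol ::
  "complex Matrix.mat \<Rightarrow> complex Matrix.mat \<Rightarrow> complex Matrix.mat \<Rightarrow> bool" where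
  "riccati_sol A B X \<longleftrightarrow>
     X \<in> carrier_mat (dim_row A) (dim_row A) \<and> nonneg_mat X \<and>
     X * B * mat_adjoint B * X - X * A - mat_adjoint A * X - 1\<^sub>m (dim_row A)
       = 0\<^sub>m (dim_row A) (dim_row A)"

definition closed_loop :: "complex Matrix.mat \<Rightarrow> complex Matrix.mat \<Rightarrow> complex Matrix.mat" where
  "closed_loop A B = A - B * mat_adjoint B * (THE X. riccati_sol A B X)"

definition gamma_decay :: "complex Matrix.mat \<Rightarrow> complex Matrix.mat \<Rightarrow> real" where
  "gamma_decay A B = Min {\<bar>Re \<nu>\<bar> | \<nu>. eigenvalue (closed_loop A B) \<nu>}"

definition admissible_inputs :: "complex Matrix.mat \<Rightarrow> nat \<Rightarrow> real \<Rightarrow> complex Matrix.mat set" where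
  "admissible_inputs A m \<beta> =
     {B \<in> carrier_mat (dim_row A) m.
        mat_kernel B = {0\<^sub>v m} \<and> stabilizable A B \<and> op_norm B = \<beta>}"

text \<open>Indices start at 0 here and below: \<open>lam 0, \<dots>, lam (n - 1)\<close> are the imaginary parts of the
  eigenvalues, listed with multiplicity.\<close>

definition eigenvalue_gap :: "nat \<Rightarrow> (nat \<Rightarrow> real) \<Rightarrow> real" where
  "eigenvalue_gap n lam = Min {\<bar>lam j - lam k\<bar> | j k. j < n \<and> k < n \<and> j \<noteq> k}"

text \<open>The left factor has columns \<open>v 0, \<dots>, v (n - 1)\<close>, so the right factor consists of the
  coordinates with respect to \<open>v\<close>; with indices starting at 0, the exponent
  \<open>(j - 1) (l - 1)\<close> becomes \<open>j * l\<close>.\<close>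

definition fourier_input ::
  "nat \<Rightarrow> nat \<Rightarrow> real \<Rightarrow> (nat \<Rightarrow> complex Matrix.vec) \<Rightarrow> complex Matrix.mat" where
  "fourier_input n m \<beta> v =
     mat_of_cols n (map v [0..<n]) *
     Matrix.mat n m (\<lambda>(j, l).
       complex_of_real (\<beta> / sqrt (real n)) *
       exp (- \<i> * complex_of_real (2 * pi / real n)) ^ (j * l))"

end

theory Submission
  imports Defs "HOL-Analysis.Function_Topology" "HOL-Analysis.Topology_Euclidean_Space"
begin

unbundle no inner_syntax

text \<open>For skew-Hermitian \<open>A\<close> the inverse \<open>Y = X\<^sup>-\<^sup>1\<close> of the Riccati solution satisfies
  \<open>Y\<^sup>2 + AY - YA = BB\<^sup>*\<close>, and \<open>A - BB\<^sup>*X = Y(A - Y)X\<close> is similar to \<open>A - Y\<close>. Put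
  \<open>d = \<beta> \<surd>(m/n)\<close>.

  The diagonal of the equation in the eigenbasis of \<open>A\<close> says \<open>\<parallel>Y v\<^sub>j\<parallel> = \<parallel>B\<^sup>* v\<^sub>j\<parallel>\<close>. As the real
  parts of the closed-loop eigenvalues add up to \<open>- tr Y\<close>, the Cauchy-Schwarz inequality gives
  \<open>\<gamma> \<le> d\<close> for every \<open>B\<close> with \<open>\<parallel>B\<parallel> = \<beta>\<close>. For the Fourier matrix, \<open>\<parallel>Y v\<^sub>j\<parallel> = d\<close> for all \<open>j\<close>.
  The commutator \<open>AY - YA\<close> has the entries \<open>\<i>(\<lambda>\<^sub>k - \<lambda>\<^sub>j) Y\<^sub>k\<^sub>j\<close>, so \<open>Y\<close> is almost diagonal, as
  the gap of \<open>A\<close> exceeds \<open>4\<beta>\<close>; for the same reason each eigenvector of \<open>A - Y\<close> is close to some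
  \<open>v\<^sub>j\<close>, and comparing its \<open>j\<close>-th coordinates gives \<open>- Re \<nu> > d/2\<close>.

  Existence of \<open>Y\<close>: among the positive semidefinite \<open>Y \<le> t I\<close> with \<open>Y\<^sup>2 + AY - YA \<ge> BB\<^sup>*\<close>, take one
  of least trace. A Newton step does not leave this set and decreases \<open>Y\<close>, so it must be trivial.\<close>

section \<open>Inner products and adjoints\<close>

text \<open>Passing from \<open>X\<close> to its inverse makes the coefficient of the quadratic term
  the identity. The residual of \<open>Y\<close> then has the linearization that sends N to the
  adjoint of W times N plus N W, with W = Y - A. Since A is skew-Hermitian, W is accretive as soon
  as Y is positive definite, so Newton steps and uniqueness both reduce to one Lyapunov lemma with
  an accretive coefficient, and no stability of the closed loop has to be known in advance. Positive
  definiteness itself follows from the residual: the kernel of a supersolution would be an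
  A-invariant subspace on which the adjoint of B vanishes, which stabilizability excludes.

  The obstacle in the lower bound is that A - Y is not normal, so its eigenvalues cannot be read off
  the diagonal of Y. The gap 4\<beta> controls two errors: the part of Y v_j orthogonal to v_j has
  squared length at most d^2/4, and that of a unit eigenvector at most 1/4. So the diagonal entry is
  at least (sqrt 3 / 2) d, the correction at most d / (2 sqrt 3), and d / sqrt 3 > d/2 is left. The
  factor 4 is available because 6 / (2 - sqrt 2)^2 > 16.\<close>

lemma scalar_prod_conj_simps:
  fixes x y z :: "complex Matrix.vec"
  assumes "x \<in> carrier_vec n" "y \<in> carrier_vec n" "z \<in> carrier_vec n"
  shows "(x + y) \<bullet>c z = x \<bullet>c z + y \<bullet>c z"
    and "z \<bullet>c (x + y) = z \<bullet>c x + z \<bullet>c y"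
    and "(x - y) \<bullet>c z = x \<bullet>c z - y \<bullet>c z"
    and "z \<bullet>c (x - y) = z \<bullet>c x - z \<bullet>c y"
    and "(c \<cdot>\<^sub>v x) \<bullet>c z = c * (x \<bullet>c z)"
    and "z \<bullet>c (c \<cdot>\<^sub>v x) = cnj c * (z \<bullet>c x)"
  using assms
  by (auto simp: scalar_prod_def sum.distrib sum_distrib_left sum_subtractf algebra_simps)

lemma cnj_scalar_prod_conj:
  fixes x y :: "complex Matrix.vec"
  assumes "x \<in> carrier_vec n" "y \<in> carrier_vec n"
  shows "cnj (x \<bullet>c y) = y \<bullet>c x"
  using assms by (auto simp: scalar_prod_def mult.commute)

text \<open>Squared lengths keep Parseval's identity and most later estimates free of square
  roots.\<close>

definition nsq :: "complex Matrix.vec \<Rightarrow> real" where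
  "nsq x = (\<Sum>i<dim_vec x. (cmod (x $ i))\<^sup>2)"

lemma vec_norm2_nsq: "vec_norm2 x = sqrt (nsq x)"
  by (simp add: vec_norm2_def nsq_def)

lemma nsq_nonneg [simp]: "0 \<le> nsq x"
  by (simp add: nsq_def sum_nonneg)

lemma scalar_prod_conj_self:
  fixes x :: "complex Matrix.vec"
  shows "x \<bullet>c x = of_real (nsq x)"
  unfolding nsq_def scalar_prod_def of_real_sum complex_norm_square [symmetric]
  by (auto intro!: sum.cong simp: complex_norm_square [symmetric] lessThan_atLeast0)

lemma Re_scalar_prod_conj_self:
  fixes x :: "complex Matrix.vec"
  shows "Re (x \<bullet>c x) = nsq x"
  by (simp add: scalar_prod_conj_self)

lemma nsq_eq_0_iff: "x \<in> carrier_vec n \<Longrightarrow> nsq x = 0 \<longleftrightarrow> x = 0\<^sub>v n"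
  by (auto simp: nsq_def sum_nonneg_eq_0_iff)

lemma nsq_pos_iff: "x \<in> carrier_vec n \<Longrightarrow> 0 < nsq x \<longleftrightarrow> x \<noteq> 0\<^sub>v n"
  using nsq_eq_0_iff [of x n] nsq_nonneg [of x] by linarith

lemma nsq_smult: "nsq (c \<cdot>\<^sub>v x) = (cmod c)\<^sup>2 * nsq x"
  by (simp add: nsq_def norm_mult power_mult_distrib sum_distrib_left)

lemma Re_scalar_prod_conj_commute:
  fixes x y :: "complex Matrix.vec"
  assumes "x \<in> carrier_vec n" "y \<in> carrier_vec n"
  shows "Re (x \<bullet>c y) = Re (y \<bullet>c x)"
  using cnj_scalar_prod_conj [OF assms] complex_cnj(1) by (metis cnj.sel(1))

lemma nsq_add:
  assumes "x \<in> carrier_vec n" "y \<in> carrier_vec n"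
  shows "nsq (x + y) = nsq x + 2 * Re (x \<bullet>c y) + nsq y"
proof -
  have "Re ((x + y) \<bullet>c (x + y)) = Re (x \<bullet>c x) + Re (x \<bullet>c y) + Re (y \<bullet>c x) + Re (y \<bullet>c y)"
    using assms by (simp add: scalar_prod_conj_simps [where n = n])
  then show ?thesis
    using Re_scalar_prod_conj_commute [OF assms] by (simp add: Re_scalar_prod_conj_self)
qed

lemma nsq_diff:
  assumes "x \<in> carrier_vec n" "y \<in> carrier_vec n"
  shows "nsq (x - y) = nsq x - 2 * Re (x \<bullet>c y) + nsq y"
proof -
  have "Re ((x - y) \<bullet>c (x - y)) = Re (x \<bullet>c x) - Re (x \<bullet>c y) - Re (y \<bullet>c x) + Re (y \<bullet>c y)"
    using assms by (simp add: scalar_prod_conj_simps [where n = n])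
  then show ?thesis
    using Re_scalar_prod_conj_commute [OF assms] by (simp add: Re_scalar_prod_conj_self)
qed

lemma cauchy_schwarz_nsq:
  assumes "x \<in> carrier_vec n" "y \<in> carrier_vec n"
  shows "(cmod (x \<bullet>c y))\<^sup>2 \<le> nsq x * nsq y"
proof -
  have "cmod (x \<bullet>c y) \<le> (\<Sum>i<n. \<bar>cmod (x $ i)\<bar> * \<bar>cmod (y $ i)\<bar>)"
    using assms
    by (auto simp: scalar_prod_def lessThan_atLeast0 norm_mult intro!: order.trans [OF norm_sum])
  also have "\<dots> \<le> L2_set (\<lambda>i. cmod (x $ i)) {..<n} * L2_set (\<lambda>i. cmod (y $ i)) {..<n}"
    by (rule L2_set_mult_ineq)
  finally have "(cmod (x \<bullet>c y))\<^sup>2 \<le> (L2_set (\<lambda>i. cmod (x $ i)) {..<n} * L2_set (\<lambda>i. cmod (y $ i)) {..<n})\<^sup>2"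
    by (intro power_mono) auto
  then show ?thesis
    using assms by (simp add: nsq_def L2_set_def power_mult_distrib sum_nonneg)
qed

section \<open>Adjoint matrices\<close>

lemma mat_adjoint_carrier [simp]:
  "M \<in> carrier_mat n m \<Longrightarrow> mat_adjoint M \<in> carrier_mat m n"
  by (auto simp: mat_adjoint_def)

lemma index_mat_adjoint [simp]:
  fixes M :: "complex Matrix.mat"
  assumes "i < dim_col M" "j < dim_row M"
  shows "mat_adjoint M $$ (i, j) = cnj (M $$ (j, i))"
  using assms by (simp add: mat_adjoint_def mat_of_rows_def)

lemma dim_mat_adjoint [simp]:
  "dim_row (mat_adjoint M) = dim_col M" "dim_col (mat_adjoint M) = dim_row M"
  by (simp_all add: mat_adjoint_def)

lemma mat_adjoint_adjoint [simp]:
  fixes M :: "complex Matrix.mat"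
  shows "mat_adjoint (mat_adjoint M) = M"
  by (rule eq_matI) auto

lemma mult_mat_vec_scalar_prod_conj:
  fixes M :: "complex Matrix.mat"
  assumes "M \<in> carrier_mat n m" "x \<in> carrier_vec m" "y \<in> carrier_vec n"
  shows "(M *\<^sub>v x) \<bullet>c y = x \<bullet>c (mat_adjoint M *\<^sub>v y)"
proof -
  have "(M *\<^sub>v x) \<bullet>c y = (\<Sum>i<n. \<Sum>j<m. M $$ (i, j) * x $ j * cnj (y $ i))"
    using assms by (auto simp: scalar_prod_def lessThan_atLeast0 sum_distrib_right intro!: sum.cong)
  also have "\<dots> = (\<Sum>j<m. \<Sum>i<n. M $$ (i, j) * x $ j * cnj (y $ i))"
    by (rule sum.swap)
  also have "\<dots> = x \<bullet>c (mat_adjoint M *\<^sub>v y)"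
    using assms
    by (auto simp: scalar_prod_def lessThan_atLeast0 sum_distrib_left intro!: sum.cong)
  finally show ?thesis .
qed

lemma mat_adjoint_scalar_prod_conj:
  fixes M :: "complex Matrix.mat"
  assumes "M \<in> carrier_mat n m" "x \<in> carrier_vec n" "y \<in> carrier_vec m"
  shows "(mat_adjoint M *\<^sub>v x) \<bullet>c y = x \<bullet>c (M *\<^sub>v y)"
  using mult_mat_vec_scalar_prod_conj [of "mat_adjoint M" m n x y] assms by simp

lemma mat_eqI_mult_vec:
  fixes M N :: "complex Matrix.mat"
  assumes "M \<in> carrier_mat n m" "N \<in> carrier_mat n m"
    and "\<And>x. x \<in> carrier_vec m \<Longrightarrow> M *\<^sub>v x = N *\<^sub>v x"
  shows "M = N"
proof (rule eq_matI)
  fix i j assume "i < dim_row N" "j < dim_col N"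
  then have ij: "i < n" "j < m" using assms by auto
  have "(M *\<^sub>v unit_vec m j) $ i = (N *\<^sub>v unit_vec m j) $ i"
    using assms by simp
  moreover have "(K *\<^sub>v unit_vec m j) $ i = K $$ (i, j)" if "K \<in> carrier_mat n m" for K :: "complex Matrix.mat"
    using that ij by auto
  ultimately show "M $$ (i, j) = N $$ (i, j)"
    using assms(1,2) by metis
qed (use assms in auto)

section \<open>Hermitian matrices and their quadratic forms\<close>

definition hermitian :: "nat \<Rightarrow> complex Matrix.mat \<Rightarrow> bool" where
  "hermitian n M \<longleftrightarrow> M \<in> carrier_mat n n \<and> mat_adjoint M = M"

lemma hermitian_carrier: "hermitian n M \<Longrightarrow> M \<in> carrier_mat n n"
  by (simp add: hermitian_def)

lemma hermitian_scalar_prod_conj: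
  assumes "hermitian n M" "x \<in> carrier_vec n" "y \<in> carrier_vec n"
  shows "(M *\<^sub>v x) \<bullet>c y = x \<bullet>c (M *\<^sub>v y)"
  using assms mult_mat_vec_scalar_prod_conj [of M n n x y] by (simp add: hermitian_def)

lemma hermitian_Im_0:
  assumes "hermitian n M" "x \<in> carrier_vec n"
  shows "(M *\<^sub>v x) \<bullet>c x = of_real (Re ((M *\<^sub>v x) \<bullet>c x))"
proof -
  have "M *\<^sub>v x \<in> carrier_vec n"
    using assms by (auto simp: hermitian_def)
  then have "cnj ((M *\<^sub>v x) \<bullet>c x) = (M *\<^sub>v x) \<bullet>c x"
    using assms cnj_scalar_prod_conj [of "M *\<^sub>v x" n x] by (simp add: hermitian_scalar_prod_conj)
  then show ?thesis
    by (simp add: Reals_cnj_iff [symmetric] complex_is_Real_iff complex_eq_iff)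
qed

lemma hermitian_form_add:
  assumes "hermitian n M" "x \<in> carrier_vec n" "y \<in> carrier_vec n"
  shows "Re ((M *\<^sub>v (x + y)) \<bullet>c (x + y)) =
    Re ((M *\<^sub>v x) \<bullet>c x) + 2 * Re ((M *\<^sub>v x) \<bullet>c y) + Re ((M *\<^sub>v y) \<bullet>c y)"
proof -
  have M: "M \<in> carrier_mat n n" using assms hermitian_carrier by blast
  have "Re ((M *\<^sub>v y) \<bullet>c x) = Re ((M *\<^sub>v x) \<bullet>c y)"
    using assms M Re_scalar_prod_conj_commute [of y n "M *\<^sub>v x"]
    by (simp add: hermitian_scalar_prod_conj)
  then show ?thesis
    using assms M
    by (simp add: mult_add_distrib_mat_vec [of M n n] scalar_prod_conj_simps [where n = n])
qed

lemma hermitian_smult_form: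
  assumes "M \<in> carrier_mat n n" "x \<in> carrier_vec n"
  shows "Re ((M *\<^sub>v (c \<cdot>\<^sub>v x)) \<bullet>c (c \<cdot>\<^sub>v x)) = (cmod c)\<^sup>2 * Re ((M *\<^sub>v x) \<bullet>c x)"
proof -
  have "(M *\<^sub>v (c \<cdot>\<^sub>v x)) \<bullet>c (c \<cdot>\<^sub>v x) = (c * cnj c) * ((M *\<^sub>v x) \<bullet>c x)"
    using assms by (simp add: mult_mat_vec [of M n n] scalar_prod_conj_simps [where n = n])
  then show ?thesis
    by (simp only: complex_norm_square [symmetric]) simp
qed

text \<open>With w = M x, the form at x + t w equals 2 t |w|^2 + t^2 c, where c is the form at w. A
  negative t of small modulus would make this negative unless w = 0.\<close>

lemma psd_null_vector:
  assumes M: "hermitian n M" and x: "x \<in> carrier_vec n"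
    and psd: "\<And>y. y \<in> carrier_vec n \<Longrightarrow> 0 \<le> Re ((M *\<^sub>v y) \<bullet>c y)"
    and null: "Re ((M *\<^sub>v x) \<bullet>c x) = 0"
  shows "M *\<^sub>v x = 0\<^sub>v n"
proof -
  have Mc: "M \<in> carrier_mat n n" using M hermitian_carrier by blast
  define w where "w = M *\<^sub>v x"
  have w: "w \<in> carrier_vec n" using Mc x by (simp add: w_def)
  define c where "c = Re ((M *\<^sub>v w) \<bullet>c w)"
  have ineq: "0 \<le> 2 * t * nsq w + t\<^sup>2 * c" for t :: real
  proof -
    have tw: "of_real t \<cdot>\<^sub>v w \<in> carrier_vec n" using w by simp
    have "0 \<le> Re ((M *\<^sub>v (x + of_real t \<cdot>\<^sub>v w)) \<bullet>c (x + of_real t \<cdot>\<^sub>v w))"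
      using x w by (intro psd) simp
    also have "\<dots> = 2 * Re (w \<bullet>c (of_real t \<cdot>\<^sub>v w)) + t\<^sup>2 * c"
      using hermitian_form_add [OF M x tw] hermitian_smult_form [OF Mc w, of "of_real t"] null
      by (simp add: w_def [symmetric] c_def)
    also have "Re (w \<bullet>c (of_real t \<cdot>\<^sub>v w)) = t * nsq w"
      by (simp add: scalar_prod_conj_simps(6) [OF w w w] scalar_prod_conj_self)
    finally show ?thesis by simp
  qed
  have c: "0 \<le> c" using psd w by (simp add: c_def)
  have "nsq w = 0"
  proof (rule ccontr)
    assume "nsq w \<noteq> 0"
    then have pos: "0 < nsq w" using nsq_nonneg [of w] by linarith
    \<comment> \<open>For c > 0 any t strictly between -2 |w|^2 / c and 0 would do; the denominator
      c + 1 also covers c = 0.\<close>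
    define t where "t = - nsq w / (c + 1)"
    have "t * (c + 1) = - nsq w" using c by (simp add: t_def)
    moreover have "t < 0" using pos c by (simp add: t_def divide_neg_pos)
    ultimately have "t * c = - nsq w - t" "t * nsq w < 0" "t < 0"
      using pos by (auto simp: algebra_simps mult_neg_pos)
    moreover have "2 * t * nsq w + t\<^sup>2 * c = 2 * (t * nsq w) + t * (t * c)"
      by (simp add: power2_eq_square)
    ultimately have "2 * t * nsq w + t\<^sup>2 * c = 2 * (t * nsq w) + t * (- nsq w - t)"
      by (simp only:)
    also have "\<dots> = t * nsq w - t * t"
      by (simp add: algebra_simps)
    finally have "2 * t * nsq w + t\<^sup>2 * c = t * nsq w - t * t" .
    then have "2 * t * nsq w + t\<^sup>2 * c < 0"
      using \<open>t * nsq w < 0\<close> zero_le_square [of t] by linarith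
    then show False using ineq [of t] by simp
  qed
  then show ?thesis using nsq_eq_0_iff [OF w] by (simp add: w_def)
qed

section \<open>Rayleigh quotients and Lyapunov inequalities\<close>

text \<open>Vectors and matrices are represented by functions of their indices, so that extremal
  arguments can use the product topology. Pinning the values off the index set to 0 makes every
  factor compact, and Tychonoff's theorem applies.\<close>

lemma compact_bounded_functions:
  "compact {f :: 'i \<Rightarrow> complex. (\<forall>i. if i \<in> I then cmod (f i) \<le> r else f i = 0)}"
proof -
  let ?S = "\<lambda>i. if i \<in> I then cball (0 :: complex) r else {0}"
  have "compactin (product_topology (\<lambda>_. euclidean) UNIV) (PiE UNIV ?S)"
    by (auto simp: compactin_PiE)
  then have "compact (PiE UNIV ?S)"
    by (simp add: euclidean_product_topology)
  moreover have "PiE UNIV ?S = {f. \<forall>i. f i \<in> ?S i}"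
    by (auto simp: PiE_def Pi_def)
  moreover have "{f. \<forall>i. f i \<in> ?S i} = {f. \<forall>i. if i \<in> I then cmod (f i) \<le> r else f i = 0}"
    by (intro Collect_cong all_cong1) simp
  ultimately show ?thesis by simp
qed

lemma hermitian_index:
  assumes "hermitian n M" "i < n" "j < n"
  shows "cnj (M $$ (j, i)) = M $$ (i, j)"
proof -
  have "M \<in> carrier_mat n n" and a: "mat_adjoint M = M"
    using assms(1) by (auto simp: hermitian_def)
  then show ?thesis using index_mat_adjoint [of i M j] assms(2,3) by simp
qed

lemma hermitianI:
  assumes "M \<in> carrier_mat n n" "\<And>i j. i < n \<Longrightarrow> j < n \<Longrightarrow> cnj (M $$ (j, i)) = M $$ (i, j)"
  shows "hermitian n M"
  using assms by (auto simp: hermitian_def intro!: eq_matI)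

lemma hermitian_shift:
  assumes "hermitian n M"
  shows "hermitian n (M + of_real t \<cdot>\<^sub>m 1\<^sub>m n)"
  using hermitian_carrier [OF assms] hermitian_index [OF assms] by (intro hermitianI) auto

lemma hermitian_uminus:
  assumes "hermitian n M"
  shows "hermitian n (- M)"
  using hermitian_carrier [OF assms] hermitian_index [OF assms] by (intro hermitianI) auto

lemma shift_mult_vec:
  fixes M :: "complex Matrix.mat"
  assumes "M \<in> carrier_mat n n" "x \<in> carrier_vec n"
  shows "(M + c \<cdot>\<^sub>m 1\<^sub>m n) *\<^sub>v x = M *\<^sub>v x + c \<cdot>\<^sub>v x"
proof -
  have "(c \<cdot>\<^sub>m 1\<^sub>m n) *\<^sub>v x = c \<cdot>\<^sub>v x"
    using assms(2) by (intro eq_vecI) (auto simp: scalar_prod_smult_left)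
  then show ?thesis
    using assms add_mult_distrib_mat_vec [of M n n "c \<cdot>\<^sub>m 1\<^sub>m n" x] by simp
qed

lemma mult_vec_form_sum:
  fixes M :: "complex Matrix.mat"
  assumes "M \<in> carrier_mat n n"
  shows "(M *\<^sub>v Matrix.vec n f) \<bullet>c (Matrix.vec n f) = (\<Sum>i<n. (\<Sum>j<n. M $$ (i, j) * f j) * cnj (f i))"
  using assms by (auto simp: scalar_prod_def lessThan_atLeast0 intro!: sum.cong)

text \<open>The form attains its minimum \<mu> on the unit sphere at some z. Then M - \<mu> is
  positive semidefinite with form 0 at z, so the eigenvector equation follows from
  \<open>psd_null_vector\<close> without any differentiation.\<close>

lemma rayleigh_min:
  assumes M: "hermitian n M" and n: "0 < n"
  obtains z \<mu> where "z \<in> carrier_vec n" "nsq z = 1" "M *\<^sub>v z = of_real \<mu> \<cdot>\<^sub>v z"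
    "\<And>x. x \<in> carrier_vec n \<Longrightarrow> \<mu> * nsq x \<le> Re ((M *\<^sub>v x) \<bullet>c x)"
proof -
  have Mc: "M \<in> carrier_mat n n" using M hermitian_carrier by blast
  define g where "g f = Re (\<Sum>i<n. (\<Sum>j<n. M $$ (i, j) * f j) * cnj (f i))" for f
  define S where "S = {f :: nat \<Rightarrow> complex. \<forall>i. if i \<in> {..<n} then cmod (f i) \<le> 1 else f i = 0} \<inter>
    {f. (\<Sum>i<n. (cmod (f i))\<^sup>2) = 1}"
  have "closed {f :: nat \<Rightarrow> complex. (\<Sum>i<n. (cmod (f i))\<^sup>2) = 1}"
    by (intro closed_Collect_eq continuous_intros continuous_on_product_coordinates)
  then have "compact S"
    unfolding S_def by (intro compact_Int_closed compact_bounded_functions)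
  moreover have "(\<lambda>i. if i = 0 then 1 else 0) \<in> S"
    using n by (auto simp: S_def if_distrib [of cmod] if_distrib [of "\<lambda>x. x\<^sup>2"] cong: if_cong)
  then have "S \<noteq> {}" by blast
  moreover have "continuous_on S g"
    unfolding g_def
    by (intro continuous_intros continuous_on_subset [OF continuous_on_product_coordinates subset_UNIV])
  ultimately obtain f where f: "f \<in> S" "\<And>h. h \<in> S \<Longrightarrow> g f \<le> g h"
    using continuous_attains_inf [of S g] by blast
  have g: "g h = Re ((M *\<^sub>v Matrix.vec n h) \<bullet>c Matrix.vec n h)" for h
    unfolding g_def mult_vec_form_sum [OF Mc] ..
  define z where "z = Matrix.vec n f"
  define \<mu> where "\<mu> = g f"
  have z: "z \<in> carrier_vec n" by (simp add: z_def)
  have nz: "nsq z = 1" using f(1) by (simp add: z_def nsq_def S_def)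
  have unit: "\<mu> \<le> Re ((M *\<^sub>v x) \<bullet>c x)" if x: "x \<in> carrier_vec n" "nsq x = 1" for x
  proof -
    let ?h = "\<lambda>i. if i < n then x $ i else 0"
    have sum: "(\<Sum>i<n. (cmod (x $ i))\<^sup>2) = 1" using x by (auto simp: nsq_def)
    have "cmod (x $ i) \<le> 1" if "i < n" for i
    proof -
      have "(cmod (x $ i))\<^sup>2 \<le> (\<Sum>i<n. (cmod (x $ i))\<^sup>2)"
        using that by (intro member_le_sum) auto
      then show ?thesis using sum by (simp add: abs_square_le_1)
    qed
    then have "?h \<in> S" using sum by (simp add: S_def)
    moreover have "Matrix.vec n ?h = x" using x by (intro eq_vecI) auto
    ultimately show ?thesis using f(2) [of ?h] g [of ?h] by (simp add: \<mu>_def)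
  qed
  have bound: "\<mu> * nsq x \<le> Re ((M *\<^sub>v x) \<bullet>c x)" if x: "x \<in> carrier_vec n" for x
  proof (cases "nsq x = 0")
    case True
    then show ?thesis using nsq_eq_0_iff [OF x] x Mc by simp
  next
    case False
    then have pos: "0 < nsq x" using nsq_nonneg [of x] by linarith
    define c where "c = complex_of_real (1 / sqrt (nsq x))"
    have c: "(cmod c)\<^sup>2 * nsq x = 1" using pos by (simp add: c_def norm_divide power_divide)
    then have "\<mu> \<le> (cmod c)\<^sup>2 * Re ((M *\<^sub>v x) \<bullet>c x)"
      using unit [of "c \<cdot>\<^sub>v x"] x hermitian_smult_form [OF Mc x] by (simp add: nsq_smult)
    then have "\<mu> * nsq x \<le> (cmod c)\<^sup>2 * Re ((M *\<^sub>v x) \<bullet>c x) * nsq x"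
      using pos by (simp add: mult_right_mono)
    also have "\<dots> = Re ((M *\<^sub>v x) \<bullet>c x)"
      using c by (simp add: mult.assoc mult.left_commute [of _ "Re _"])
    finally show ?thesis .
  qed
  define N where "N = M + of_real (- \<mu>) \<cdot>\<^sub>m 1\<^sub>m n"
  have N: "hermitian n N" unfolding N_def by (rule hermitian_shift [OF M])
  have form: "Re ((N *\<^sub>v x) \<bullet>c x) = Re ((M *\<^sub>v x) \<bullet>c x) - \<mu> * nsq x" if "x \<in> carrier_vec n" for x
    using that Mc unfolding N_def
    by (simp add: shift_mult_vec scalar_prod_conj_simps [where n = n] scalar_prod_conj_self)
  have "N *\<^sub>v z = 0\<^sub>v n"
  proof (rule psd_null_vector [OF N z])
    show "Re ((N *\<^sub>v z) \<bullet>c z) = 0"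
      using form [OF z] nz g [of f] by (simp add: \<mu>_def z_def)
  qed (use form bound in auto)
  then have "M *\<^sub>v z + of_real (- \<mu>) \<cdot>\<^sub>v z = 0\<^sub>v n"
    using shift_mult_vec [OF Mc z] by (simp add: N_def)
  then have eq: "(M *\<^sub>v z + of_real (- \<mu>) \<cdot>\<^sub>v z) $ i = 0" if "i < n" for i
    using that by simp
  have "(M *\<^sub>v z) $ i = of_real \<mu> * z $ i" if "i < n" for i
    using eq [OF that] that z Mc by (simp del: index_mult_mat_vec)
  then have "M *\<^sub>v z = of_real \<mu> \<cdot>\<^sub>v z"
    using z Mc by (intro eq_vecI) (simp_all del: index_mult_mat_vec)
  with z nz bound show thesis by (intro that)
qed

lemma rayleigh_max:
  assumes M: "hermitian n M" and n: "0 < n"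
  obtains z \<mu> where "z \<in> carrier_vec n" "nsq z = 1" "M *\<^sub>v z = of_real \<mu> \<cdot>\<^sub>v z"
    "\<And>x. x \<in> carrier_vec n \<Longrightarrow> Re ((M *\<^sub>v x) \<bullet>c x) \<le> \<mu> * nsq x"
proof -
  have Mc: "M \<in> carrier_mat n n" using M hermitian_carrier by blast
  obtain z \<mu> where z: "z \<in> carrier_vec n" "nsq z = 1" "(- M) *\<^sub>v z = of_real \<mu> \<cdot>\<^sub>v z"
    and b: "\<And>x. x \<in> carrier_vec n \<Longrightarrow> \<mu> * nsq x \<le> Re (((- M) *\<^sub>v x) \<bullet>c x)"
    using rayleigh_min [OF hermitian_uminus [OF M] n] by blast
  have um: "(- M) *\<^sub>v x = - (M *\<^sub>v x)" if "x \<in> carrier_vec n" for x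
    using that Mc by simp
  have "M *\<^sub>v z = of_real (- \<mu>) \<cdot>\<^sub>v z"
  proof (rule eq_vecI)
    fix i assume "i < dim_vec (of_real (- \<mu>) \<cdot>\<^sub>v z)"
    then have i: "i < n" using z by simp
    have "(- (M *\<^sub>v z)) $ i = (of_real \<mu> \<cdot>\<^sub>v z) $ i" using z(3) um [OF z(1)] by simp
    then have "- ((M *\<^sub>v z) $ i) = of_real \<mu> * z $ i"
      using i z(1) Mc by (simp del: index_mult_mat_vec)
    then have "(M *\<^sub>v z) $ i = - (of_real \<mu> * z $ i)"
      by (simp only: minus_equation_iff [of _ "of_real \<mu> * z $ i"])
    then show "(M *\<^sub>v z) $ i = (of_real (- \<mu>) \<cdot>\<^sub>v z) $ i"
      using i z(1) by simp
  qed (use z Mc in simp)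
  moreover have "Re ((M *\<^sub>v x) \<bullet>c x) \<le> (- \<mu>) * nsq x" if x: "x \<in> carrier_vec n" for x
    using b [OF x] um [OF x] x Mc by (simp add: scalar_prod_uminus_left)
  ultimately show thesis using z that by blast
qed

text \<open>A Lyapunov inequality is decided at an eigenvector of \<open>M\<close> for its smallest eigenvalue.\<close>

lemma lyapunov_psd:
  assumes M: "hermitian n M" and W: "W \<in> carrier_mat n n"
    and acc: "\<And>x. x \<in> carrier_vec n \<Longrightarrow> x \<noteq> 0\<^sub>v n \<Longrightarrow> 0 < Re ((W *\<^sub>v x) \<bullet>c x)"
    and lyap: "\<And>x. x \<in> carrier_vec n \<Longrightarrow> 0 \<le> Re ((M *\<^sub>v x) \<bullet>c (W *\<^sub>v x))"
    and x: "x \<in> carrier_vec n"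
  shows "0 \<le> Re ((M *\<^sub>v x) \<bullet>c x)"
proof (cases "n = 0")
  case True
  then show ?thesis using x hermitian_carrier [OF M] by (auto simp: scalar_prod_def)
next
  case False
  then obtain z \<mu> where z: "z \<in> carrier_vec n" "nsq z = 1" "M *\<^sub>v z = of_real \<mu> \<cdot>\<^sub>v z"
    and b: "\<And>x. x \<in> carrier_vec n \<Longrightarrow> \<mu> * nsq x \<le> Re ((M *\<^sub>v x) \<bullet>c x)"
    using rayleigh_min [OF M] by blast
  have Wz: "W *\<^sub>v z \<in> carrier_vec n" using W z by simp
  have "z \<noteq> 0\<^sub>v n" using z nsq_eq_0_iff [of z n] by auto
  then have "0 < Re ((W *\<^sub>v z) \<bullet>c z)" using acc z by blast
  \<comment> \<open>As M z = \<mu> z with real \<mu>, the Lyapunov form at z is \<mu> times a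
    positive number.\<close>
  moreover have "Re ((M *\<^sub>v z) \<bullet>c (W *\<^sub>v z)) = \<mu> * Re ((W *\<^sub>v z) \<bullet>c z)"
    using z Wz Re_scalar_prod_conj_commute [OF Wz z(1)]
    by (simp add: scalar_prod_conj_simps(5) [OF z(1) z(1) Wz])
  ultimately have "0 \<le> \<mu>"
    using lyap [OF z(1)] by (simp add: zero_le_mult_iff)
  then show ?thesis using b [OF x] mult_nonneg_nonneg [of \<mu> "nsq x"] nsq_nonneg [of x] by linarith
qed

text \<open>A vanishing form is positive semidefinite and null at every vector, so
  \<open>psd_null_vector\<close> applies everywhere.\<close>

lemma hermitian_form_zero:
  assumes M: "hermitian n M" and "\<And>x. x \<in> carrier_vec n \<Longrightarrow> Re ((M *\<^sub>v x) \<bullet>c x) = 0"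
  shows "M = 0\<^sub>m n n"
proof (rule mat_eqI_mult_vec)
  show "M \<in> carrier_mat n n" using M hermitian_carrier by blast
  show "M *\<^sub>v x = 0\<^sub>m n n *\<^sub>v x" if "x \<in> carrier_vec n" for x
    using psd_null_vector [OF M that] assms(2) that by (intro eq_vecI) auto
qed simp

text \<open>\<open>lyapunov_psd\<close> applies to M and to -M.\<close>

lemma lyapunov_zero:
  assumes M: "hermitian n M" and W: "W \<in> carrier_mat n n"
    and acc: "\<And>x. x \<in> carrier_vec n \<Longrightarrow> x \<noteq> 0\<^sub>v n \<Longrightarrow> 0 < Re ((W *\<^sub>v x) \<bullet>c x)"
    and lyap: "\<And>x. x \<in> carrier_vec n \<Longrightarrow> Re ((M *\<^sub>v x) \<bullet>c (W *\<^sub>v x)) = 0"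
  shows "M = 0\<^sub>m n n"
proof (rule hermitian_form_zero [OF M])
  fix x :: "complex Matrix.vec" assume x: "x \<in> carrier_vec n"
  have Mc: "M \<in> carrier_mat n n" using M hermitian_carrier by blast
  have um: "((- M) *\<^sub>v y) \<bullet>c w = - ((M *\<^sub>v y) \<bullet>c w)" if "y \<in> carrier_vec n" "w \<in> carrier_vec n" for y w
    using that Mc by (simp add: scalar_prod_uminus_left)
  have "0 \<le> Re ((M *\<^sub>v x) \<bullet>c x)"
    using lyapunov_psd [OF M W acc _ x] lyap by simp
  moreover have "0 \<le> Re (((- M) *\<^sub>v x) \<bullet>c x)"
    using lyapunov_psd [OF hermitian_uminus [OF M] W acc _ x] lyap um W by simp
  ultimately show "Re ((M *\<^sub>v x) \<bullet>c x) = 0"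
    using um [OF x x] by simp
qed

section \<open>The Lyapunov equation\<close>

lemma mat_adjoint_mult_vec_carrier [simp]:
  "M \<in> carrier_mat n m \<Longrightarrow> x \<in> carrier_vec n \<Longrightarrow> mat_adjoint M *\<^sub>v x \<in> carrier_vec m"
  by (rule mult_mat_vec_carrier [OF mat_adjoint_carrier])

text \<open>A kernel vector would have form 0, so K is injective and hence invertible.\<close>

lemma accretive_solvable:
  fixes K :: "complex Matrix.mat"
  assumes K: "K \<in> carrier_mat n n"
    and acc: "\<And>x. x \<in> carrier_vec n \<Longrightarrow> x \<noteq> 0\<^sub>v n \<Longrightarrow> 0 < Re ((K *\<^sub>v x) \<bullet>c x)"
    and c: "c \<in> carrier_vec n"
  obtains e where "e \<in> carrier_vec n" "K *\<^sub>v e = c"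
proof -
  have "det K \<noteq> 0"
  proof
    assume "det K = 0"
    then obtain v where v: "v \<in> carrier_vec n" "v \<noteq> 0\<^sub>v n" "K *\<^sub>v v = 0\<^sub>v n"
      using det_0_iff_vec_prod_zero [OF K] by blast
    then show False using acc [of v] by simp
  qed
  then obtain J where J: "J \<in> carrier_mat n n" "K * J = 1\<^sub>m n"
    using det_non_zero_imp_unit [OF K, of "()"] by (auto simp: Units_def ring_mat_def)
  have "K *\<^sub>v (J *\<^sub>v c) = c"
    using assoc_mult_mat_vec [OF K J(1) c] J(2) c by simp
  then show thesis using J c that [of "J *\<^sub>v c"] by simp
qed

text \<open>The roots of the characteristic polynomial form the diagonal of T, which makes the
  diagonal entries eigenvalues. Both the Sylvester equation and the trace estimate in
  \<open>gamma_decay_le\<close> rest on this.\<close>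

lemma schur_complex:
  fixes W :: "complex Matrix.mat"
  assumes W: "W \<in> carrier_mat n n"
  obtains T P Q where "T \<in> carrier_mat n n" "P \<in> carrier_mat n n" "Q \<in> carrier_mat n n"
    "P * Q = 1\<^sub>m n" "Q * P = 1\<^sub>m n" "W = P * T * Q" "upper_triangular T"
    "\<And>j. j < n \<Longrightarrow> eigenvalue W (T $$ (j, j))"
proof -
  obtain es where es: "char_poly W = (\<Prod>a\<leftarrow>es. [:- a, 1:])"
    using char_poly_factorized [OF W] by blast
  obtain T P Q where "schur_decomposition W es = (T, P, Q)"
    by (cases "schur_decomposition W es") auto
  from schur_decomposition [OF W es this]
  have sim: "similar_mat_wit W T P Q" and tri: "upper_triangular T" and diag: "diag_mat T = es"
    by auto
  from similar_mat_witD2 [OF W sim]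
  have T: "T \<in> carrier_mat n n" "P \<in> carrier_mat n n" "Q \<in> carrier_mat n n"
    "P * Q = 1\<^sub>m n" "Q * P = 1\<^sub>m n" "W = P * T * Q"
    by auto
  have "eigenvalue W (T $$ (j, j))" if j: "j < n" for j
  proof -
    have "T $$ (j, j) \<in> set es"
      using j T(1) unfolding diag [symmetric] diag_mat_def by auto
    then have "poly (char_poly W) (T $$ (j, j)) = 0"
      unfolding es by (auto simp: poly_prod_list prod_list_zero_iff)
    then show ?thesis using eigenvalue_root_char_poly [OF W] by simp
  qed
  with T tri show thesis by (intro that)
qed

lemma eigenvalueE:
  fixes W :: "complex Matrix.mat"
  assumes "eigenvalue W t" "W \<in> carrier_mat n n"
  obtains x where "x \<in> carrier_vec n" "x \<noteq> 0\<^sub>v n" "W *\<^sub>v x = t \<cdot>\<^sub>v x"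
  using assms by (auto simp: eigenvalue_def eigenvector_def)

lemma eigenvalue_accretive:
  fixes W :: "complex Matrix.mat"
  assumes W: "W \<in> carrier_mat n n"
    and acc: "\<And>x. x \<in> carrier_vec n \<Longrightarrow> x \<noteq> 0\<^sub>v n \<Longrightarrow> 0 < Re ((W *\<^sub>v x) \<bullet>c x)"
    and "eigenvalue W t"
  shows "0 < Re t"
proof -
  obtain x where x: "x \<in> carrier_vec n" "x \<noteq> 0\<^sub>v n" "W *\<^sub>v x = t \<cdot>\<^sub>v x"
    using eigenvalueE [OF assms(3) W] .
  have "0 < Re (t * of_real (nsq x))"
    using acc [OF x(1,2)] x(1,3)
    by (simp add: scalar_prod_conj_simps(5) [OF x(1) x(1) x(1)] scalar_prod_conj_self)
  then have "0 < Re t * nsq x" by simp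
  then show ?thesis using nsq_nonneg [of x] by (simp add: zero_less_mult_iff)
qed

text \<open>The columns of \<open>E\<close> are found one after the other.\<close>

lemma sylvester_triangular:
  fixes K T C :: "complex Matrix.mat"
  assumes K: "K \<in> carrier_mat n n"
    and acc: "\<And>x. x \<in> carrier_vec n \<Longrightarrow> x \<noteq> 0\<^sub>v n \<Longrightarrow> 0 < Re ((K *\<^sub>v x) \<bullet>c x)"
    and T: "T \<in> carrier_mat n n" "upper_triangular T" "\<And>j. j < n \<Longrightarrow> 0 < Re (T $$ (j, j))"
    and C: "C \<in> carrier_mat n n"
  obtains E where "E \<in> carrier_mat n n" "E * T + K * E = C"
proof -
  \<comment> \<open>This is column j of the equation: as T is upper triangular, column j of E T
    involves only columns up to j of E, and those with k < j are moved to the right.\<close>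
  define good where "good e j \<longleftrightarrow> e j \<in> carrier_vec n \<and>
    K *\<^sub>v e j + T $$ (j, j) \<cdot>\<^sub>v e j = Matrix.vec n (\<lambda>i. C $$ (i, j) - (\<Sum>k<j. T $$ (k, j) * e k $ i))" for e j
  have "\<exists>e. \<forall>j<p. good e j" if "p \<le> n" for p
    using that
  proof (induction p)
    case 0
    then show ?case by simp
  next
    case (Suc p)
    then obtain e where e: "\<forall>j<p. good e j" by auto
    let ?t = "T $$ (p, p)"
    let ?K = "K + ?t \<cdot>\<^sub>m 1\<^sub>m n"
    let ?c = "Matrix.vec n (\<lambda>i. C $$ (i, p) - (\<Sum>k<p. T $$ (k, p) * e k $ i))"
    \<comment> \<open>A shift by a scalar with positive real part keeps K accretive, so the equation
      for the new column is solvable.\<close>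
    have "0 < Re ((?K *\<^sub>v x) \<bullet>c x)" if x: "x \<in> carrier_vec n" "x \<noteq> 0\<^sub>v n" for x
    proof -
      have "(?K *\<^sub>v x) \<bullet>c x = (K *\<^sub>v x) \<bullet>c x + ?t * of_real (nsq x)"
        using x K by (simp add: shift_mult_vec scalar_prod_conj_simps [where n = n] scalar_prod_conj_self)
      moreover have "0 \<le> Re ?t * nsq x" using T(3) [of p] Suc.prems by simp
      ultimately show ?thesis using acc [OF x] by simp
    qed
    then obtain u where u: "u \<in> carrier_vec n" "?K *\<^sub>v u = ?c"
      using accretive_solvable [of ?K n ?c] K by auto
    \<comment> \<open>\<open>good e j\<close> looks only at columns up to j, so setting column p
      does not disturb the earlier ones.\<close>
    have "good (e(p := u)) j" if "j < Suc p" for j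
    proof (cases "j = p")
      case True
      then show ?thesis using u shift_mult_vec [OF K u(1), of ?t] by (simp add: good_def)
    next
      case False
      then show ?thesis using e that by (simp add: good_def)
    qed
    then show ?case by blast
  qed
  then obtain e where e: "\<And>j. j < n \<Longrightarrow> good e j" by blast
  define E where "E = Matrix.mat n n (\<lambda>(i, j). e j $ i)"
  have E: "E \<in> carrier_mat n n" by (simp add: E_def)
  have col: "col E j = e j" if "j < n" for j
    using that e [OF that] by (intro eq_vecI) (auto simp: E_def good_def)
  have "E * T + K * E = C"
  proof (rule eq_matI)
    fix i j assume "i < dim_row C" "j < dim_col C"
    then have ij: "i < n" "j < n" using C by auto
    have ej: "e j \<in> carrier_vec n" using e [OF ij(2)] by (simp add: good_def)
    have "(E * T) $$ (i, j) = (\<Sum>k<n. e k $ i * T $$ (k, j))"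
      using ij T(1) by (simp add: E_def scalar_prod_def lessThan_atLeast0)
    also have "\<dots> = (\<Sum>k<Suc j. e k $ i * T $$ (k, j))"
      using ij T(1) upper_triangularD [OF T(2)] by (intro sum.mono_neutral_right) auto
    finally have ET: "(E * T) $$ (i, j) = (\<Sum>k<j. T $$ (k, j) * e k $ i) + T $$ (j, j) * e j $ i"
      by (simp add: mult.commute)
    have KE: "(K * E) $$ (i, j) = (K *\<^sub>v e j) $ i"
      using ij K E col by simp
    have "(K *\<^sub>v e j + T $$ (j, j) \<cdot>\<^sub>v e j) $ i = C $$ (i, j) - (\<Sum>k<j. T $$ (k, j) * e k $ i)"
      using e [OF ij(2)] ij by (simp add: good_def)
    moreover have "(K *\<^sub>v e j + T $$ (j, j) \<cdot>\<^sub>v e j) $ i = (K *\<^sub>v e j) $ i + T $$ (j, j) * e j $ i"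
      using ij ej K by simp
    ultimately have "(K *\<^sub>v e j) $ i + T $$ (j, j) * e j $ i = C $$ (i, j) - (\<Sum>k<j. T $$ (k, j) * e k $ i)"
      by (simp only:)
    then have "(E * T) $$ (i, j) + (K * E) $$ (i, j) = C $$ (i, j)"
      unfolding ET KE by (simp add: eq_diff_eq ac_simps)
    then show "(E * T + K * E) $$ (i, j) = C $$ (i, j)"
      using ij K E T(1) by simp
  qed (use K E T C in auto)
  with E show thesis by (intro that)
qed

text \<open>With W = P T Q and F = E P, the equation for E becomes
  \<open>F * T + mat_adjoint W * F = C * P\<close>, whose coefficient T is triangular. The real part
  of the form of the equation involves E only through the sum of E and its adjoint, hence the
  Hermitian part N.\<close>

lemma lyapunov_solution:
  assumes W: "W \<in> carrier_mat n n"
    and acc: "\<And>x. x \<in> carrier_vec n \<Longrightarrow> x \<noteq> 0\<^sub>v n \<Longrightarrow> 0 < Re ((W *\<^sub>v x) \<bullet>c x)"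
    and C: "hermitian n C"
  obtains N where "hermitian n N"
    "\<And>x. x \<in> carrier_vec n \<Longrightarrow> 2 * Re ((N *\<^sub>v x) \<bullet>c (W *\<^sub>v x)) = Re ((C *\<^sub>v x) \<bullet>c x)"
proof -
  obtain T P Q where T: "T \<in> carrier_mat n n" "P \<in> carrier_mat n n" "Q \<in> carrier_mat n n"
    "P * Q = 1\<^sub>m n" "Q * P = 1\<^sub>m n" "W = P * T * Q" "upper_triangular T"
    "\<And>j. j < n \<Longrightarrow> eigenvalue W (T $$ (j, j))"
    using schur_complex [OF W] by blast
  have Cc: "C \<in> carrier_mat n n" using C hermitian_carrier by blast
  have "0 < Re ((mat_adjoint W *\<^sub>v x) \<bullet>c x)" if "x \<in> carrier_vec n" "x \<noteq> 0\<^sub>v n" for x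
    using acc [OF that] that W mat_adjoint_scalar_prod_conj [OF W that(1) that(1)]
      Re_scalar_prod_conj_commute [of x n "W *\<^sub>v x"] by simp
  then obtain F where F: "F \<in> carrier_mat n n" "F * T + mat_adjoint W * F = C * P"
    using sylvester_triangular [of "mat_adjoint W" n T "C * P"] T(1,2,7) W Cc
      eigenvalue_accretive [OF W acc T(8)] by auto
  define E where "E = F * Q"
  have E: "E \<in> carrier_mat n n" using F T by (simp add: E_def)
  have "E * W = F * T * Q"
  proof -
    have "E * W = F * (Q * W)"
      using F(1) T(3) W by (simp add: E_def assoc_mult_mat [of _ n n _ n _ n])
    also have "Q * W = (Q * P) * (T * Q)"
      using T(1-3) unfolding T(6) by (simp add: assoc_mult_mat [of _ n n _ n _ n])
    also have "\<dots> = T * Q" using T(1,3,5) by simp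
    finally show ?thesis using F(1) T(1,3) by simp
  qed
  moreover have "mat_adjoint W * E = mat_adjoint W * F * Q"
    using F(1) T(3) W by (simp add: E_def assoc_mult_mat [of _ n n _ n _ n])
  moreover have "mat_adjoint W * F \<in> carrier_mat n n" "F * T \<in> carrier_mat n n"
    using F(1) T(1) W by (auto intro: mult_carrier_mat mat_adjoint_carrier)
  ultimately have "E * W + mat_adjoint W * E = (F * T + mat_adjoint W * F) * Q"
    using T(3) by (simp only: add_mult_distrib_mat [of _ n n _ _ n])
  also have "\<dots> = C * (P * Q)"
    using F(2) Cc T(2,3) by (simp add: assoc_mult_mat [of _ n n _ n _ n])
  finally have syl: "E * W + mat_adjoint W * E = C"
    using Cc T(4) by simp
  define N where "N = (1 / 2) \<cdot>\<^sub>m (E + mat_adjoint E)"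
  have N: "hermitian n N" using E by (intro hermitianI) (auto simp: N_def)
  have "2 * Re ((N *\<^sub>v x) \<bullet>c (W *\<^sub>v x)) = Re ((C *\<^sub>v x) \<bullet>c x)" if x: "x \<in> carrier_vec n" for x
  proof -
    have Wx: "W *\<^sub>v x \<in> carrier_vec n" and Ex: "E *\<^sub>v x \<in> carrier_vec n"
      and Esx: "mat_adjoint E *\<^sub>v x \<in> carrier_vec n"
      using W x E by auto
    have "C *\<^sub>v x = E *\<^sub>v (W *\<^sub>v x) + mat_adjoint W *\<^sub>v (E *\<^sub>v x)"
      using E W x assoc_mult_mat_vec [OF mat_adjoint_carrier [OF W] E x]
        add_mult_distrib_mat_vec [OF mult_carrier_mat [OF E W] mult_carrier_mat [OF mat_adjoint_carrier [OF W] E] x]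
      by (simp add: syl [symmetric])
    then have "(C *\<^sub>v x) \<bullet>c x = (E *\<^sub>v (W *\<^sub>v x)) \<bullet>c x + (mat_adjoint W *\<^sub>v (E *\<^sub>v x)) \<bullet>c x"
      using E W x by (simp add: scalar_prod_conj_simps(1) [where n = n])
    also have "(E *\<^sub>v (W *\<^sub>v x)) \<bullet>c x = (W *\<^sub>v x) \<bullet>c (mat_adjoint E *\<^sub>v x)"
      by (rule mult_mat_vec_scalar_prod_conj [OF E Wx x])
    also have "(mat_adjoint W *\<^sub>v (E *\<^sub>v x)) \<bullet>c x = (E *\<^sub>v x) \<bullet>c (W *\<^sub>v x)"
      by (rule mat_adjoint_scalar_prod_conj [OF W Ex x])
    finally have 1: "Re ((C *\<^sub>v x) \<bullet>c x) = Re ((mat_adjoint E *\<^sub>v x) \<bullet>c (W *\<^sub>v x)) + Re ((E *\<^sub>v x) \<bullet>c (W *\<^sub>v x))"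
      using Re_scalar_prod_conj_commute [OF Wx Esx] by simp
    have "N *\<^sub>v x = (1 / 2) \<cdot>\<^sub>v ((E + mat_adjoint E) *\<^sub>v x)"
      using E x by (intro eq_vecI) (auto simp: N_def scalar_prod_smult_left)
    also have "(E + mat_adjoint E) *\<^sub>v x = E *\<^sub>v x + mat_adjoint E *\<^sub>v x"
      by (rule add_mult_distrib_mat_vec [OF E mat_adjoint_carrier [OF E] x])
    finally have "N *\<^sub>v x = (1 / 2) \<cdot>\<^sub>v (E *\<^sub>v x + mat_adjoint E *\<^sub>v x)" .
    then have "(N *\<^sub>v x) \<bullet>c (W *\<^sub>v x) = (1 / 2) * ((E *\<^sub>v x) \<bullet>c (W *\<^sub>v x) + (mat_adjoint E *\<^sub>v x) \<bullet>c (W *\<^sub>v x))"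
      using Ex Esx Wx by (simp add: scalar_prod_conj_simps [where n = n])
    then have "of_real 2 * ((N *\<^sub>v x) \<bullet>c (W *\<^sub>v x)) = (E *\<^sub>v x) \<bullet>c (W *\<^sub>v x) + (mat_adjoint E *\<^sub>v x) \<bullet>c (W *\<^sub>v x)"
      by (simp add: mult.commute)
    from arg_cong [OF this, of Re] show ?thesis using 1 by simp
  qed
  with N show thesis by (intro that)
qed

section \<open>Gram matrices and positive semidefinite matrices\<close>

lemma mat_adjoint_mult:
  fixes M N :: "complex Matrix.mat"
  assumes "M \<in> carrier_mat n k" "N \<in> carrier_mat k m"
  shows "mat_adjoint (M * N) = mat_adjoint N * mat_adjoint M"
  using assms by (intro eq_matI) (auto simp: scalar_prod_def mult.commute)

lemma mat_adjoint_minus: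
  fixes M N :: "complex Matrix.mat"
  assumes "M \<in> carrier_mat n m" "N \<in> carrier_mat n m"
  shows "mat_adjoint (M - N) = mat_adjoint M - mat_adjoint N"
  using assms by (intro eq_matI) auto

lemma hermitian_minus:
  assumes "hermitian n M" "hermitian n N"
  shows "hermitian n (M - N)"
  using hermitian_carrier [OF assms(1)] hermitian_carrier [OF assms(2)]
    hermitian_index [OF assms(1)] hermitian_index [OF assms(2)]
  by (intro hermitianI) auto

lemma hermitian_gram:
  fixes B :: "complex Matrix.mat"
  assumes "B \<in> carrier_mat n m"
  shows "hermitian n (B * mat_adjoint B)"
  using assms mat_adjoint_mult [of B n m "mat_adjoint B" n] by (simp add: hermitian_def)

lemma gram_form:
  fixes B :: "complex Matrix.mat"
  assumes B: "B \<in> carrier_mat n m" and x: "x \<in> carrier_vec n"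
  shows "((B * mat_adjoint B) *\<^sub>v x) \<bullet>c x = of_real (nsq (mat_adjoint B *\<^sub>v x))"
proof -
  have Bx: "mat_adjoint B *\<^sub>v x \<in> carrier_vec m"
    using B x mat_adjoint_carrier mult_mat_vec_carrier by blast
  have "(B * mat_adjoint B) *\<^sub>v x = B *\<^sub>v (mat_adjoint B *\<^sub>v x)"
    using B x by (simp add: assoc_mult_mat_vec [of _ n m _ n])
  then show ?thesis
    using mult_mat_vec_scalar_prod_conj [OF B Bx x] by (simp add: scalar_prod_conj_self)
qed

text \<open>This is Y^2 \<le> t Y for 0 \<le> Y \<le> t, obtained without a square root of Y:
  evaluate the nonnegative form of Y at x - (1/t) Y x and bound the term of second order by Y \<le>
  t.\<close>

lemma psd_bound:
  assumes Y: "hermitian n Y" and t: "0 < t"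
    and psd: "\<And>y. y \<in> carrier_vec n \<Longrightarrow> 0 \<le> Re ((Y *\<^sub>v y) \<bullet>c y)"
    and le: "\<And>y. y \<in> carrier_vec n \<Longrightarrow> Re ((Y *\<^sub>v y) \<bullet>c y) \<le> t * nsq y"
    and x: "x \<in> carrier_vec n"
  shows "nsq (Y *\<^sub>v x) \<le> t * Re ((Y *\<^sub>v x) \<bullet>c x)"
proof -
  have Yc: "Y \<in> carrier_mat n n" using Y hermitian_carrier by blast
  define u where "u = Y *\<^sub>v x"
  have u: "u \<in> carrier_vec n" using Yc x by (simp add: u_def)
  define c where "c = complex_of_real (- (1 / t))"
  have cu: "c \<cdot>\<^sub>v u \<in> carrier_vec n" using u by simp
  have cc: "(cmod c)\<^sup>2 = 1 / t\<^sup>2"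
    by (simp only: c_def norm_of_real) (simp add: power_divide)
  have "0 \<le> Re ((Y *\<^sub>v (x + c \<cdot>\<^sub>v u)) \<bullet>c (x + c \<cdot>\<^sub>v u))"
    using x u by (intro psd) simp
  also have "\<dots> = Re (u \<bullet>c x) + 2 * Re (u \<bullet>c (c \<cdot>\<^sub>v u)) + (cmod c)\<^sup>2 * Re ((Y *\<^sub>v u) \<bullet>c u)"
    using hermitian_form_add [OF Y x cu] hermitian_smult_form [OF Yc u] by (simp add: u_def)
  also have "Re (u \<bullet>c (c \<cdot>\<^sub>v u)) = - (1 / t) * nsq u"
    by (simp add: scalar_prod_conj_simps(6) [OF u u u] scalar_prod_conj_self c_def)
  also have "(cmod c)\<^sup>2 * Re ((Y *\<^sub>v u) \<bullet>c u) \<le> (1 / t\<^sup>2) * (t * nsq u)"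
    unfolding cc using le [OF u] by (intro mult_left_mono) auto
  finally have "0 \<le> Re (u \<bullet>c x) - nsq u / t"
    using t by (simp add: power2_eq_square)
  then show ?thesis using t by (simp add: u_def field_simps)
qed

lemma scalar_prod_conj_unit_vec:
  fixes x :: "complex Matrix.vec"
  assumes "x \<in> carrier_vec n" "i < n"
  shows "x \<bullet>c unit_vec n i = x $ i"
proof -
  have "conjugate (unit_vec n i) = (unit_vec n i :: complex Matrix.vec)"
    by (rule eq_vecI) (auto simp: unit_vec_def)
  then show ?thesis using assms by simp
qed

lemma mult_unit_vec_index:
  fixes M :: "complex Matrix.mat"
  assumes "M \<in> carrier_mat n m" "i < n" "j < m"
  shows "(M *\<^sub>v unit_vec m j) $ i = M $$ (i, j)"
  using assms by auto

lemma nsq_unit_vec [simp]: "i < n \<Longrightarrow> nsq (unit_vec n i) = 1"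
  by (simp add: nsq_def unit_vec_def if_distrib [of cmod] if_distrib [of "\<lambda>x. x\<^sup>2"] cong: if_cong)

lemma index_norm_le_nsq:
  assumes "x \<in> carrier_vec n" "i < n"
  shows "(cmod (x $ i))\<^sup>2 \<le> nsq x"
  unfolding nsq_def using assms by (intro member_le_sum) auto

text \<open>The diagonal entries are nonnegative with sum at most 0, so all are 0. Then every unit
  vector is a null vector of the form and every column vanishes.\<close>

lemma psd_trace_zero:
  assumes N: "hermitian n N"
    and psd: "\<And>y. y \<in> carrier_vec n \<Longrightarrow> 0 \<le> Re ((N *\<^sub>v y) \<bullet>c y)"
    and tr: "(\<Sum>i<n. Re (N $$ (i, i))) \<le> 0"
  shows "N = 0\<^sub>m n n"
proof -
  have Nc: "N \<in> carrier_mat n n" using N hermitian_carrier by blast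
  have form: "(N *\<^sub>v unit_vec n i) \<bullet>c unit_vec n i = N $$ (i, i)" if "i < n" for i
    using that Nc mult_unit_vec_index [OF Nc that that] scalar_prod_conj_unit_vec [of "N *\<^sub>v unit_vec n i" n i]
    by (metis mult_mat_vec_carrier unit_vec_carrier)
  have nonneg: "0 \<le> Re (N $$ (i, i))" if "i < n" for i
    using form [OF that] psd [of "unit_vec n i"] by simp
  then have "(\<Sum>i<n. Re (N $$ (i, i))) = 0"
    using tr by (intro antisym sum_nonneg) auto
  then have zero: "Re (N $$ (i, i)) = 0" if "i < n" for i
    using that nonneg by (subst (asm) sum_nonneg_eq_0_iff) auto
  have col: "N *\<^sub>v unit_vec n j = 0\<^sub>v n" if "j < n" for j
    using psd_null_vector [OF N _ psd, of "unit_vec n j"] form [OF that] zero [OF that] by simp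
  show ?thesis
    using Nc mult_unit_vec_index [OF Nc] col by (intro eq_matI) (auto simp del: index_mult_mat_vec)
qed

section \<open>Coordinates in an orthonormal basis\<close>

locale orthonormal_basis =
  fixes n :: nat and v :: "nat \<Rightarrow> complex Matrix.vec"
  assumes basis_carrier: "j < n \<Longrightarrow> v j \<in> carrier_vec n"
    and orthonormal: "j < n \<Longrightarrow> k < n \<Longrightarrow> v j \<bullet>c v k = (if j = k then 1 else 0)"
begin

definition basis_mat :: "complex Matrix.mat" where
  "basis_mat = mat_of_cols n (map v [0..<n])"

lemma basis_mat_carrier [simp]: "basis_mat \<in> carrier_mat n n"
  using mat_of_cols_carrier(1) [of n "map v [0..<n]"] by (simp add: basis_mat_def)

lemma dim_basis_mat [simp]: "dim_row basis_mat = n" "dim_col basis_mat = n"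
  using basis_mat_carrier by blast+

lemma col_basis_mat: "j < n \<Longrightarrow> col basis_mat j = v j"
  using basis_carrier by (simp add: basis_mat_def)

lemma adjoint_basis_mat_index:
  assumes "x \<in> carrier_vec n" "j < n"
  shows "(mat_adjoint basis_mat *\<^sub>v x) $ j = x \<bullet>c v j"
proof -
  have "basis_mat $$ (i, j) = v j $ i" if "i < n" for i
    using that assms(2) by (simp add: basis_mat_def mat_of_cols_index)
  then show ?thesis
    using assms basis_carrier [OF assms(2)] basis_mat_carrier
    by (auto simp: scalar_prod_def mult.commute intro!: sum.cong)
qed

lemma basis_mat_unitary:
  "mat_adjoint basis_mat * basis_mat = 1\<^sub>m n" "basis_mat * mat_adjoint basis_mat = 1\<^sub>m n"
proof -
  show 1: "mat_adjoint basis_mat * basis_mat = 1\<^sub>m n"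
  proof (rule eq_matI)
    fix i j assume "i < dim_row (1\<^sub>m n :: complex Matrix.mat)" "j < dim_col (1\<^sub>m n :: complex Matrix.mat)"
    then have ij: "i < n" "j < n" by auto
    have "(mat_adjoint basis_mat * basis_mat) $$ (i, j) = (mat_adjoint basis_mat *\<^sub>v v j) $ i"
      using ij basis_mat_carrier col_basis_mat
      by (metis carrier_matD col_dim dim_mat_adjoint(1) index_mult_mat(1) index_mult_mat_vec)
    also have "\<dots> = v j \<bullet>c v i"
      using ij basis_carrier by (intro adjoint_basis_mat_index)
    also have "\<dots> = 1\<^sub>m n $$ (i, j)"
      using ij orthonormal by auto
    finally show "(mat_adjoint basis_mat * basis_mat) $$ (i, j) = 1\<^sub>m n $$ (i, j)" .
  qed (use basis_mat_carrier in auto)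
  show "basis_mat * mat_adjoint basis_mat = 1\<^sub>m n"
    by (rule mat_mult_left_right_inverse [OF _ _ 1]) simp_all
qed

lemma parseval:
  assumes x: "x \<in> carrier_vec n"
  shows "nsq x = (\<Sum>j<n. (cmod (x \<bullet>c v j))\<^sup>2)"
proof -
  have Vx: "mat_adjoint basis_mat *\<^sub>v x \<in> carrier_vec n"
    by (rule mult_mat_vec_carrier [OF _ x]) simp
  have "of_real (nsq x) = (basis_mat *\<^sub>v (mat_adjoint basis_mat *\<^sub>v x)) \<bullet>c x"
    using x basis_mat_unitary(2) assoc_mult_mat_vec [of basis_mat n n "mat_adjoint basis_mat" n x]
    by (simp add: scalar_prod_conj_self)
  also have "\<dots> = of_real (nsq (mat_adjoint basis_mat *\<^sub>v x))"
    using mult_mat_vec_scalar_prod_conj [OF basis_mat_carrier Vx x] by (simp add: scalar_prod_conj_self)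
  also have "nsq (mat_adjoint basis_mat *\<^sub>v x) = (\<Sum>j<n. (cmod (x \<bullet>c v j))\<^sup>2)"
    using adjoint_basis_mat_index [OF x] Vx by (simp add: nsq_def del: index_mult_mat_vec)
  finally show ?thesis by (simp only: of_real_eq_iff)
qed

lemma coordinates_zero:
  assumes "x \<in> carrier_vec n" "\<And>j. j < n \<Longrightarrow> x \<bullet>c v j = 0"
  shows "x = 0\<^sub>v n"
  using parseval [OF assms(1)] assms nsq_eq_0_iff by simp

end

section \<open>The inverse Riccati equation\<close>

lemma mult_mat_zero_vec:
  fixes M :: "complex Matrix.mat"
  assumes "M \<in> carrier_mat n m"
  shows "M *\<^sub>v 0\<^sub>v m = 0\<^sub>v n"
  using assms by (intro eq_vecI) auto

locale skew_basis = orthonormal_basis n v for n v +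
  fixes A :: "complex Matrix.mat" and lam :: "nat \<Rightarrow> real"
  assumes n_pos: "0 < n"
    and A: "A \<in> carrier_mat n n"
    and skew: "mat_adjoint A = - A"
    and eigen: "j < n \<Longrightarrow> A *\<^sub>v v j = (\<i> * of_real (lam j)) \<cdot>\<^sub>v v j"
    and lam_distinct: "j < n \<Longrightarrow> k < n \<Longrightarrow> j \<noteq> k \<Longrightarrow> lam j \<noteq> lam k"
begin

lemma skew_scalar_prod:
  assumes "x \<in> carrier_vec n" "y \<in> carrier_vec n"
  shows "(A *\<^sub>v x) \<bullet>c y = - (x \<bullet>c (A *\<^sub>v y))"
proof -
  have "mat_adjoint A *\<^sub>v y = (- 1) \<cdot>\<^sub>v (A *\<^sub>v y)"
    using assms A by (intro eq_vecI) (simp_all add: skew)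
  moreover have "A *\<^sub>v y \<in> carrier_vec n" using A assms by simp
  ultimately show ?thesis
    using mult_mat_vec_scalar_prod_conj [OF A assms] scalar_prod_conj_simps(6) [of "A *\<^sub>v y" n "A *\<^sub>v y" x "- 1"] assms
    by simp
qed

lemma skew_form_zero: "x \<in> carrier_vec n \<Longrightarrow> Re ((A *\<^sub>v x) \<bullet>c x) = 0"
  using skew_scalar_prod [of x x] Re_scalar_prod_conj_commute [of x n "A *\<^sub>v x"] A by simp

lemma coordinate_skew:
  assumes "x \<in> carrier_vec n" "j < n"
  shows "(A *\<^sub>v x) \<bullet>c v j = \<i> * of_real (lam j) * (x \<bullet>c v j)"
  using skew_scalar_prod [OF assms(1) basis_carrier [OF assms(2)]] eigen [OF assms(2)] assms
    scalar_prod_conj_simps(6) [of "v j" n "v j" x] basis_carrier [OF assms(2)]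
  by simp

end

text \<open>\<open>controllable\<close> is the Hautus test: as A has simple eigenvalues, its
  eigenvectors are multiples of the \<open>v j\<close>, and none may be annihilated by the adjoint
  of B.\<close>

locale skew_system = skew_basis n v A lam for n v A lam +
  fixes B :: "complex Matrix.mat" and m :: nat
  assumes B: "B \<in> carrier_mat n m"
    and controllable: "j < n \<Longrightarrow> mat_adjoint B *\<^sub>v v j \<noteq> 0\<^sub>v m"
begin

text \<open>Applying A - i lam_j to x deletes coordinate j and multiplies the others by nonzero
  factors. By induction on the number of nonzero coordinates the result is 0, so x is a multiple of
  \<open>v j\<close>, which \<open>controllable\<close> excludes unless x = 0.\<close>

lemma invariant_kernel:
  assumes S: "S \<subseteq> carrier_vec n"
    and add: "\<And>x y c. x \<in> S \<Longrightarrow> y \<in> S \<Longrightarrow> x + c \<cdot>\<^sub>v y \<in> S"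
    and inv: "\<And>x. x \<in> S \<Longrightarrow> A *\<^sub>v x \<in> S"
    and ker: "\<And>x. x \<in> S \<Longrightarrow> mat_adjoint B *\<^sub>v x = 0\<^sub>v m"
    and x: "x \<in> S"
  shows "x = 0\<^sub>v n"
  using x
proof (induction "card {j. j < n \<and> x \<bullet>c v j \<noteq> 0}" arbitrary: x rule: less_induct)
  case less
  have xc: "x \<in> carrier_vec n" using less.prems S by blast
  show ?case
  proof (rule ccontr)
    assume "x \<noteq> 0\<^sub>v n"
    then obtain j where j: "j < n" "x \<bullet>c v j \<noteq> 0"
      using coordinates_zero [OF xc] by blast
    define y where "y = A *\<^sub>v x + (- (\<i> * of_real (lam j))) \<cdot>\<^sub>v x"
    have yS: "y \<in> S" unfolding y_def by (intro add inv less.prems)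
    have y: "y \<bullet>c v k = \<i> * of_real (lam k - lam j) * (x \<bullet>c v k)" if "k < n" for k
      using coordinate_skew [OF xc that] A xc basis_carrier [OF that]
      by (simp add: y_def scalar_prod_conj_simps [where n = n] algebra_simps)
    have "{k. k < n \<and> y \<bullet>c v k \<noteq> 0} \<subset> {k. k < n \<and> x \<bullet>c v k \<noteq> 0}"
    proof (rule psubsetI)
      show "{k. k < n \<and> y \<bullet>c v k \<noteq> 0} \<subseteq> {k. k < n \<and> x \<bullet>c v k \<noteq> 0}"
      proof
        fix k assume k: "k \<in> {k. k < n \<and> y \<bullet>c v k \<noteq> 0}"
        then show "k \<in> {k. k < n \<and> x \<bullet>c v k \<noteq> 0}" using y [of k] by simp
      qed
      have "j \<notin> {k. k < n \<and> y \<bullet>c v k \<noteq> 0}" using y [OF j(1)] by simp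
      then show "{k. k < n \<and> y \<bullet>c v k \<noteq> 0} \<noteq> {k. k < n \<and> x \<bullet>c v k \<noteq> 0}"
        using j by blast
    qed
    then have "y = 0\<^sub>v n"
      by (intro less.hyps yS psubset_card_mono) auto
    then have zero: "x \<bullet>c v k = 0" if "k < n" "k \<noteq> j" for k
      using y [OF that(1)] lam_distinct [OF that(1) j(1) that(2)] basis_carrier [OF that(1)] by simp
    define c where "c = x \<bullet>c v j"
    have vj: "v j \<in> carrier_vec n" using basis_carrier j by blast
    have "x - c \<cdot>\<^sub>v v j = 0\<^sub>v n"
    proof (rule coordinates_zero)
      fix k assume k: "k < n"
      have "(x - c \<cdot>\<^sub>v v j) \<bullet>c v k = x \<bullet>c v k - c * (v j \<bullet>c v k)"
        using xc vj basis_carrier [OF k] by (simp add: scalar_prod_conj_simps [where n = n])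
      then show "(x - c \<cdot>\<^sub>v v j) \<bullet>c v k = 0"
        using orthonormal [OF j(1) k] zero [OF k] by (cases "k = j") (auto simp: c_def)
    qed (use xc vj in simp)
    then have "(x - c \<cdot>\<^sub>v v j) $ i = 0" if "i < n" for i
      using that by simp
    then have "x = c \<cdot>\<^sub>v v j"
      using xc vj by (intro eq_vecI) auto
    then have "c \<cdot>\<^sub>v (mat_adjoint B *\<^sub>v v j) = 0\<^sub>v m"
      using ker [OF less.prems] mult_mat_vec [OF mat_adjoint_carrier [OF B] vj] by simp
    then have "(c \<cdot>\<^sub>v (mat_adjoint B *\<^sub>v v j)) $ i = 0" if "i < m" for i
      using that by simp
    moreover have "(c \<cdot>\<^sub>v (mat_adjoint B *\<^sub>v v j)) $ i = c * (mat_adjoint B *\<^sub>v v j) $ i" if "i < m" for i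
      using that B by simp
    moreover have "c \<noteq> 0" using j(2) by (simp add: c_def)
    ultimately have "(mat_adjoint B *\<^sub>v v j) $ i = 0" if "i < m" for i
      using that by (simp del: index_mult_mat_vec)
    then have "mat_adjoint B *\<^sub>v v j = 0\<^sub>v m"
      using B by (intro eq_vecI) (auto simp del: index_mult_mat_vec)
    then show False using controllable [OF j(1)] by blast
  qed
qed

section \<open>The residual of the inverse Riccati equation\<close>

definition res_mat :: "complex Matrix.mat \<Rightarrow> complex Matrix.mat" where
  "res_mat Y = (Y * Y + A * Y) - (Y * A + B * mat_adjoint B)"

text \<open>For Hermitian Y this is the form of \<open>res_mat Y\<close>, written so that each
  matrix acts on x only once. Continuity in the entries of Y and the expansion at Y - N are then
  direct.\<close>

definition res_form :: "complex Matrix.mat \<Rightarrow> complex Matrix.vec \<Rightarrow> real" where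
  "res_form Y x = nsq (Y *\<^sub>v x) - 2 * Re ((Y *\<^sub>v x) \<bullet>c (A *\<^sub>v x)) - nsq (mat_adjoint B *\<^sub>v x)"

lemma res_mat_carrier: "Y \<in> carrier_mat n n \<Longrightarrow> res_mat Y \<in> carrier_mat n n"
  unfolding res_mat_def using A B by auto

lemma res_mat_mult_vec:
  assumes Y: "Y \<in> carrier_mat n n" and x: "x \<in> carrier_vec n"
  shows "res_mat Y *\<^sub>v x = (Y *\<^sub>v (Y *\<^sub>v x) + A *\<^sub>v (Y *\<^sub>v x)) -
    (Y *\<^sub>v (A *\<^sub>v x) + (B * mat_adjoint B) *\<^sub>v x)"
proof -
  have c: "Y * Y \<in> carrier_mat n n" "A * Y \<in> carrier_mat n n" "Y * A \<in> carrier_mat n n"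
    "B * mat_adjoint B \<in> carrier_mat n n"
    using Y A hermitian_carrier [OF hermitian_gram [OF B]] by auto
  have "res_mat Y *\<^sub>v x = (Y * Y + A * Y) *\<^sub>v x - (Y * A + B * mat_adjoint B) *\<^sub>v x"
    unfolding res_mat_def
    using c x by (intro minus_mult_distrib_mat_vec [of _ n n]) auto
  then show ?thesis
    using add_mult_distrib_mat_vec [OF c(1,2) x] add_mult_distrib_mat_vec [OF c(3,4) x]
      assoc_mult_mat_vec [OF Y Y x] assoc_mult_mat_vec [OF A Y x] assoc_mult_mat_vec [OF Y A x]
    by simp
qed

lemma res_mat_form:
  assumes Y: "hermitian n Y" and x: "x \<in> carrier_vec n"
  shows "Re ((res_mat Y *\<^sub>v x) \<bullet>c x) = res_form Y x"
proof -
  have Yc: "Y \<in> carrier_mat n n" using Y hermitian_carrier by blast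
  have c: "Y *\<^sub>v x \<in> carrier_vec n" "A *\<^sub>v x \<in> carrier_vec n"
    "(B * mat_adjoint B) *\<^sub>v x \<in> carrier_vec n"
    using Yc A x hermitian_carrier [OF hermitian_gram [OF B]] by auto
  have "(res_mat Y *\<^sub>v x) \<bullet>c x = (Y *\<^sub>v (Y *\<^sub>v x)) \<bullet>c x + (A *\<^sub>v (Y *\<^sub>v x)) \<bullet>c x -
      ((Y *\<^sub>v (A *\<^sub>v x)) \<bullet>c x + ((B * mat_adjoint B) *\<^sub>v x) \<bullet>c x)"
    unfolding res_mat_mult_vec [OF Yc x]
    using c x Yc A by (simp add: scalar_prod_conj_simps [where n = n])
  also have "(Y *\<^sub>v (Y *\<^sub>v x)) \<bullet>c x = of_real (nsq (Y *\<^sub>v x))"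
    using hermitian_scalar_prod_conj [OF Y c(1) x] by (simp add: scalar_prod_conj_self)
  also have "(A *\<^sub>v (Y *\<^sub>v x)) \<bullet>c x = - ((Y *\<^sub>v x) \<bullet>c (A *\<^sub>v x))"
    by (rule skew_scalar_prod [OF c(1) x])
  also have "(Y *\<^sub>v (A *\<^sub>v x)) \<bullet>c x = (A *\<^sub>v x) \<bullet>c (Y *\<^sub>v x)"
    by (rule hermitian_scalar_prod_conj [OF Y c(2) x])
  finally show ?thesis
    using Re_scalar_prod_conj_commute [OF c(1,2)]
    by (simp add: res_form_def gram_form [OF B x])
qed

text \<open>The commutator of a skew-Hermitian with a Hermitian matrix is Hermitian.\<close>

lemma hermitian_res_mat:
  assumes "hermitian n Y"
  shows "hermitian n (res_mat Y)"
proof -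
  have Y: "Y \<in> carrier_mat n n" "mat_adjoint Y = Y" using assms by (auto simp: hermitian_def)
  have YY: "hermitian n (Y * Y)"
    using Y mat_adjoint_mult [OF Y(1) Y(1)] by (simp add: hermitian_def)
  have "mat_adjoint (A * Y - Y * A) = Y * (- A) - (- A) * Y"
    using A Y mat_adjoint_mult [OF A Y(1)] mat_adjoint_mult [OF Y(1) A]
    by (simp add: mat_adjoint_minus [of _ n n] skew)
  also have "\<dots> = A * Y - Y * A"
  proof -
    have "Y * (- A) = - (Y * A)" "(- A) * Y = - (A * Y)"
      using A Y by auto
    then show ?thesis using A Y by (intro eq_matI) auto
  qed
  finally have "mat_adjoint (A * Y - Y * A) = A * Y - Y * A" .
  moreover have "A * Y - Y * A \<in> carrier_mat n n"
    by (rule minus_carrier_mat [OF mult_carrier_mat [OF Y(1) A]])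
  ultimately have "hermitian n (A * Y - Y * A)"
    by (simp only: hermitian_def)
  then have 1: "hermitian n ((B * mat_adjoint B) - (A * Y - Y * A))"
    by (rule hermitian_minus [OF hermitian_gram [OF B]])
  have "res_mat Y = Y * Y - ((B * mat_adjoint B) - (A * Y - Y * A))"
    unfolding res_mat_def using A Y B by (intro eq_matI) auto
  then show ?thesis using hermitian_minus [OF YY 1] by simp
qed

text \<open>On the kernel of Y the form of the residual is minus the squared length of
  \<open>mat_adjoint B *\<^sub>v x\<close>. Being nonnegative as well, it is 0, so the adjoint of B
  vanishes there and x is a null vector of the residual matrix. That equation reduces to Y A x = 0:
  the kernel is A-invariant, and \<open>invariant_kernel\<close> applies.\<close>

lemma res_form_psd_injective:
  assumes Y: "hermitian n Y"
    and res: "\<And>x. x \<in> carrier_vec n \<Longrightarrow> 0 \<le> res_form Y x"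
    and x: "x \<in> carrier_vec n" "Y *\<^sub>v x = 0\<^sub>v n"
  shows "x = 0\<^sub>v n"
proof (rule invariant_kernel)
  let ?S = "{x \<in> carrier_vec n. Y *\<^sub>v x = 0\<^sub>v n}"
  have Yc: "Y \<in> carrier_mat n n" using Y hermitian_carrier by blast
  show "x \<in> ?S" using x by simp
  show "x + c \<cdot>\<^sub>v y \<in> ?S" if "x \<in> ?S" "y \<in> ?S" for x y c
  proof -
    have "c \<cdot>\<^sub>v 0\<^sub>v n = (0\<^sub>v n :: complex Matrix.vec)"
      by (intro eq_vecI) auto
    then show ?thesis
      using that Yc by (simp add: mult_add_distrib_mat_vec [OF Yc] mult_mat_vec [OF Yc])
  qed
  have B0: "nsq (mat_adjoint B *\<^sub>v y) = 0" and f0: "res_form Y y = 0" if "y \<in> ?S" for y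
  proof -
    have "res_form Y y = - nsq (mat_adjoint B *\<^sub>v y)"
      using that A by (simp add: res_form_def nsq_def)
    then show "nsq (mat_adjoint B *\<^sub>v y) = 0" "res_form Y y = 0"
      using res [of y] that nsq_nonneg [of "mat_adjoint B *\<^sub>v y"] by auto
  qed
  show ker: "mat_adjoint B *\<^sub>v y = 0\<^sub>v m" if "y \<in> ?S" for y
    using B0 [OF that] nsq_eq_0_iff [of "mat_adjoint B *\<^sub>v y" m] that B by simp
  show "A *\<^sub>v y \<in> ?S" if y: "y \<in> ?S" for y
  proof -
    have yc: "y \<in> carrier_vec n" using y by simp
    have "res_mat Y *\<^sub>v y = 0\<^sub>v n"
      using res res_mat_form [OF Y] f0 [OF y] yc
      by (intro psd_null_vector [OF hermitian_res_mat [OF Y]]) auto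
    moreover have "(B * mat_adjoint B) *\<^sub>v y = 0\<^sub>v n"
      using assoc_mult_mat_vec [OF B mat_adjoint_carrier [OF B] yc] ker [OF y] mult_mat_zero_vec [OF B]
      by simp
    ultimately have eq: "(Y *\<^sub>v 0\<^sub>v n + A *\<^sub>v 0\<^sub>v n) - (Y *\<^sub>v (A *\<^sub>v y) + 0\<^sub>v n) = 0\<^sub>v n"
      using res_mat_mult_vec [OF Yc yc] y by simp
    have "(Y *\<^sub>v (A *\<^sub>v y)) $ i = 0" if "i < n" for i
    proof -
      have "((Y *\<^sub>v 0\<^sub>v n + A *\<^sub>v 0\<^sub>v n) - (Y *\<^sub>v (A *\<^sub>v y) + 0\<^sub>v n)) $ i = 0"
        unfolding eq using that by simp
      then show ?thesis
        using that Yc A mult_mat_zero_vec [OF Yc] mult_mat_zero_vec [OF A] by (simp del: index_mult_mat_vec)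
    qed
    then have "Y *\<^sub>v (A *\<^sub>v y) = 0\<^sub>v n"
      using Yc by (intro eq_vecI) (auto simp del: index_mult_mat_vec)
    then show ?thesis using A yc by simp
  qed
qed auto

end

section \<open>Supersolutions, Newton steps and existence\<close>

context skew_system
begin

text \<open>Equations and weak inequalities only, so that the set is closed; the bound by t makes it
  compact. Positive definiteness, which is not a closed condition, comes back through
  \<open>supersol_pos\<close>.\<close>

definition riccati_supersol :: "real \<Rightarrow> complex Matrix.mat \<Rightarrow> bool" where
  "riccati_supersol t Y \<longleftrightarrow> hermitian n Y \<and>
    (\<forall>x \<in> carrier_vec n. 0 \<le> Re ((Y *\<^sub>v x) \<bullet>c x)) \<and>
    (\<forall>x \<in> carrier_vec n. Re ((Y *\<^sub>v x) \<bullet>c x) \<le> t * nsq x) \<and>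
    (\<forall>x \<in> carrier_vec n. 0 \<le> res_form Y x)"

lemma supersol_pos:
  assumes Y: "riccati_supersol t Y" and x: "x \<in> carrier_vec n" "x \<noteq> 0\<^sub>v n"
  shows "0 < Re ((Y *\<^sub>v x) \<bullet>c x)"
proof (rule ccontr)
  have h: "hermitian n Y" using Y by (simp add: riccati_supersol_def)
  assume "\<not> 0 < Re ((Y *\<^sub>v x) \<bullet>c x)"
  then have "Re ((Y *\<^sub>v x) \<bullet>c x) = 0"
    using Y x(1) by (auto simp: riccati_supersol_def intro: antisym)
  then have "Y *\<^sub>v x = 0\<^sub>v n"
    using Y by (intro psd_null_vector [OF h x(1)]) (simp_all add: riccati_supersol_def)
  moreover have "0 \<le> res_form Y y" if "y \<in> carrier_vec n" for y
    using Y that by (simp add: riccati_supersol_def)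
  ultimately have "x = 0\<^sub>v n"
    using res_form_psd_injective [OF h _ x(1)] by blast
  then show False using x(2) by simp
qed

text \<open>Supplies the box for \<open>compact_bounded_functions\<close>; \<open>psd_bound\<close>
  passes from the form of Y to the lengths of its columns.\<close>

lemma supersol_index_bound:
  assumes Y: "riccati_supersol t Y" and t: "0 < t" and ij: "i < n" "j < n"
  shows "cmod (Y $$ (i, j)) \<le> t"
proof -
  have h: "hermitian n Y" using Y by (simp add: riccati_supersol_def)
  then have Yc: "Y \<in> carrier_mat n n" using hermitian_carrier by blast
  let ?e = "unit_vec n j :: complex Matrix.vec"
  have "(cmod (Y $$ (i, j)))\<^sup>2 \<le> nsq (Y *\<^sub>v ?e)"
    using index_norm_le_nsq [of "Y *\<^sub>v ?e" n i] Yc ij mult_unit_vec_index [OF Yc ij] by simp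
  also have "\<dots> \<le> t * Re ((Y *\<^sub>v ?e) \<bullet>c ?e)"
    using Y t by (intro psd_bound [OF h]) (auto simp: riccati_supersol_def)
  also have "\<dots> \<le> t * (t * nsq ?e)"
    using Y t by (intro mult_left_mono) (auto simp: riccati_supersol_def)
  also have "\<dots> = t\<^sup>2" using ij by (simp add: power2_eq_square)
  finally show ?thesis
    by (rule power2_le_imp_le) (use t in linarith)
qed

lemma mult_vec_diff:
  fixes M N :: "complex Matrix.mat"
  assumes "M \<in> carrier_mat n n" "N \<in> carrier_mat n n" "x \<in> carrier_vec n"
  shows "(M - N) *\<^sub>v x = M *\<^sub>v x - N *\<^sub>v x"
  using assms by (rule minus_mult_distrib_mat_vec)

text \<open>One Newton step from a supersolution \<open>Y\<close> is \<open>Y - N\<close> with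
  \<open>W\<^sup>* N + N W\<close> equal to the residual of \<open>Y\<close>, where \<open>W = Y - A\<close>; the new residual is \<open>N\<^sup>2\<close>.\<close>

lemma newton_step:
  assumes Y: "riccati_supersol t Y"
  obtains N where "hermitian n N" "\<And>x. x \<in> carrier_vec n \<Longrightarrow> 0 \<le> Re ((N *\<^sub>v x) \<bullet>c x)"
    "\<And>x. x \<in> carrier_vec n \<Longrightarrow> 2 * Re ((N *\<^sub>v x) \<bullet>c ((Y - A) *\<^sub>v x)) = res_form Y x"
    "riccati_supersol t (Y - N)"
proof -
  have h: "hermitian n Y" using Y by (simp add: riccati_supersol_def)
  then have Yc: "Y \<in> carrier_mat n n" using hermitian_carrier by blast
  have W: "Y - A \<in> carrier_mat n n" using Yc A by auto
  have Wx: "(Y - A) *\<^sub>v x = Y *\<^sub>v x - A *\<^sub>v x" if "x \<in> carrier_vec n" for x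
    by (rule mult_vec_diff [OF Yc A that])
  \<comment> \<open>A contributes no real part, so W inherits accretivity from the positive definite
    Y.\<close>
  have acc: "0 < Re (((Y - A) *\<^sub>v x) \<bullet>c x)" if "x \<in> carrier_vec n" "x \<noteq> 0\<^sub>v n" for x
    using supersol_pos [OF Y that] skew_form_zero [OF that(1)] that Yc A
    by (simp add: Wx scalar_prod_conj_simps [where n = n])
  obtain N where N: "hermitian n N"
    and eq: "\<And>x. x \<in> carrier_vec n \<Longrightarrow>
      2 * Re ((N *\<^sub>v x) \<bullet>c ((Y - A) *\<^sub>v x)) = Re ((res_mat Y *\<^sub>v x) \<bullet>c x)"
    using lyapunov_solution [OF W acc hermitian_res_mat [OF h]] by blast
  have eq: "2 * Re ((N *\<^sub>v x) \<bullet>c ((Y - A) *\<^sub>v x)) = res_form Y x" if "x \<in> carrier_vec n" for x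
    using eq [OF that] res_mat_form [OF h that] by simp
  have Nc: "N \<in> carrier_mat n n" using N hermitian_carrier by blast
  have res: "0 \<le> res_form Y x" if "x \<in> carrier_vec n" for x
    using Y that by (simp add: riccati_supersol_def)
  have lyap: "0 \<le> Re ((N *\<^sub>v x) \<bullet>c ((Y - A) *\<^sub>v x))" if "x \<in> carrier_vec n" for x
    using eq [OF that] res [OF that] by linarith
  have psd: "0 \<le> Re ((N *\<^sub>v x) \<bullet>c x)" if "x \<in> carrier_vec n" for x
    using lyapunov_psd [OF N W acc lyap that] by blast
  have D: "hermitian n (Y - N)" using h N by (rule hermitian_minus)
  have Dx: "(Y - N) *\<^sub>v x = Y *\<^sub>v x - N *\<^sub>v x" if "x \<in> carrier_vec n" for x
    by (rule mult_vec_diff [OF Yc Nc that])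
  have expand: "2 * (Re ((N *\<^sub>v x) \<bullet>c (Y *\<^sub>v x)) - Re ((N *\<^sub>v x) \<bullet>c (A *\<^sub>v x))) = res_form Y x"
    if "x \<in> carrier_vec n" for x
    using eq [OF that] that Yc Nc A by (simp add: Wx scalar_prod_conj_simps [where n = n])
  \<comment> \<open>The Lyapunov inequality holds for Y - N too: twice its left-hand side is the sum
    of the squared lengths of Y y and of \<open>mat_adjoint B *\<^sub>v y\<close>.\<close>
  have "0 \<le> Re (((Y - N) *\<^sub>v x) \<bullet>c x)" if "x \<in> carrier_vec n" for x
  proof (rule lyapunov_psd [OF D W acc _ that])
    fix y :: "complex Matrix.vec" assume y: "y \<in> carrier_vec n"
    have "Re (((Y - N) *\<^sub>v y) \<bullet>c ((Y - A) *\<^sub>v y)) =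
        nsq (Y *\<^sub>v y) - Re ((Y *\<^sub>v y) \<bullet>c (A *\<^sub>v y)) -
        (Re ((N *\<^sub>v y) \<bullet>c (Y *\<^sub>v y)) - Re ((N *\<^sub>v y) \<bullet>c (A *\<^sub>v y)))"
      using y Yc Nc A by (simp add: Wx Dx scalar_prod_conj_simps [where n = n] scalar_prod_conj_self)
    also have "\<dots> = (nsq (Y *\<^sub>v y) + nsq (mat_adjoint B *\<^sub>v y)) / 2"
      using expand [OF y] by (simp add: res_form_def)
    finally have "Re (((Y - N) *\<^sub>v y) \<bullet>c ((Y - A) *\<^sub>v y)) = (nsq (Y *\<^sub>v y) + nsq (mat_adjoint B *\<^sub>v y)) / 2" .
    moreover have "0 \<le> (nsq (Y *\<^sub>v y) + nsq (mat_adjoint B *\<^sub>v y)) / 2"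
      by (intro divide_nonneg_nonneg add_nonneg_nonneg nsq_nonneg) simp
    ultimately show "0 \<le> Re (((Y - N) *\<^sub>v y) \<bullet>c ((Y - A) *\<^sub>v y))"
      by (simp only:)
  qed
  moreover have "Re (((Y - N) *\<^sub>v x) \<bullet>c x) \<le> t * nsq x" if "x \<in> carrier_vec n" for x
  proof -
    have "Re (((Y - N) *\<^sub>v x) \<bullet>c x) = Re ((Y *\<^sub>v x) \<bullet>c x) - Re ((N *\<^sub>v x) \<bullet>c x)"
      using that Yc Nc by (simp add: Dx scalar_prod_conj_simps [where n = n])
    moreover have "Re ((Y *\<^sub>v x) \<bullet>c x) \<le> t * nsq x"
      using Y that by (simp add: riccati_supersol_def)
    ultimately show ?thesis using psd [OF that] by simp
  qed
  \<comment> \<open>N was chosen to cancel the residual of Y together with the linear terms; only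
    the quadratic term survives.\<close>
  moreover have "res_form (Y - N) x = nsq (N *\<^sub>v x)" if x: "x \<in> carrier_vec n" for x
  proof -
    have c: "Y *\<^sub>v x \<in> carrier_vec n" "N *\<^sub>v x \<in> carrier_vec n" "A *\<^sub>v x \<in> carrier_vec n"
      using x Yc Nc A by auto
    show ?thesis
      using expand [OF x] Re_scalar_prod_conj_commute [OF c(1,2)] nsq_diff [OF c(1,2)]
      by (simp add: res_form_def Dx [OF x] scalar_prod_conj_simps(3) [OF c(1,2,3)])
  qed
  ultimately have "riccati_supersol t (Y - N)"
    using D by (simp add: riccati_supersol_def)
  with N psd eq show thesis by (intro that)
qed

text \<open>A multiple t of the identity commutes with A, so only t^2 has to dominate
  \<open>B * mat_adjoint B\<close>.\<close>

lemma scaled_identity_supersol: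
  obtains t where "0 < t" "riccati_supersol t (of_real t \<cdot>\<^sub>m 1\<^sub>m n)"
proof -
  obtain \<mu> where \<mu>: "\<And>x. x \<in> carrier_vec n \<Longrightarrow> Re (((B * mat_adjoint B) *\<^sub>v x) \<bullet>c x) \<le> \<mu> * nsq x"
    using rayleigh_max [OF hermitian_gram [OF B] n_pos] by metis
  \<comment> \<open>The 1 makes t positive and ensures t^2 \<ge> t \<ge> \<mu>.\<close>
  define t where "t = max 1 \<mu>"
  have t: "1 \<le> t" "\<mu> \<le> t" by (auto simp: t_def)
  let ?Y = "of_real t \<cdot>\<^sub>m 1\<^sub>m n :: complex Matrix.mat"
  have Yx: "?Y *\<^sub>v x = of_real t \<cdot>\<^sub>v x" if "x \<in> carrier_vec n" for x
    using that by (intro eq_vecI) (auto simp: scalar_prod_smult_left)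
  have h: "hermitian n ?Y" by (intro hermitianI) auto
  have "0 \<le> res_form ?Y x" if x: "x \<in> carrier_vec n" for x
  proof -
    have Ax: "A *\<^sub>v x \<in> carrier_vec n" using A x by simp
    have "Re (x \<bullet>c (A *\<^sub>v x)) = 0"
      using skew_form_zero [OF x] Re_scalar_prod_conj_commute [OF x Ax] by simp
    then have "res_form ?Y x = t\<^sup>2 * nsq x - nsq (mat_adjoint B *\<^sub>v x)"
      using x by (simp add: res_form_def Yx nsq_smult scalar_prod_conj_simps(5) [OF x x Ax])
    moreover have "nsq (mat_adjoint B *\<^sub>v x) \<le> \<mu> * nsq x"
      using \<mu> [OF x] gram_form [OF B x] by simp
    moreover have "\<mu> * nsq x \<le> t\<^sup>2 * nsq x"
      using t by (intro mult_right_mono) (auto simp: power2_eq_square intro: order.trans [OF t(2)])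
    ultimately show ?thesis by simp
  qed
  moreover have "Re ((?Y *\<^sub>v x) \<bullet>c x) = t * nsq x" if x: "x \<in> carrier_vec n" for x
    using x by (simp add: Yx scalar_prod_conj_simps(5) [OF x x x] scalar_prod_conj_self)
  ultimately have "riccati_supersol t ?Y"
    using h t by (simp add: riccati_supersol_def)
  with t show thesis by (intro that [of t]) auto
qed

text \<open>For each fixed x the two sides of every inequality depend continuously on finitely many
  coordinates of F, and closed conditions may be intersected over all x.\<close>

lemma closed_supersol: "closed {F. riccati_supersol t (Matrix.mat n n F)}"
proof -
  let ?M = "\<lambda>F :: nat \<times> nat \<Rightarrow> complex. Matrix.mat n n F"
  have coord: "continuous_on UNIV (\<lambda>F :: nat \<times> nat \<Rightarrow> complex. F p)" for p
    by (rule continuous_on_product_coordinates)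
  have mv: "(?M F *\<^sub>v x) $ i = (\<Sum>j<n. F (i, j) * x $ j)" if "x \<in> carrier_vec n" "i < n" for F x i
    using that by (auto simp: scalar_prod_def lessThan_atLeast0 intro!: sum.cong)
  have mp: "(?M F *\<^sub>v x) \<bullet>c y = (\<Sum>i<n. (\<Sum>j<n. F (i, j) * x $ j) * cnj (y $ i))"
    if "x \<in> carrier_vec n" "y \<in> carrier_vec n" for F x y
    using that mv [OF that(1)]
    by (auto simp: scalar_prod_def lessThan_atLeast0 simp del: index_mult_mat_vec intro!: sum.cong)
  have cont_form: "continuous_on UNIV (\<lambda>F. Re ((?M F *\<^sub>v x) \<bullet>c y))"
    if "x \<in> carrier_vec n" "y \<in> carrier_vec n" for x y
    unfolding mp [OF that] by (intro continuous_intros coord)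
  have nq: "nsq (?M F *\<^sub>v x) = (\<Sum>i<n. (cmod (\<Sum>j<n. F (i, j) * x $ j))\<^sup>2)" if "x \<in> carrier_vec n" for F x
    using mv [OF that] by (simp add: nsq_def del: index_mult_mat_vec)
  have cont_nsq: "continuous_on UNIV (\<lambda>F. nsq (?M F *\<^sub>v x))" if "x \<in> carrier_vec n" for x
    unfolding nq [OF that] by (intro continuous_intros coord)
  have herm: "hermitian n (?M F) \<longleftrightarrow> (\<forall>i. \<forall>j. i < n \<longrightarrow> j < n \<longrightarrow> cnj (F (j, i)) = F (i, j))" for F
    using hermitian_index [of n "?M F"] by (auto intro!: hermitianI)
  have closed_all: "closed {F. \<forall>x. x \<in> carrier_vec n \<longrightarrow> P F x}"
    if "\<And>x. x \<in> carrier_vec n \<Longrightarrow> closed {F. P F x}" for P :: "(nat \<times> nat \<Rightarrow> complex) \<Rightarrow> complex Matrix.vec \<Rightarrow> bool"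
  proof (rule closed_Collect_all)
    show "closed {F. x \<in> carrier_vec n \<longrightarrow> P F x}" for x
      using that [of x] by (cases "x \<in> carrier_vec n") auto
  qed
  have "closed {F. hermitian n (?M F)}"
    unfolding herm
    by (intro closed_Collect_all closed_Collect_imp open_Collect_const closed_Collect_eq continuous_intros coord)
  moreover have "closed {F. \<forall>x. x \<in> carrier_vec n \<longrightarrow> 0 \<le> Re ((?M F *\<^sub>v x) \<bullet>c x)}"
    by (intro closed_all closed_Collect_le cont_form continuous_on_const)
  moreover have "closed {F. \<forall>x. x \<in> carrier_vec n \<longrightarrow> Re ((?M F *\<^sub>v x) \<bullet>c x) \<le> t * nsq x}"
    by (intro closed_all closed_Collect_le cont_form continuous_on_const)
  moreover have "closed {F. \<forall>x. x \<in> carrier_vec n \<longrightarrow> 0 \<le> res_form (?M F) x}"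
    unfolding res_form_def
    by (intro closed_all closed_Collect_le continuous_on_diff continuous_on_mult_left cont_form cont_nsq
        continuous_on_const mult_mat_vec_carrier [OF A])
  ultimately have "closed ({F. hermitian n (?M F)} \<inter>
      {F. \<forall>x. x \<in> carrier_vec n \<longrightarrow> 0 \<le> Re ((?M F *\<^sub>v x) \<bullet>c x)} \<inter>
      {F. \<forall>x. x \<in> carrier_vec n \<longrightarrow> Re ((?M F *\<^sub>v x) \<bullet>c x) \<le> t * nsq x} \<inter>
      {F. \<forall>x. x \<in> carrier_vec n \<longrightarrow> 0 \<le> res_form (?M F) x})"
    by (intro closed_Int)
  also have "\<dots> = {F. riccati_supersol t (?M F)}"
    unfolding riccati_supersol_def Ball_def by blast
  finally show ?thesis .
qed

text \<open>A supersolution of least trace admits no proper Newton step.\<close>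

lemma riccati_inverse_exists:
  obtains Y where "hermitian n Y" "\<And>x. x \<in> carrier_vec n \<Longrightarrow> x \<noteq> 0\<^sub>v n \<Longrightarrow> 0 < Re ((Y *\<^sub>v x) \<bullet>c x)"
    "res_mat Y = 0\<^sub>m n n"
proof -
  obtain t where t: "0 < t" and T0: "riccati_supersol t (of_real t \<cdot>\<^sub>m 1\<^sub>m n)"
    using scaled_identity_supersol .
  let ?M = "\<lambda>F :: nat \<times> nat \<Rightarrow> complex. Matrix.mat n n F"
  \<comment> \<open>Values outside the index square are set to 0 to make S compact;
    \<open>Matrix.mat\<close> ignores them.\<close>
  define S where "S = {F. \<forall>p. if p \<in> {..<n} \<times> {..<n} then cmod (F p) \<le> t else F p = 0} \<inter>
    {F. riccati_supersol t (?M F)}"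
  define tr where "tr F = (\<Sum>i<n. Re (F (i, i)))" for F :: "nat \<times> nat \<Rightarrow> complex"
  have S: "\<exists>F \<in> S. ?M F = Y" if Y: "riccati_supersol t Y" for Y
  proof
    let ?F = "\<lambda>p. if p \<in> {..<n} \<times> {..<n} then Y $$ p else 0"
    have "Y \<in> carrier_mat n n" using Y hermitian_carrier by (auto simp: riccati_supersol_def)
    then show M: "?M ?F = Y" by (intro eq_matI) auto
    show "?F \<in> S"
      unfolding S_def using Y M supersol_index_bound [OF Y t] by auto
  qed
  have "compact S"
    unfolding S_def by (intro compact_Int_closed compact_bounded_functions closed_supersol)
  moreover have "S \<noteq> {}" using S [OF T0] by blast
  moreover have "continuous_on S tr"
    unfolding tr_def
    by (intro continuous_intros continuous_on_subset [OF continuous_on_product_coordinates subset_UNIV])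
  ultimately obtain F where F: "F \<in> S" "\<And>H. H \<in> S \<Longrightarrow> tr F \<le> tr H"
    using continuous_attains_inf [of S tr] by blast
  define Y where "Y = ?M F"
  have Y: "riccati_supersol t Y" using F(1) by (simp add: S_def Y_def)
  obtain N where N: "hermitian n N" "\<And>x. x \<in> carrier_vec n \<Longrightarrow> 0 \<le> Re ((N *\<^sub>v x) \<bullet>c x)"
    "\<And>x. x \<in> carrier_vec n \<Longrightarrow> 2 * Re ((N *\<^sub>v x) \<bullet>c ((Y - A) *\<^sub>v x)) = res_form Y x"
    "riccati_supersol t (Y - N)"
    using newton_step [OF Y] by blast
  have Nc: "N \<in> carrier_mat n n" using N hermitian_carrier by blast
  obtain H where H: "H \<in> S" "?M H = Y - N" using S [OF N(4)] by blast
  \<comment> \<open>Y - N competes with Y, so the trace of the positive semidefinite N cannot be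
    positive.\<close>
  have "H (i, i) = F (i, i) - N $$ (i, i)" if "i < n" for i
  proof -
    have "?M H $$ (i, i) = (Y - N) $$ (i, i)" using H(2) by simp
    then show ?thesis using that Nc by (simp add: Y_def)
  qed
  then have "tr H = tr F - (\<Sum>i<n. Re (N $$ (i, i)))"
    by (simp add: tr_def sum_subtractf)
  then have "(\<Sum>i<n. Re (N $$ (i, i))) \<le> 0" using F(2) [OF H(1)] by simp
  then have N0: "N = 0\<^sub>m n n" using psd_trace_zero [OF N(1,2)] by blast
  have h: "hermitian n Y" using Y by (simp add: riccati_supersol_def)
  then have Yc: "Y \<in> carrier_mat n n" using hermitian_carrier by blast
  \<comment> \<open>With N = 0 the equation of the Newton step says that the residual of Y
    vanishes.\<close>
  have "res_mat Y = 0\<^sub>m n n"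
  proof (rule hermitian_form_zero [OF hermitian_res_mat [OF h]])
    fix x :: "complex Matrix.vec" assume x: "x \<in> carrier_vec n"
    have "N *\<^sub>v x = 0\<^sub>v n" unfolding N0 using x by (intro eq_vecI) auto
    moreover have "(Y - A) *\<^sub>v x \<in> carrier_vec n"
      using Yc A x by (simp add: mult_vec_diff)
    ultimately have "res_form Y x = 0" using N(3) [OF x] by simp
    then show "Re ((res_mat Y *\<^sub>v x) \<bullet>c x) = 0" using res_mat_form [OF h x] by simp
  qed
  with h supersol_pos [OF Y] show thesis by (intro that)
qed

end

section \<open>The Riccati equation and the closed loop\<close>

lemma vec_balance:
  fixes p q r g :: "complex Matrix.vec"
  assumes "p \<in> carrier_vec n" "q \<in> carrier_vec n" "r \<in> carrier_vec n" "g \<in> carrier_vec n"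
    and eq: "(p + q) - (r + g) = 0\<^sub>v n"
  shows "q - g = r - p"
proof (rule eq_vecI)
  fix i assume "i < dim_vec (r - p)"
  then have i: "i < n" using assms by simp
  have "((p + q) - (r + g)) $ i = 0" unfolding eq using i by simp
  then have "p $ i + q $ i - (r $ i + g $ i) = 0" using i assms(1-4) by simp
  moreover have "q $ i - g $ i = (p $ i + q $ i - (r $ i + g $ i)) + (r $ i - p $ i)"
    by simp
  ultimately have "q $ i - g $ i = r $ i - p $ i" by simp
  then show "(q - g) $ i = (r - p) $ i" using i assms(1-4) by simp
qed (use assms in auto)

lemma zero_mat_mult_vec:
  fixes x :: "complex Matrix.vec"
  assumes "x \<in> carrier_vec m"
  shows "0\<^sub>m n m *\<^sub>v x = 0\<^sub>v n"
  using assms by (intro eq_vecI) auto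

lemma injective_invertible:
  fixes K :: "complex Matrix.mat"
  assumes K: "K \<in> carrier_mat n n"
    and inj: "\<And>x. x \<in> carrier_vec n \<Longrightarrow> K *\<^sub>v x = 0\<^sub>v n \<Longrightarrow> x = 0\<^sub>v n"
  obtains J where "J \<in> carrier_mat n n" "K * J = 1\<^sub>m n" "J * K = 1\<^sub>m n"
proof -
  have "det K \<noteq> 0"
    using det_0_iff_vec_prod_zero [OF K] inj by blast
  then show thesis
    using det_non_zero_imp_unit [OF K, of "()"] that by (auto simp: Units_def ring_mat_def)
qed

lemma hermitian_inverse:
  assumes X: "hermitian n X" and Y: "Y \<in> carrier_mat n n" and XY: "X * Y = 1\<^sub>m n" "Y * X = 1\<^sub>m n"
  shows "hermitian n Y"
proof -
  have Xc: "X \<in> carrier_mat n n" and Xa: "mat_adjoint X = X"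
    using X by (auto simp: hermitian_def)
  have "mat_adjoint Y * X = mat_adjoint (X * Y)"
    using mat_adjoint_mult [OF Xc Y] Xa by simp
  also have "\<dots> = 1\<^sub>m n"
    unfolding XY by (intro eq_matI) auto
  finally have 1: "mat_adjoint Y * X = 1\<^sub>m n" .
  have "mat_adjoint Y = mat_adjoint Y * (X * Y)"
    using Y XY by simp
  also have "\<dots> = (mat_adjoint Y * X) * Y"
    by (rule assoc_mult_mat [OF mat_adjoint_carrier [OF Y] Xc Y, symmetric])
  also have "\<dots> = Y" using 1 Y by simp
  finally show ?thesis using Y by (simp add: hermitian_def)
qed

context skew_system
begin

definition riccati_mat :: "complex Matrix.mat \<Rightarrow> complex Matrix.mat" where
  "riccati_mat X = X * B * mat_adjoint B * X - X * A - mat_adjoint A * X - 1\<^sub>m n"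

lemma riccati_mat_mult_vec:
  assumes X: "X \<in> carrier_mat n n" and x: "x \<in> carrier_vec n"
  shows "riccati_mat X *\<^sub>v x =
    X *\<^sub>v ((B * mat_adjoint B) *\<^sub>v (X *\<^sub>v x)) - X *\<^sub>v (A *\<^sub>v x) - (- (A *\<^sub>v (X *\<^sub>v x))) - x"
proof -
  have G: "B * mat_adjoint B \<in> carrier_mat n n"
    using hermitian_carrier [OF hermitian_gram [OF B]] .
  have "X * B * mat_adjoint B = X * (B * mat_adjoint B)"
    by (rule assoc_mult_mat [OF X B mat_adjoint_carrier [OF B]])
  then have 1: "X * B * mat_adjoint B * X = X * ((B * mat_adjoint B) * X)"
    using assoc_mult_mat [OF X G X] by simp
  have c: "X * ((B * mat_adjoint B) * X) \<in> carrier_mat n n" "X * A \<in> carrier_mat n n"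
    "(- A) * X \<in> carrier_mat n n" "(1\<^sub>m n :: complex Matrix.mat) \<in> carrier_mat n n"
    using X G A by auto
  have mA: "((- A) * X) *\<^sub>v x = - (A *\<^sub>v (X *\<^sub>v x))"
    using assoc_mult_mat_vec [OF uminus_carrier_mat [OF A] X x] A X x by simp
  have d: "X * (B * mat_adjoint B * X) - X * A \<in> carrier_mat n n"
    "X * (B * mat_adjoint B * X) - X * A - (- A) * X \<in> carrier_mat n n"
    using minus_carrier_mat [OF c(2)] minus_carrier_mat [OF c(3)] by blast+
  show ?thesis
    unfolding riccati_mat_def 1 skew
    using minus_mult_distrib_mat_vec [OF c(1,2) x] minus_mult_distrib_mat_vec [OF d(1) c(3) x]
      minus_mult_distrib_mat_vec [OF d(2) c(4) x] mA
      assoc_mult_mat_vec [OF X mult_carrier_mat [OF G X] x] assoc_mult_mat_vec [OF G X x]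
      assoc_mult_mat_vec [OF X A x] x
    by simp
qed

text \<open>Multiplying the residual of Y by X from both sides turns Y^2 into the identity and A Y -
  Y A into X A - A X. As the adjoint of A is -A, the result is minus the Riccati expression of
  X.\<close>

lemma riccati_mat_res_mat:
  assumes X: "X \<in> carrier_mat n n" and Y: "Y \<in> carrier_mat n n"
    and XY: "X * Y = 1\<^sub>m n" "Y * X = 1\<^sub>m n" and x: "x \<in> carrier_vec n"
  shows "riccati_mat X *\<^sub>v x = - (X *\<^sub>v (res_mat Y *\<^sub>v (X *\<^sub>v x)))"
proof -
  have G: "B * mat_adjoint B \<in> carrier_mat n n"
    using hermitian_carrier [OF hermitian_gram [OF B]] .
  define y where "y = X *\<^sub>v x"
  have y: "y \<in> carrier_vec n" using X x by (simp add: y_def)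
  have Yy: "Y *\<^sub>v y = x" using assoc_mult_mat_vec [OF Y X x] XY x by (simp add: y_def)
  have XYz: "X *\<^sub>v (Y *\<^sub>v z) = z" if "z \<in> carrier_vec n" for z
    using assoc_mult_mat_vec [OF X Y that] XY that by simp
  have c: "Y *\<^sub>v x \<in> carrier_vec n" "A *\<^sub>v x \<in> carrier_vec n" "Y *\<^sub>v (A *\<^sub>v y) \<in> carrier_vec n"
    "(B * mat_adjoint B) *\<^sub>v y \<in> carrier_vec n" "A *\<^sub>v y \<in> carrier_vec n"
    using X Y A G x y by auto
  have "X *\<^sub>v (res_mat Y *\<^sub>v y) =
      (X *\<^sub>v (Y *\<^sub>v x) + X *\<^sub>v (A *\<^sub>v x)) - (X *\<^sub>v (Y *\<^sub>v (A *\<^sub>v y)) + X *\<^sub>v ((B * mat_adjoint B) *\<^sub>v y))"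
    unfolding res_mat_mult_vec [OF Y y] Yy
    using mult_minus_distrib_mat_vec [OF X add_carrier_vec [OF c(1,2)] add_carrier_vec [OF c(3,4)]]
      mult_add_distrib_mat_vec [OF X c(1,2)] mult_add_distrib_mat_vec [OF X c(3,4)] by simp
  also have "\<dots> = (x + X *\<^sub>v (A *\<^sub>v x)) - (A *\<^sub>v y + X *\<^sub>v ((B * mat_adjoint B) *\<^sub>v y))"
    using XYz x c by simp
  finally have 1: "X *\<^sub>v (res_mat Y *\<^sub>v y) = (x + X *\<^sub>v (A *\<^sub>v x)) - (A *\<^sub>v y + X *\<^sub>v ((B * mat_adjoint B) *\<^sub>v y))" .
  have c2: "X *\<^sub>v (A *\<^sub>v x) \<in> carrier_vec n" "X *\<^sub>v ((B * mat_adjoint B) *\<^sub>v y) \<in> carrier_vec n"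
    using X c by auto
  have vec: "p - q - (- r) - x = - ((x + q) - (r + p))"
    if "p \<in> carrier_vec n" "q \<in> carrier_vec n" "r \<in> carrier_vec n" for p q r
    using that x by (intro eq_vecI) auto
  show ?thesis
    unfolding riccati_mat_mult_vec [OF X x] y_def [symmetric] 1
    using vec c c2 x by blast
qed

text \<open>The order on the complex numbers also asks the form to be real, which holds for every
  Hermitian X; so real parts suffice from here on.\<close>

lemma riccati_sol_iff:
  "riccati_sol A B X \<longleftrightarrow> hermitian n X \<and>
    (\<forall>x \<in> carrier_vec n. 0 \<le> Re ((X *\<^sub>v x) \<bullet>c x)) \<and> riccati_mat X = 0\<^sub>m n n"
proof -
  have dA: "dim_row A = n" using A by simp
  have "nonneg_mat X \<longleftrightarrow> mat_adjoint X = X \<and> (\<forall>x \<in> carrier_vec n. 0 \<le> Re ((X *\<^sub>v x) \<bullet>c x))"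
    if X: "X \<in> carrier_mat n n"
  proof -
    have "0 \<le> (X *\<^sub>v x) \<bullet>c x \<longleftrightarrow> 0 \<le> Re ((X *\<^sub>v x) \<bullet>c x)"
      if "mat_adjoint X = X" "x \<in> carrier_vec n" for x
    proof -
      have "Im ((X *\<^sub>v x) \<bullet>c x) = 0"
        using hermitian_Im_0 [of n X x] that X by (metis Im_complex_of_real hermitian_def)
      then show ?thesis by (simp add: less_eq_complex_def)
    qed
    then show ?thesis using X by (auto simp: nonneg_mat_def)
  qed
  then show ?thesis
    by (auto simp: riccati_sol_def riccati_mat_def hermitian_def dA)
qed

text \<open>If X x = 0, the Riccati equation at x reduces to X A x = -x. Pairing with x gives 0 on
  the left, because X moves over to x, and hence x = 0. Positivity holds because the form of Y at x
  is that of X at Y x.\<close>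

lemma riccati_sol_inverse:
  assumes X: "riccati_sol A B X"
  obtains Y where "hermitian n Y" "X * Y = 1\<^sub>m n" "Y * X = 1\<^sub>m n" "res_mat Y = 0\<^sub>m n n"
    "\<And>x. x \<in> carrier_vec n \<Longrightarrow> x \<noteq> 0\<^sub>v n \<Longrightarrow> 0 < Re ((Y *\<^sub>v x) \<bullet>c x)"
proof -
  have h: "hermitian n X" and psd: "\<And>x. x \<in> carrier_vec n \<Longrightarrow> 0 \<le> Re ((X *\<^sub>v x) \<bullet>c x)"
    and eq: "riccati_mat X = 0\<^sub>m n n"
    using X by (auto simp: riccati_sol_iff)
  have Xc: "X \<in> carrier_mat n n" using h hermitian_carrier by blast
  have G: "B * mat_adjoint B \<in> carrier_mat n n"
    using hermitian_carrier [OF hermitian_gram [OF B]] .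
  have inj: "x = 0\<^sub>v n" if x: "x \<in> carrier_vec n" "X *\<^sub>v x = 0\<^sub>v n" for x
  proof -
    let ?z = "(B * mat_adjoint B) *\<^sub>v (X *\<^sub>v x)"
    have c: "?z \<in> carrier_vec n" "A *\<^sub>v x \<in> carrier_vec n" "X *\<^sub>v (A *\<^sub>v x) \<in> carrier_vec n"
      using Xc G A x by auto
    have X0: "X *\<^sub>v ?z = 0\<^sub>v n" "A *\<^sub>v (X *\<^sub>v x) = 0\<^sub>v n"
      using x mult_mat_zero_vec [OF G] mult_mat_zero_vec [OF Xc] mult_mat_zero_vec [OF A] by auto
    have zero: "0\<^sub>v n = 0\<^sub>v n - X *\<^sub>v (A *\<^sub>v x) - (- 0\<^sub>v n) - x"
      using riccati_mat_mult_vec [OF Xc x(1)] eq X0 zero_mat_mult_vec [OF x(1), of n] by simp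
    have "p = (- 1) \<cdot>\<^sub>v x" if "p \<in> carrier_vec n" "0\<^sub>v n = 0\<^sub>v n - p - (- 0\<^sub>v n) - x" for p
    proof (rule eq_vecI)
      fix i assume "i < dim_vec ((- 1) \<cdot>\<^sub>v x)"
      then have i: "i < n" using x by simp
      have "(0\<^sub>v n - p - (- 0\<^sub>v n) - x) $ i = 0" using that(2) i by (metis index_zero_vec(1))
      then have "- p $ i - x $ i = 0" using i x that(1) by simp
      then have "p $ i = - x $ i" by (metis add.inverse_inverse diff_eq_eq add_0)
      then show "p $ i = ((- 1) \<cdot>\<^sub>v x) $ i" using i x by simp
    qed (use x that in auto)
    then have "X *\<^sub>v (A *\<^sub>v x) = (- 1) \<cdot>\<^sub>v x" using c(3) zero by blast
    moreover have "(X *\<^sub>v (A *\<^sub>v x)) \<bullet>c x = 0"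
      using hermitian_scalar_prod_conj [OF h c(2) x(1)] x(2) c by simp
    ultimately have "nsq x = 0"
      using scalar_prod_conj_simps(5) [OF x(1) x(1) x(1), of "- 1"] by (simp add: scalar_prod_conj_self)
    then show ?thesis using nsq_eq_0_iff [OF x(1)] by simp
  qed
  obtain Y where Y: "Y \<in> carrier_mat n n" "X * Y = 1\<^sub>m n" "Y * X = 1\<^sub>m n"
    using injective_invertible [OF Xc inj] by blast
  have hY: "hermitian n Y" by (rule hermitian_inverse [OF h Y])
  have XYz: "X *\<^sub>v (Y *\<^sub>v z) = z" "Y *\<^sub>v (X *\<^sub>v z) = z" if "z \<in> carrier_vec n" for z
    using assoc_mult_mat_vec [OF Xc Y(1) that] assoc_mult_mat_vec [OF Y(1) Xc that] Y that by simp_all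
  have "res_mat Y = 0\<^sub>m n n"
  proof (rule mat_eqI_mult_vec)
    fix x :: "complex Matrix.vec" assume x: "x \<in> carrier_vec n"
    have r: "res_mat Y *\<^sub>v x \<in> carrier_vec n" using res_mat_carrier [OF Y(1)] x by simp
    have "riccati_mat X *\<^sub>v (Y *\<^sub>v x) = 0\<^sub>v n"
      using Y(1) x unfolding eq by (intro eq_vecI) auto
    then have "- (X *\<^sub>v (res_mat Y *\<^sub>v x)) = 0\<^sub>v n"
      using riccati_mat_res_mat [OF Xc Y, of "Y *\<^sub>v x"] XYz(1) [OF x] Y(1) x by simp
    then have "- (- (X *\<^sub>v (res_mat Y *\<^sub>v x))) = - (0\<^sub>v n :: complex Matrix.vec)"
      by (rule arg_cong)
    then have "X *\<^sub>v (res_mat Y *\<^sub>v x) = 0\<^sub>v n" by simp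
    then have "res_mat Y *\<^sub>v x = 0\<^sub>v n"
      using XYz(2) [OF r] mult_mat_zero_vec [OF Y(1)] by simp
    then show "res_mat Y *\<^sub>v x = 0\<^sub>m n n *\<^sub>v x" using x by (simp add: zero_mat_mult_vec)
  qed (use res_mat_carrier [OF Y(1)] in auto)
  moreover have "0 < Re ((Y *\<^sub>v x) \<bullet>c x)" if x: "x \<in> carrier_vec n" "x \<noteq> 0\<^sub>v n" for x
  proof (rule ccontr)
    have Yx: "Y *\<^sub>v x \<in> carrier_vec n" using Y(1) x by simp
    assume "\<not> 0 < Re ((Y *\<^sub>v x) \<bullet>c x)"
    moreover have "Re ((X *\<^sub>v (Y *\<^sub>v x)) \<bullet>c (Y *\<^sub>v x)) = Re ((Y *\<^sub>v x) \<bullet>c x)"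
      using XYz(1) [OF x(1)] Re_scalar_prod_conj_commute [OF x(1) Yx] by simp
    ultimately have "Re ((X *\<^sub>v (Y *\<^sub>v x)) \<bullet>c (Y *\<^sub>v x)) = 0"
      using psd [OF Yx] by simp
    then have "X *\<^sub>v (Y *\<^sub>v x) = 0\<^sub>v n"
      using psd_null_vector [OF h Yx psd] by blast
    then show False using XYz(1) [OF x(1)] x(2) by simp
  qed
  ultimately show thesis using hY Y by (intro that)
qed

text \<open>The difference \<open>res_form Y x - res_form Z x\<close> is the real part of the inner
  product of (Y - Z) x and (Y + Z - 2 A) x. It vanishes and Y + Z - 2 A is accretive, so
  \<open>lyapunov_zero\<close> applies.\<close>

lemma riccati_inverse_unique:
  assumes Y: "hermitian n Y" "res_mat Y = 0\<^sub>m n n"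
      "\<And>x. x \<in> carrier_vec n \<Longrightarrow> x \<noteq> 0\<^sub>v n \<Longrightarrow> 0 < Re ((Y *\<^sub>v x) \<bullet>c x)"
    and Z: "hermitian n Z" "res_mat Z = 0\<^sub>m n n"
      "\<And>x. x \<in> carrier_vec n \<Longrightarrow> x \<noteq> 0\<^sub>v n \<Longrightarrow> 0 < Re ((Z *\<^sub>v x) \<bullet>c x)"
  shows "Y = Z"
proof -
  have Yc: "Y \<in> carrier_mat n n" and Zc: "Z \<in> carrier_mat n n"
    using Y(1) Z(1) hermitian_carrier by auto
  let ?W = "(Y - A) + (Z - A)"
  have W: "?W \<in> carrier_mat n n" using A by (simp add: minus_carrier_mat)
  have Wx: "?W *\<^sub>v x = (Y *\<^sub>v x - A *\<^sub>v x) + (Z *\<^sub>v x - A *\<^sub>v x)" if "x \<in> carrier_vec n" for x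
    using add_mult_distrib_mat_vec [OF minus_carrier_mat [OF A] minus_carrier_mat [OF A] that]
      mult_vec_diff [OF Yc A that] mult_vec_diff [OF Zc A that] by simp
  have Dx: "(Y - Z) *\<^sub>v x = Y *\<^sub>v x - Z *\<^sub>v x" if "x \<in> carrier_vec n" for x
    by (rule mult_vec_diff [OF Yc Zc that])
  have res0: "res_form Y x = 0" "res_form Z x = 0" if x: "x \<in> carrier_vec n" for x
  proof -
    show "res_form Y x = 0" "res_form Z x = 0"
      using res_mat_form [OF Y(1) x] res_mat_form [OF Z(1) x] x
      unfolding Y(2) Z(2) by (simp_all add: zero_mat_mult_vec)
  qed
  have "Y - Z = 0\<^sub>m n n"
  proof (rule lyapunov_zero [OF hermitian_minus [OF Y(1) Z(1)] W])
    fix x :: "complex Matrix.vec" assume x: "x \<in> carrier_vec n"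
    have c: "Y *\<^sub>v x \<in> carrier_vec n" "Z *\<^sub>v x \<in> carrier_vec n" "A *\<^sub>v x \<in> carrier_vec n"
      using x Yc Zc A by auto
    show "0 < Re ((?W *\<^sub>v x) \<bullet>c x)" if "x \<noteq> 0\<^sub>v n"
      using Y(3) [OF x that] Z(3) [OF x that] skew_form_zero [OF x] c x
      by (simp add: Wx scalar_prod_conj_simps [where n = n])
    show "Re (((Y - Z) *\<^sub>v x) \<bullet>c (?W *\<^sub>v x)) = 0"
      using res0 [OF x] Re_scalar_prod_conj_commute [OF c(1,2)] c x
      by (simp add: Wx Dx scalar_prod_conj_simps [where n = n] scalar_prod_conj_self res_form_def)
  qed
  then have "(Y - Z) $$ (i, j) = 0" if "i < n" "j < n" for i j
    using that by simp
  then show ?thesis using Yc Zc by (intro eq_matI) auto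
qed

lemma riccati_sol_unique:
  assumes X: "riccati_sol A B X" and Z: "riccati_sol A B Z"
  shows "X = Z"
proof -
  obtain Y where Y: "hermitian n Y" "X * Y = 1\<^sub>m n" "Y * X = 1\<^sub>m n" "res_mat Y = 0\<^sub>m n n"
    "\<And>x. x \<in> carrier_vec n \<Longrightarrow> x \<noteq> 0\<^sub>v n \<Longrightarrow> 0 < Re ((Y *\<^sub>v x) \<bullet>c x)"
    using riccati_sol_inverse [OF X] by blast
  obtain V where V: "hermitian n V" "Z * V = 1\<^sub>m n" "V * Z = 1\<^sub>m n" "res_mat V = 0\<^sub>m n n"
    "\<And>x. x \<in> carrier_vec n \<Longrightarrow> x \<noteq> 0\<^sub>v n \<Longrightarrow> 0 < Re ((V *\<^sub>v x) \<bullet>c x)"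
    using riccati_sol_inverse [OF Z] by blast
  have c: "X \<in> carrier_mat n n" "Y \<in> carrier_mat n n" "Z \<in> carrier_mat n n"
    using X Z Y(1) hermitian_carrier by (auto simp: riccati_sol_iff)
  have "Y = V" by (rule riccati_inverse_unique [OF Y(1,4,5) V(1,4,5)])
  then have "X = X * (Y * Z)" using V c by simp
  also have "\<dots> = (X * Y) * Z" by (rule assoc_mult_mat [OF c, symmetric])
  also have "\<dots> = Z" using Y c by simp
  finally show ?thesis .
qed

text \<open>Existence and uniqueness give the definite description in \<open>closed_loop\<close> its
  value, the inverse of Y. The vanishing residual rearranges to the intertwining relation
  \<open>conj\<close>, along which Y carries eigenvectors of A - Y to those of the closed
  loop.\<close>

lemma closed_loop_spectrum:
  obtains Y where "hermitian n Y" "res_mat Y = 0\<^sub>m n n"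
    "\<And>x. x \<in> carrier_vec n \<Longrightarrow> x \<noteq> 0\<^sub>v n \<Longrightarrow> 0 < Re ((Y *\<^sub>v x) \<bullet>c x)"
    "\<And>\<nu>. eigenvalue (closed_loop A B) \<nu> \<longleftrightarrow> eigenvalue (A - Y) \<nu>"
proof -
  obtain Y where Y: "hermitian n Y" "\<And>x. x \<in> carrier_vec n \<Longrightarrow> x \<noteq> 0\<^sub>v n \<Longrightarrow> 0 < Re ((Y *\<^sub>v x) \<bullet>c x)"
    "res_mat Y = 0\<^sub>m n n"
    using riccati_inverse_exists by blast
  have Yc: "Y \<in> carrier_mat n n" using Y(1) hermitian_carrier by blast
  have G: "B * mat_adjoint B \<in> carrier_mat n n"
    using hermitian_carrier [OF hermitian_gram [OF B]] .
  have "x = 0\<^sub>v n" if "x \<in> carrier_vec n" "Y *\<^sub>v x = 0\<^sub>v n" for x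
    using Y(2) [OF that(1)] that by fastforce
  then obtain X where X: "X \<in> carrier_mat n n" "Y * X = 1\<^sub>m n" "X * Y = 1\<^sub>m n"
    using injective_invertible [OF Yc] by blast
  have hX: "hermitian n X" by (rule hermitian_inverse [OF Y(1) X])
  have XYz: "X *\<^sub>v (Y *\<^sub>v z) = z" "Y *\<^sub>v (X *\<^sub>v z) = z" if "z \<in> carrier_vec n" for z
    using assoc_mult_mat_vec [OF X(1) Yc that] assoc_mult_mat_vec [OF Yc X(1) that] X that by simp_all
  have res0: "res_mat Y *\<^sub>v z = 0\<^sub>v n" if "z \<in> carrier_vec n" for z
    unfolding Y(3) using that by (intro eq_vecI) auto
  have "riccati_mat X = 0\<^sub>m n n"
  proof (rule mat_eqI_mult_vec)
    show "riccati_mat X \<in> carrier_mat n n"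
      unfolding riccati_mat_def by (rule minus_carrier_mat) simp
    fix x :: "complex Matrix.vec" assume x: "x \<in> carrier_vec n"
    have "riccati_mat X *\<^sub>v x = - (X *\<^sub>v 0\<^sub>v n)"
      using riccati_mat_res_mat [OF X(1) Yc X(3,2) x] res0 X x by simp
    then show "riccati_mat X *\<^sub>v x = 0\<^sub>m n n *\<^sub>v x"
      using x mult_mat_zero_vec [OF X(1)] by (intro eq_vecI) auto
  qed simp
  moreover have "0 \<le> Re ((X *\<^sub>v x) \<bullet>c x)" if x: "x \<in> carrier_vec n" for x
  proof -
    have Xx: "X *\<^sub>v x \<in> carrier_vec n" using X x by simp
    have "0 \<le> Re ((Y *\<^sub>v (X *\<^sub>v x)) \<bullet>c (X *\<^sub>v x))"
    proof (cases "X *\<^sub>v x = 0\<^sub>v n")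
      case True
      then show ?thesis using mult_mat_zero_vec [OF Yc] by simp
    next
      case False
      then show ?thesis using Y(2) [OF Xx] by simp
    qed
    then show ?thesis using XYz(2) [OF x] Re_scalar_prod_conj_commute [OF x Xx] by simp
  qed
  ultimately have sol: "riccati_sol A B X" using hX by (simp add: riccati_sol_iff)
  have "(THE X. riccati_sol A B X) = X"
    using sol riccati_sol_unique by blast
  then have cl: "closed_loop A B = A - (B * mat_adjoint B) * X"
    by (simp add: closed_loop_def)
  have GX: "(B * mat_adjoint B) * X \<in> carrier_mat n n" using G X by simp
  have F: "closed_loop A B \<in> carrier_mat n n"
    unfolding cl by (rule minus_carrier_mat [OF GX])
  have AY: "A - Y \<in> carrier_mat n n" by (rule minus_carrier_mat [OF Yc])
  have conj: "closed_loop A B *\<^sub>v (Y *\<^sub>v u) = Y *\<^sub>v ((A - Y) *\<^sub>v u)" if u: "u \<in> carrier_vec n" for u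
  proof -
    have c: "Y *\<^sub>v u \<in> carrier_vec n" "A *\<^sub>v u \<in> carrier_vec n" "(B * mat_adjoint B) *\<^sub>v u \<in> carrier_vec n"
      using Yc A G u by auto
    have c2: "Y *\<^sub>v (Y *\<^sub>v u) \<in> carrier_vec n" "A *\<^sub>v (Y *\<^sub>v u) \<in> carrier_vec n" "Y *\<^sub>v (A *\<^sub>v u) \<in> carrier_vec n"
      using Yc A c by auto
    have 1: "closed_loop A B *\<^sub>v (Y *\<^sub>v u) = A *\<^sub>v (Y *\<^sub>v u) - (B * mat_adjoint B) *\<^sub>v u"
      unfolding cl using mult_vec_diff [OF A GX c(1)] assoc_mult_mat_vec [OF G X(1) c(1)] XYz(1) [OF u] by simp
    have 2: "Y *\<^sub>v ((A - Y) *\<^sub>v u) = Y *\<^sub>v (A *\<^sub>v u) - Y *\<^sub>v (Y *\<^sub>v u)"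
      using mult_vec_diff [OF A Yc u] mult_minus_distrib_mat_vec [OF Yc c(2,1)] by simp
    have 3: "(Y *\<^sub>v (Y *\<^sub>v u) + A *\<^sub>v (Y *\<^sub>v u)) - (Y *\<^sub>v (A *\<^sub>v u) + (B * mat_adjoint B) *\<^sub>v u) = 0\<^sub>v n"
      using res_mat_mult_vec [OF Yc u] res0 [OF u] by simp
    show ?thesis
      unfolding 1 2 by (rule vec_balance [OF c2(1,2,3) c(3) 3])
  qed
  have "eigenvalue (closed_loop A B) \<nu> \<longleftrightarrow> eigenvalue (A - Y) \<nu>" for \<nu>
  proof
    assume "eigenvalue (closed_loop A B) \<nu>"
    then obtain x where x: "x \<in> carrier_vec n" "x \<noteq> 0\<^sub>v n" "closed_loop A B *\<^sub>v x = \<nu> \<cdot>\<^sub>v x"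
      using eigenvalueE [OF _ F] by blast
    define u where "u = X *\<^sub>v x"
    have u: "u \<in> carrier_vec n" "Y *\<^sub>v u = x" using X x XYz by (auto simp: u_def)
    have "u \<noteq> 0\<^sub>v n" using u x mult_mat_zero_vec [OF Yc] by auto
    moreover have "(A - Y) *\<^sub>v u \<in> carrier_vec n" using AY u by simp
    then have "(A - Y) *\<^sub>v u = X *\<^sub>v (\<nu> \<cdot>\<^sub>v x)"
      using conj [OF u(1)] u x XYz(1) by metis
    then have "(A - Y) *\<^sub>v u = \<nu> \<cdot>\<^sub>v u"
      using mult_mat_vec [OF X(1) x(1)] by (simp add: u_def)
    ultimately show "eigenvalue (A - Y) \<nu>"
      using u AY unfolding eigenvalue_def eigenvector_def by (metis carrier_matD(1))
  next
    assume "eigenvalue (A - Y) \<nu>"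
    then obtain u where u: "u \<in> carrier_vec n" "u \<noteq> 0\<^sub>v n" "(A - Y) *\<^sub>v u = \<nu> \<cdot>\<^sub>v u"
      using eigenvalueE [OF _ AY] by blast
    have "closed_loop A B *\<^sub>v (Y *\<^sub>v u) = \<nu> \<cdot>\<^sub>v (Y *\<^sub>v u)"
      using conj [OF u(1)] u mult_mat_vec [OF Yc u(1)] by simp
    moreover have "Y *\<^sub>v u \<noteq> 0\<^sub>v n"
      using XYz(1) [OF u(1)] u(2) mult_mat_zero_vec [OF X(1)] by auto
    moreover have "Y *\<^sub>v u \<in> carrier_vec n" using Yc u by simp
    ultimately show "eigenvalue (closed_loop A B) \<nu>"
      using F unfolding eigenvalue_def eigenvector_def by (metis carrier_matD(1))
  qed
  with Y show thesis by (intro that)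
qed

end

section \<open>Upper bound for the decay rate\<close>

definition mat_trace :: "complex Matrix.mat \<Rightarrow> complex" where
  "mat_trace M = (\<Sum>i<dim_row M. M $$ (i, i))"

lemma mat_trace_mult_commute:
  assumes "M \<in> carrier_mat n k" "N \<in> carrier_mat k n"
  shows "mat_trace (M * N) = mat_trace (N * M)"
proof -
  have "mat_trace (M * N) = (\<Sum>i<n. \<Sum>j<k. M $$ (i, j) * N $$ (j, i))"
    using assms by (auto simp: mat_trace_def scalar_prod_def lessThan_atLeast0 intro!: sum.cong)
  also have "\<dots> = (\<Sum>j<k. \<Sum>i<n. M $$ (i, j) * N $$ (j, i))"
    by (rule sum.swap)
  also have "\<dots> = mat_trace (N * M)"
    using assms by (auto simp: mat_trace_def scalar_prod_def lessThan_atLeast0 mult.commute intro!: sum.cong)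
  finally show ?thesis .
qed

lemma mat_trace_similar:
  assumes "T \<in> carrier_mat n n" "P \<in> carrier_mat n n" "Q \<in> carrier_mat n n" "Q * P = 1\<^sub>m n"
  shows "mat_trace (P * T * Q) = mat_trace T"
proof -
  have "mat_trace (P * T * Q) = mat_trace (Q * (P * T))"
    using assms by (intro mat_trace_mult_commute [of _ n n]) auto
  also have "Q * (P * T) = (Q * P) * T"
    by (rule assoc_mult_mat [OF assms(3,2,1), symmetric])
  also have "\<dots> = T" using assms by simp
  finally show ?thesis .
qed

lemma (in orthonormal_basis) mat_trace_basis:
  assumes M: "M \<in> carrier_mat n n"
  shows "mat_trace M = (\<Sum>j<n. (M *\<^sub>v v j) \<bullet>c v j)"
proof -
  have Va: "mat_adjoint basis_mat \<in> carrier_mat n n" by simp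
  have "mat_trace M = mat_trace (mat_adjoint basis_mat * M * basis_mat)"
    using mat_trace_similar [OF M Va basis_mat_carrier basis_mat_unitary(2)] by simp
  also have "mat_adjoint basis_mat * M * basis_mat = mat_adjoint basis_mat * (M * basis_mat)"
    by (rule assoc_mult_mat [OF Va M basis_mat_carrier])
  also have "mat_trace \<dots> = (\<Sum>j<n. (M *\<^sub>v v j) \<bullet>c v j)"
  proof -
    have "(mat_adjoint basis_mat * (M * basis_mat)) $$ (j, j) = (M *\<^sub>v v j) \<bullet>c v j" if j: "j < n" for j
    proof -
      have "col (M * basis_mat) j = M *\<^sub>v v j"
        using j M col_basis_mat [OF j] by (metis basis_mat_carrier carrier_matD(2) col_mult2)
      then have "(mat_adjoint basis_mat * (M * basis_mat)) $$ (j, j) = (mat_adjoint basis_mat *\<^sub>v (M *\<^sub>v v j)) $ j"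
        using j M by simp
      also have "\<dots> = (M *\<^sub>v v j) \<bullet>c v j"
        using M basis_carrier [OF j] j by (intro adjoint_basis_mat_index) auto
      finally show ?thesis .
    qed
    then show ?thesis by (simp add: mat_trace_def)
  qed
  finally show ?thesis .
qed

lemma finite_eigenvalues:
  fixes W :: "complex Matrix.mat"
  assumes "W \<in> carrier_mat n n"
  shows "finite {\<nu>. eigenvalue W \<nu>}"
proof -
  have "char_poly W \<noteq> 0" using degree_monic_char_poly [OF assms] by auto
  then show ?thesis
    using poly_roots_finite eigenvalue_root_char_poly [OF assms] by simp
qed

context skew_system
begin

lemma dim_B: "dim_row B = n" "dim_col B = m"
  using B by auto

lemma adjoint_B_carrier: "x \<in> carrier_vec n \<Longrightarrow> mat_adjoint B *\<^sub>v x \<in> carrier_vec m"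
  using mat_adjoint_mult_vec_carrier [OF B] .

text \<open>Both sides are the squared Frobenius norm of B, summed by rows in the basis
  \<open>v\<close> and by columns.\<close>

lemma sum_nsq_adjoint_B:
  "(\<Sum>j<n. nsq (mat_adjoint B *\<^sub>v v j)) = (\<Sum>l<m. nsq (B *\<^sub>v unit_vec m l))"
proof -
  have "nsq (mat_adjoint B *\<^sub>v v j) = (\<Sum>l<m. (cmod ((B *\<^sub>v unit_vec m l) \<bullet>c v j))\<^sup>2)" if j: "j < n" for j
  proof -
    have vj: "v j \<in> carrier_vec n" using basis_carrier [OF j] .
    have "(cmod ((mat_adjoint B *\<^sub>v v j) $ l))\<^sup>2 = (cmod ((B *\<^sub>v unit_vec m l) \<bullet>c v j))\<^sup>2" if l: "l < m" for l
    proof -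
      have Be: "B *\<^sub>v unit_vec m l \<in> carrier_vec n" using B by simp
      have "(mat_adjoint B *\<^sub>v v j) $ l = (mat_adjoint B *\<^sub>v v j) \<bullet>c unit_vec m l"
        using scalar_prod_conj_unit_vec [OF adjoint_B_carrier [OF vj] l] by simp
      also have "\<dots> = v j \<bullet>c (B *\<^sub>v unit_vec m l)"
        by (rule mat_adjoint_scalar_prod_conj [OF B vj unit_vec_carrier])
      also have "\<dots> = cnj ((B *\<^sub>v unit_vec m l) \<bullet>c v j)"
        using cnj_scalar_prod_conj [OF Be vj] by simp
      finally show ?thesis by (simp only: complex_mod_cnj)
    qed
    then show ?thesis by (simp add: nsq_def dim_B del: index_mult_mat_vec)
  qed
  then have "(\<Sum>j<n. nsq (mat_adjoint B *\<^sub>v v j)) = (\<Sum>j<n. \<Sum>l<m. (cmod ((B *\<^sub>v unit_vec m l) \<bullet>c v j))\<^sup>2)"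
    by simp
  also have "\<dots> = (\<Sum>l<m. \<Sum>j<n. (cmod ((B *\<^sub>v unit_vec m l) \<bullet>c v j))\<^sup>2)"
    by (rule sum.swap)
  also have "\<dots> = (\<Sum>l<m. nsq (B *\<^sub>v unit_vec m l))"
    using B parseval by simp
  finally show ?thesis .
qed

lemma res_zero_form:
  assumes Y: "hermitian n Y" "res_mat Y = 0\<^sub>m n n" and x: "x \<in> carrier_vec n"
  shows "res_form Y x = 0"
  using res_mat_form [OF Y(1) x] x unfolding Y(2) by (simp add: zero_mat_mult_vec)

text \<open>The eigenvalue is imaginary and the form of Y is real. Hence the commutator has zero
  diagonal in the eigenbasis of A, and the diagonal of the residual equation compares only
  lengths.\<close>

lemma hermitian_basis_diag:
  assumes Y: "hermitian n Y" and j: "j < n"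
  shows "Re ((Y *\<^sub>v v j) \<bullet>c (A *\<^sub>v v j)) = 0"
proof -
  have vj: "v j \<in> carrier_vec n" using basis_carrier [OF j] .
  have Yv: "Y *\<^sub>v v j \<in> carrier_vec n" using hermitian_carrier [OF Y] vj by simp
  have "(Y *\<^sub>v v j) \<bullet>c (A *\<^sub>v v j) = cnj (\<i> * of_real (lam j)) * ((Y *\<^sub>v v j) \<bullet>c v j)"
    unfolding eigen [OF j] by (rule scalar_prod_conj_simps(6) [OF vj vj Yv])
  also have "\<dots> = cnj (\<i> * of_real (lam j)) * of_real (Re ((Y *\<^sub>v v j) \<bullet>c v j))"
    using hermitian_Im_0 [OF Y vj] by simp
  finally show ?thesis by simp
qed

lemma nsq_inverse_basis:
  assumes Y: "hermitian n Y" "res_mat Y = 0\<^sub>m n n" and j: "j < n"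
  shows "nsq (Y *\<^sub>v v j) = nsq (mat_adjoint B *\<^sub>v v j)"
  using res_zero_form [OF Y basis_carrier [OF j]] hermitian_basis_diag [OF Y(1) j]
  by (simp add: res_form_def)

lemma spectrum_neg:
  assumes Y: "hermitian n Y"
    and pos: "\<And>x. x \<in> carrier_vec n \<Longrightarrow> x \<noteq> 0\<^sub>v n \<Longrightarrow> 0 < Re ((Y *\<^sub>v x) \<bullet>c x)"
    and ev: "eigenvalue (A - Y) \<nu>"
  shows "Re \<nu> < 0"
proof -
  have Yc: "Y \<in> carrier_mat n n" using Y hermitian_carrier by blast
  obtain x where x: "x \<in> carrier_vec n" "x \<noteq> 0\<^sub>v n" "(A - Y) *\<^sub>v x = \<nu> \<cdot>\<^sub>v x"
    using eigenvalueE [OF ev minus_carrier_mat [OF Yc]] by blast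
  have "((A - Y) *\<^sub>v x) \<bullet>c x = \<nu> * of_real (nsq x)"
    using scalar_prod_conj_simps(5) [OF x(1) x(1) x(1)] by (simp add: x(3) scalar_prod_conj_self)
  moreover have "Re (((A - Y) *\<^sub>v x) \<bullet>c x) = - Re ((Y *\<^sub>v x) \<bullet>c x)"
    using skew_form_zero [OF x(1)] x(1) A Yc
    by (simp add: mult_vec_diff [OF A Yc] scalar_prod_conj_simps [where n = n])
  ultimately have "Re \<nu> * nsq x < 0" using pos [OF x(1,2)] by simp
  then show ?thesis using nsq_nonneg [of x] by (simp add: mult_less_0_iff)
qed

text \<open>\<open>Min\<close> in \<open>gamma_decay\<close> is meaningful only for a finite
  nonempty set.\<close>

lemma closed_loop_spectrum_finite:
  "finite {\<bar>Re \<nu>\<bar> | \<nu>. eigenvalue (closed_loop A B) \<nu>}"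
  "{\<bar>Re \<nu>\<bar> | \<nu>. eigenvalue (closed_loop A B) \<nu>} \<noteq> {}"
proof -
  obtain Y where Y: "hermitian n Y"
    "\<And>\<nu>. eigenvalue (closed_loop A B) \<nu> \<longleftrightarrow> eigenvalue (A - Y) \<nu>"
    using closed_loop_spectrum by metis
  have AY: "A - Y \<in> carrier_mat n n" by (rule minus_carrier_mat [OF hermitian_carrier [OF Y(1)]])
  show "finite {\<bar>Re \<nu>\<bar> | \<nu>. eigenvalue (closed_loop A B) \<nu>}"
    using finite_eigenvalues [OF AY] Y(2) by (simp add: setcompr_eq_image)
  obtain T P Q where "\<And>j. j < n \<Longrightarrow> eigenvalue (A - Y) (T $$ (j, j))"
    using schur_complex [OF AY] by metis
  then show "{\<bar>Re \<nu>\<bar> | \<nu>. eigenvalue (closed_loop A B) \<nu>} \<noteq> {}"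
    using n_pos Y(2) by blast
qed

text \<open>The closed-loop eigenvalues sum up to the trace of \<open>A - Y\<close>, and the diagonal of \<open>Y\<close> is
  bounded by the rows of \<open>B\<close>.\<close>

lemma gamma_decay_le:
  assumes \<beta>: "0 \<le> \<beta>" and bound: "\<And>l. l < m \<Longrightarrow> nsq (B *\<^sub>v unit_vec m l) \<le> \<beta>\<^sup>2"
  shows "gamma_decay A B \<le> \<beta> * sqrt (real m / real n)"
proof -
  obtain Y where Y: "hermitian n Y" "res_mat Y = 0\<^sub>m n n"
    and pos: "\<And>x. x \<in> carrier_vec n \<Longrightarrow> x \<noteq> 0\<^sub>v n \<Longrightarrow> 0 < Re ((Y *\<^sub>v x) \<bullet>c x)"
    and spec: "\<And>\<nu>. eigenvalue (closed_loop A B) \<nu> \<longleftrightarrow> eigenvalue (A - Y) \<nu>"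
    using closed_loop_spectrum by blast
  have Yc: "Y \<in> carrier_mat n n" using Y hermitian_carrier by blast
  have AY: "A - Y \<in> carrier_mat n n" by (rule minus_carrier_mat [OF Yc])
  obtain T P Q where T: "T \<in> carrier_mat n n" "P \<in> carrier_mat n n" "Q \<in> carrier_mat n n"
    "P * Q = 1\<^sub>m n" "Q * P = 1\<^sub>m n" "A - Y = P * T * Q" "upper_triangular T"
    "\<And>j. j < n \<Longrightarrow> eigenvalue (A - Y) (T $$ (j, j))"
    using schur_complex [OF AY] by blast
  let ?\<gamma> = "gamma_decay A B"
  have le: "?\<gamma> \<le> - Re (T $$ (j, j))" if j: "j < n" for j
  proof -
    have "?\<gamma> \<le> \<bar>Re (T $$ (j, j))\<bar>"
      unfolding gamma_decay_def using T(8) [OF j] spec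
      by (intro Min_le closed_loop_spectrum_finite(1)) blast
    then show ?thesis using spectrum_neg [OF Y(1) pos T(8) [OF j]] by simp
  qed
  have diag: "- Re (((A - Y) *\<^sub>v v j) \<bullet>c v j) \<le> sqrt (nsq (mat_adjoint B *\<^sub>v v j))" if j: "j < n" for j
  proof -
    have vj: "v j \<in> carrier_vec n" using basis_carrier [OF j] .
    have Yv: "Y *\<^sub>v v j \<in> carrier_vec n" using Yc vj by simp
    have nv: "nsq (v j) = 1"
      using orthonormal [OF j j] scalar_prod_conj_self [of "v j"] by (metis of_real_eq_1_iff)
    have "- Re (((A - Y) *\<^sub>v v j) \<bullet>c v j) = Re ((Y *\<^sub>v v j) \<bullet>c v j)"
      using skew_form_zero [OF vj] vj A Yc
      by (simp add: mult_vec_diff [OF A Yc] scalar_prod_conj_simps [where n = n])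
    also have "\<dots> \<le> cmod ((Y *\<^sub>v v j) \<bullet>c v j)" by (rule complex_Re_le_cmod)
    also have "\<dots> \<le> sqrt (nsq (Y *\<^sub>v v j))"
      using cauchy_schwarz_nsq [OF Yv vj] nv by (intro real_le_rsqrt) simp
    also have "\<dots> = sqrt (nsq (mat_adjoint B *\<^sub>v v j))"
      using nsq_inverse_basis [OF Y j] by simp
    finally show ?thesis .
  qed
  have "real n * ?\<gamma> = (\<Sum>j<n. ?\<gamma>)" by simp
  also have "\<dots> \<le> (\<Sum>j<n. - Re (T $$ (j, j)))"
    using le by (intro sum_mono) simp
  also have "\<dots> = - Re (mat_trace T)"
    using T(1) by (simp add: mat_trace_def sum_negf)
  also have "mat_trace T = mat_trace (A - Y)"
    unfolding T(6) using mat_trace_similar [OF T(1,2,3,5)] by simp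
  also have "- Re (mat_trace (A - Y)) = (\<Sum>j<n. - Re (((A - Y) *\<^sub>v v j) \<bullet>c v j))"
    by (simp add: mat_trace_basis [OF AY] sum_negf)
  also have "\<dots> \<le> (\<Sum>j<n. sqrt (nsq (mat_adjoint B *\<^sub>v v j)))"
    using diag by (intro sum_mono) simp
  finally have 1: "real n * ?\<gamma> \<le> (\<Sum>j<n. sqrt (nsq (mat_adjoint B *\<^sub>v v j)))" .
  \<comment> \<open>Cauchy-Schwarz against the constant 1. The sum of squares is the squared
    Frobenius norm of B, at most m \<beta>^2 because each of the m columns has length at most
    \<beta>.\<close>
  have "(\<Sum>j<n. sqrt (nsq (mat_adjoint B *\<^sub>v v j)))
      \<le> L2_set (\<lambda>j. sqrt (nsq (mat_adjoint B *\<^sub>v v j))) {..<n} * L2_set (\<lambda>_. 1) {..<n}"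
    using L2_set_mult_ineq [of "\<lambda>j. sqrt (nsq (mat_adjoint B *\<^sub>v v j))" "\<lambda>_. 1" "{..<n}"] by simp
  also have "\<dots> = sqrt (\<Sum>j<n. nsq (mat_adjoint B *\<^sub>v v j)) * sqrt (real n)"
    by (simp add: L2_set_def)
  also have "\<dots> \<le> sqrt (real m * \<beta>\<^sup>2) * sqrt (real n)"
  proof -
    have "(\<Sum>j<n. nsq (mat_adjoint B *\<^sub>v v j)) \<le> (\<Sum>l<m. \<beta>\<^sup>2)"
      unfolding sum_nsq_adjoint_B using bound by (intro sum_mono) simp
    then show ?thesis by (intro mult_right_mono real_sqrt_le_mono) auto
  qed
  also have "\<dots> = real n * (\<beta> * sqrt (real m / real n))"
    using n_pos \<beta> by (simp add: real_sqrt_mult real_sqrt_divide field_simps)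
  finally have "real n * ?\<gamma> \<le> real n * (\<beta> * sqrt (real m / real n))"
    using 1 by (rule order.trans [rotated])
  then show ?thesis using n_pos by (simp only: mult_le_cancel_left_pos of_nat_0_less_iff)
qed

end

section \<open>Lower bound for the decay rate\<close>

lemma (in orthonormal_basis) nsq_remove_coordinate:
  assumes x: "x \<in> carrier_vec n" and j: "j < n"
  shows "nsq (x - (x \<bullet>c v j) \<cdot>\<^sub>v v j) = (\<Sum>k\<in>{..<n} - {j}. (cmod (x \<bullet>c v k))\<^sup>2)"
proof -
  define r where "r = x - (x \<bullet>c v j) \<cdot>\<^sub>v v j"
  have vj: "v j \<in> carrier_vec n" using basis_carrier [OF j] .
  have r: "r \<in> carrier_vec n" using x vj by (simp add: r_def)
  have coord: "r \<bullet>c v k = (if k = j then 0 else x \<bullet>c v k)" if k: "k < n" for k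
  proof -
    have vk: "v k \<in> carrier_vec n" using basis_carrier [OF k] .
    have "r \<bullet>c v k = x \<bullet>c v k - (x \<bullet>c v j) * (v j \<bullet>c v k)"
      unfolding r_def using x vj vk by (simp add: scalar_prod_conj_simps [where n = n])
    then show ?thesis using orthonormal [OF j k] by auto
  qed
  have "nsq r = (\<Sum>k<n. (cmod (r \<bullet>c v k))\<^sup>2)" by (rule parseval [OF r])
  also have "\<dots> = (cmod (r \<bullet>c v j))\<^sup>2 + (\<Sum>k\<in>{..<n} - {j}. (cmod (r \<bullet>c v k))\<^sup>2)"
    using j by (intro sum.remove) auto
  also have "\<dots> = (\<Sum>k\<in>{..<n} - {j}. (cmod (x \<bullet>c v k))\<^sup>2)"
    using coord coord [OF j] by (auto intro!: sum.cong)
  finally show ?thesis by (simp add: r_def)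
qed

lemma (in orthonormal_basis) parseval_remove:
  assumes x: "x \<in> carrier_vec n" and j: "j < n"
  shows "nsq x = (cmod (x \<bullet>c v j))\<^sup>2 + (\<Sum>k\<in>{..<n} - {j}. (cmod (x \<bullet>c v k))\<^sup>2)"
  unfolding parseval [OF x] using j by (intro sum.remove) auto

text \<open>For y the image of x under the adjoint of B, |y|^2 is the inner product of B y and x.
  Cauchy-Schwarz and the bound on B give |y|^4 \<le> \<beta>^2 |y|^2 |x|^2, and |y|^2
  cancels.\<close>

lemma adjoint_norm_le:
  fixes B :: "complex Matrix.mat"
  assumes B: "B \<in> carrier_mat n m" and x: "x \<in> carrier_vec n"
    and bound: "\<And>y. y \<in> carrier_vec m \<Longrightarrow> nsq (B *\<^sub>v y) \<le> \<beta>\<^sup>2 * nsq y"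
  shows "nsq (mat_adjoint B *\<^sub>v x) \<le> \<beta>\<^sup>2 * nsq x"
proof (cases "nsq (mat_adjoint B *\<^sub>v x) = 0")
  case True
  then show ?thesis by simp
next
  case False
  define y where "y = mat_adjoint B *\<^sub>v x"
  have y: "y \<in> carrier_vec m" unfolding y_def by (rule mat_adjoint_mult_vec_carrier [OF B x])
  have By: "B *\<^sub>v y \<in> carrier_vec n" using B y by simp
  have pos: "0 < nsq y" using False nsq_nonneg [of y] unfolding y_def by linarith
  have "(B *\<^sub>v y) \<bullet>c x = of_real (nsq y)"
    using mult_mat_vec_scalar_prod_conj [OF B y x] by (simp add: y_def scalar_prod_conj_self)
  then have "(nsq y)\<^sup>2 \<le> nsq (B *\<^sub>v y) * nsq x"
    using cauchy_schwarz_nsq [OF By x] by simp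
  also have "\<dots> \<le> \<beta>\<^sup>2 * nsq y * nsq x"
    using bound [OF y] by (intro mult_right_mono) auto
  finally have "nsq y * nsq y \<le> nsq y * (\<beta>\<^sup>2 * nsq x)"
    by (simp add: power2_eq_square ac_simps)
  then show ?thesis using pos by (simp add: y_def)
qed

text \<open>In the application -a is the real part of an eigenvalue of A - Y, p a diagonal entry of
  Y, S the squared length of the rest of that column and R that of the rest of the eigenvector. The
  hypotheses give p \<ge> 0.86 d, so a \<le> d/2 would force |a - p| \<ge> 0.36 d; but (a - p)^2
  \<le> S R / (1 - R) \<le> d^2 / 12, and 0.36^2 > 1/12.\<close>

lemma gap_estimate:
  fixes a p d R S :: real
  assumes d: "0 < d" and p: "0 \<le> p" "p\<^sup>2 + S = d\<^sup>2" and S: "S \<le> d\<^sup>2 / 4"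
    and R: "0 \<le> R" "R \<le> 1 / 4" "(a - p)\<^sup>2 * (1 - R) \<le> R * S" and S0: "0 \<le> S"
  shows "d / 2 < a"
proof (rule ccontr)
  assume "\<not> d / 2 < a"
  then have a: "a \<le> d / 2" by simp
  have "3 / 4 * d\<^sup>2 \<le> p\<^sup>2" using p(2) S by linarith
  moreover have "(86 / 100 * d)\<^sup>2 = 7396 / 10000 * d\<^sup>2"
    by (simp add: power_mult_distrib power_divide)
  ultimately have "(86 / 100 * d)\<^sup>2 \<le> p\<^sup>2"
    using zero_le_power2 [of d] by linarith
  then have "86 / 100 * d \<le> p" using p(1) by (rule power2_le_imp_le)
  then have "36 / 100 * d \<le> p - a" using a by simp
  then have "(36 / 100 * d)\<^sup>2 \<le> (p - a)\<^sup>2"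
    using d by (intro power_mono) auto
  then have 1: "(1296 / 10000) * d\<^sup>2 \<le> (a - p)\<^sup>2"
    by (simp add: power_mult_distrib power_divide power2_commute)
  have "(a - p)\<^sup>2 * (3 / 4) \<le> (a - p)\<^sup>2 * (1 - R)"
    using R(2) by (intro mult_left_mono) auto
  also have "\<dots> \<le> R * S" by (rule R(3))
  also have "\<dots> \<le> 1 / 4 * (d\<^sup>2 / 4)"
    using R(1,2) S S0 by (intro mult_mono) auto
  finally have "(a - p)\<^sup>2 * (3 / 4) \<le> 1 / 4 * (d\<^sup>2 / 4)" .
  moreover have "0 < d\<^sup>2" using d by simp
  ultimately show False using 1 by linarith
qed

context skew_system
begin

text \<open>At an eigenvector w for the largest eigenvalue \<mu> of Y the commutator has form 0. The
  residual equation thus equates \<mu>^2 with the squared length of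
  \<open>mat_adjoint B *\<^sub>v w\<close>.\<close>

lemma inverse_form_le:
  assumes Y: "hermitian n Y" "res_mat Y = 0\<^sub>m n n" and \<beta>: "0 \<le> \<beta>"
    and bound: "\<And>y. y \<in> carrier_vec m \<Longrightarrow> nsq (B *\<^sub>v y) \<le> \<beta>\<^sup>2 * nsq y"
    and x: "x \<in> carrier_vec n"
  shows "Re ((Y *\<^sub>v x) \<bullet>c x) \<le> \<beta> * nsq x"
proof -
  obtain w \<mu> where w: "w \<in> carrier_vec n" "nsq w = 1" "Y *\<^sub>v w = of_real \<mu> \<cdot>\<^sub>v w"
    and top: "\<And>x. x \<in> carrier_vec n \<Longrightarrow> Re ((Y *\<^sub>v x) \<bullet>c x) \<le> \<mu> * nsq x"
    using rayleigh_max [OF Y(1) n_pos] by blast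
  have Aw: "A *\<^sub>v w \<in> carrier_vec n" using A w by simp
  have "Re (w \<bullet>c (A *\<^sub>v w)) = 0"
    using skew_form_zero [OF w(1)] Re_scalar_prod_conj_commute [OF w(1) Aw] by simp
  then have "\<mu>\<^sup>2 = nsq (mat_adjoint B *\<^sub>v w)"
    using res_zero_form [OF Y w(1)] w scalar_prod_conj_simps(5) [OF w(1) w(1) Aw]
    by (simp add: res_form_def nsq_smult)
  also have "\<dots> \<le> \<beta>\<^sup>2"
    using adjoint_norm_le [OF B w(1) bound] w(2) by simp
  finally have "\<mu> \<le> \<beta>" using \<beta> by (rule power2_le_imp_le)
  then have "\<mu> * nsq x \<le> \<beta> * nsq x" by (intro mult_right_mono) auto
  with top [OF x] show ?thesis by linarith
qed

lemma inverse_norm_le: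
  assumes Y: "hermitian n Y" "res_mat Y = 0\<^sub>m n n"
    and pos: "\<And>x. x \<in> carrier_vec n \<Longrightarrow> x \<noteq> 0\<^sub>v n \<Longrightarrow> 0 < Re ((Y *\<^sub>v x) \<bullet>c x)"
    and \<beta>: "0 < \<beta>"
    and bound: "\<And>y. y \<in> carrier_vec m \<Longrightarrow> nsq (B *\<^sub>v y) \<le> \<beta>\<^sup>2 * nsq y"
    and x: "x \<in> carrier_vec n"
  shows "nsq (Y *\<^sub>v x) \<le> \<beta>\<^sup>2 * nsq x"
proof -
  have psd: "0 \<le> Re ((Y *\<^sub>v y) \<bullet>c y)" if "y \<in> carrier_vec n" for y
    using pos [OF that] mult_mat_zero_vec [OF hermitian_carrier [OF Y(1)]] that
    by (cases "y = 0\<^sub>v n") auto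
  have le: "Re ((Y *\<^sub>v y) \<bullet>c y) \<le> \<beta> * nsq y" if "y \<in> carrier_vec n" for y
    using inverse_form_le [OF Y _ bound that] \<beta> by simp
  have "nsq (Y *\<^sub>v x) \<le> \<beta> * Re ((Y *\<^sub>v x) \<bullet>c x)"
    by (rule psd_bound [OF Y(1) \<beta> psd le x])
  also have "\<dots> \<le> \<beta> * (\<beta> * nsq x)"
    using le [OF x] \<beta> by (intro mult_left_mono) auto
  finally show ?thesis by (simp add: power2_eq_square)
qed

text \<open>Applied to v_j, the equation equates i (lam_k - lam_j) Y_kj with coordinate k of g, the
  difference of \<open>(B * mat_adjoint B) *\<^sub>v v j\<close> and Y^2 v_j. Both terms have length
  at most \<beta> times that of \<open>mat_adjoint B *\<^sub>v v j\<close>; so |g|^2 gains a factor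
  4 \<beta>^2, while the gap contributes 16 \<beta>^2.\<close>

lemma inverse_off_diagonal:
  assumes Y: "hermitian n Y" "res_mat Y = 0\<^sub>m n n"
    and pos: "\<And>x. x \<in> carrier_vec n \<Longrightarrow> x \<noteq> 0\<^sub>v n \<Longrightarrow> 0 < Re ((Y *\<^sub>v x) \<bullet>c x)"
    and \<beta>: "0 < \<beta>"
    and bound: "\<And>y. y \<in> carrier_vec m \<Longrightarrow> nsq (B *\<^sub>v y) \<le> \<beta>\<^sup>2 * nsq y"
    and gap: "\<And>k. k < n \<Longrightarrow> k \<noteq> j \<Longrightarrow> 4 * \<beta> \<le> \<bar>lam k - lam j\<bar>"
    and j: "j < n"
  shows "(\<Sum>k\<in>{..<n} - {j}. (cmod ((Y *\<^sub>v v j) \<bullet>c v k))\<^sup>2) \<le> nsq (mat_adjoint B *\<^sub>v v j) / 4"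
proof -
  have Yc: "Y \<in> carrier_mat n n" using Y hermitian_carrier by blast
  have G: "B * mat_adjoint B \<in> carrier_mat n n"
    using hermitian_carrier [OF hermitian_gram [OF B]] .
  have vj: "v j \<in> carrier_vec n" using basis_carrier [OF j] .
  have Bv: "mat_adjoint B *\<^sub>v v j \<in> carrier_vec m" by (rule adjoint_B_carrier [OF vj])
  define q where "q = nsq (mat_adjoint B *\<^sub>v v j)"
  have c: "Y *\<^sub>v v j \<in> carrier_vec n" "A *\<^sub>v v j \<in> carrier_vec n" "(B * mat_adjoint B) *\<^sub>v v j \<in> carrier_vec n"
    using Yc A G vj by auto
  have c2: "Y *\<^sub>v (Y *\<^sub>v v j) \<in> carrier_vec n" "A *\<^sub>v (Y *\<^sub>v v j) \<in> carrier_vec n" "Y *\<^sub>v (A *\<^sub>v v j) \<in> carrier_vec n"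
    using Yc A c by auto
  define g where "g = (B * mat_adjoint B) *\<^sub>v v j - Y *\<^sub>v (Y *\<^sub>v v j)"
  have g: "g \<in> carrier_vec n" using c c2 by (simp add: g_def)
  have entry: "\<i> * of_real (lam k - lam j) * ((Y *\<^sub>v v j) \<bullet>c v k) = g \<bullet>c v k" if k: "k < n" for k
  proof -
    have vk: "v k \<in> carrier_vec n" using basis_carrier [OF k] .
    have "(res_mat Y *\<^sub>v v j) \<bullet>c v k = 0"
      unfolding Y(2) using vj vk by (simp add: zero_mat_mult_vec)
    then have "(Y *\<^sub>v (Y *\<^sub>v v j)) \<bullet>c v k + (A *\<^sub>v (Y *\<^sub>v v j)) \<bullet>c v k -
        ((Y *\<^sub>v (A *\<^sub>v v j)) \<bullet>c v k + ((B * mat_adjoint B) *\<^sub>v v j) \<bullet>c v k) = 0"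
      unfolding res_mat_mult_vec [OF Yc vj]
      using c c2 vk by (simp add: scalar_prod_conj_simps [where n = n])
    moreover have "(A *\<^sub>v (Y *\<^sub>v v j)) \<bullet>c v k = \<i> * of_real (lam k) * ((Y *\<^sub>v v j) \<bullet>c v k)"
      by (rule coordinate_skew [OF c(1) k])
    moreover have "(Y *\<^sub>v (A *\<^sub>v v j)) \<bullet>c v k = \<i> * of_real (lam j) * ((Y *\<^sub>v v j) \<bullet>c v k)"
      unfolding eigen [OF j] mult_mat_vec [OF Yc vj]
      by (rule scalar_prod_conj_simps(5) [OF c(1) c(1) vk])
    ultimately have "(Y *\<^sub>v (Y *\<^sub>v v j)) \<bullet>c v k + \<i> * of_real (lam k) * ((Y *\<^sub>v v j) \<bullet>c v k) -
        (\<i> * of_real (lam j) * ((Y *\<^sub>v v j) \<bullet>c v k) + ((B * mat_adjoint B) *\<^sub>v v j) \<bullet>c v k) = 0"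
      by (simp only:)
    moreover have "g \<bullet>c v k = ((B * mat_adjoint B) *\<^sub>v v j) \<bullet>c v k - (Y *\<^sub>v (Y *\<^sub>v v j)) \<bullet>c v k"
      unfolding g_def by (rule scalar_prod_conj_simps(3) [OF c(3) c2(1) vk])
    moreover have "\<i> * of_real (lam k - lam j) * t = (b - y) + (y + \<i> * of_real (lam k) * t - (\<i> * of_real (lam j) * t + b))"
      for t b y :: complex
      by (simp add: algebra_simps)
    ultimately show ?thesis by (metis add.right_neutral)
  qed
  have "nsq ((B * mat_adjoint B) *\<^sub>v v j) \<le> \<beta>\<^sup>2 * q"
    using bound [OF Bv] assoc_mult_mat_vec [OF B mat_adjoint_carrier [OF B] vj] by (simp add: q_def)
  moreover have "nsq (Y *\<^sub>v (Y *\<^sub>v v j)) \<le> \<beta>\<^sup>2 * q"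
    using inverse_norm_le [OF Y pos \<beta> bound c(1)] nsq_inverse_basis [OF Y j] by (simp add: q_def)
  \<comment> \<open>Parallelogram law.\<close>
  moreover have "nsq g \<le> 2 * nsq ((B * mat_adjoint B) *\<^sub>v v j) + 2 * nsq (Y *\<^sub>v (Y *\<^sub>v v j))"
    using nsq_diff [OF c(3) c2(1)] nsq_add [OF c(3) c2(1)]
      nsq_nonneg [of "(B * mat_adjoint B) *\<^sub>v v j + Y *\<^sub>v (Y *\<^sub>v v j)"] by (simp add: g_def)
  ultimately have ng: "nsq g \<le> 4 * \<beta>\<^sup>2 * q" by simp
  have "(4 * \<beta>)\<^sup>2 * (\<Sum>k\<in>{..<n} - {j}. (cmod ((Y *\<^sub>v v j) \<bullet>c v k))\<^sup>2) \<le>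
      (\<Sum>k\<in>{..<n} - {j}. (cmod (g \<bullet>c v k))\<^sup>2)"
    unfolding sum_distrib_left
  proof (rule sum_mono)
    fix k assume "k \<in> {..<n} - {j}"
    then have k: "k < n" "k \<noteq> j" by auto
    have "(4 * \<beta>)\<^sup>2 \<le> \<bar>lam k - lam j\<bar>\<^sup>2"
      using gap [OF k] \<beta> by (intro power_mono) auto
    then have "(4 * \<beta>)\<^sup>2 * (cmod ((Y *\<^sub>v v j) \<bullet>c v k))\<^sup>2 \<le> \<bar>lam k - lam j\<bar>\<^sup>2 * (cmod ((Y *\<^sub>v v j) \<bullet>c v k))\<^sup>2"
      by (intro mult_right_mono) auto
    also have "\<dots> = (cmod (\<i> * of_real (lam k - lam j) * ((Y *\<^sub>v v j) \<bullet>c v k)))\<^sup>2"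
      by (simp only: norm_mult norm_of_real norm_ii power_mult_distrib) simp
    finally show "(4 * \<beta>)\<^sup>2 * (cmod ((Y *\<^sub>v v j) \<bullet>c v k))\<^sup>2 \<le> (cmod (g \<bullet>c v k))\<^sup>2"
      unfolding entry [OF k(1)] .
  qed
  also have "\<dots> \<le> nsq g"
    using parseval_remove [OF g j] by simp
  also note ng
  finally have "\<beta>\<^sup>2 * (4 * (\<Sum>k\<in>{..<n} - {j}. (cmod ((Y *\<^sub>v v j) \<bullet>c v k))\<^sup>2)) \<le> \<beta>\<^sup>2 * q"
    by (simp add: power_mult_distrib mult.commute)
  then have "4 * (\<Sum>k\<in>{..<n} - {j}. (cmod ((Y *\<^sub>v v j) \<bullet>c v k))\<^sup>2) \<le> q"
    using \<beta> by (simp only: mult_le_cancel_left_pos zero_less_power)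
  then show ?thesis by (simp add: q_def)
qed

lemma decay_rate_lower:
  assumes Y: "hermitian n Y" "res_mat Y = 0\<^sub>m n n"
    and pos: "\<And>x. x \<in> carrier_vec n \<Longrightarrow> x \<noteq> 0\<^sub>v n \<Longrightarrow> 0 < Re ((Y *\<^sub>v x) \<bullet>c x)"
    and \<beta>: "0 < \<beta>"
    and bound: "\<And>y. y \<in> carrier_vec m \<Longrightarrow> nsq (B *\<^sub>v y) \<le> \<beta>\<^sup>2 * nsq y"
    and gap: "\<And>k j. k < n \<Longrightarrow> j < n \<Longrightarrow> k \<noteq> j \<Longrightarrow> 4 * \<beta> \<le> \<bar>lam k - lam j\<bar>"
    and d: "0 < d" "\<And>j. j < n \<Longrightarrow> nsq (mat_adjoint B *\<^sub>v v j) = d\<^sup>2"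
    and ev: "eigenvalue (A - Y) \<nu>"
  shows "d / 2 < - Re \<nu>"
proof -
  have Yc: "Y \<in> carrier_mat n n" using Y hermitian_carrier by blast
  obtain x where x: "x \<in> carrier_vec n" "x \<noteq> 0\<^sub>v n" "(A - Y) *\<^sub>v x = \<nu> \<cdot>\<^sub>v x"
    using eigenvalueE [OF ev minus_carrier_mat [OF Yc]] by blast
  have xpos: "0 < nsq x" using nsq_pos_iff [OF x(1)] x(2) by simp
  define z where "z = of_real (1 / sqrt (nsq x)) \<cdot>\<^sub>v x"
  have z: "z \<in> carrier_vec n" using x by (simp add: z_def)
  have nz: "nsq z = 1"
    unfolding z_def nsq_smult norm_of_real using xpos by (simp add: power_divide)
  have "(A - Y) *\<^sub>v z = \<nu> \<cdot>\<^sub>v z"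
    unfolding z_def mult_mat_vec [OF minus_carrier_mat [OF Yc] x(1)] x(3)
    by (simp add: smult_smult_assoc mult.commute)
  then have ez: "A *\<^sub>v z - Y *\<^sub>v z = \<nu> \<cdot>\<^sub>v z"
    using mult_vec_diff [OF A Yc z] by simp
  have Yz: "Y *\<^sub>v z \<in> carrier_vec n" and Az: "A *\<^sub>v z \<in> carrier_vec n" using Yc A z by auto
  have coord: "(Y *\<^sub>v z) \<bullet>c v k = (\<i> * of_real (lam k) - \<nu>) * (z \<bullet>c v k)" if k: "k < n" for k
  proof -
    have vk: "v k \<in> carrier_vec n" using basis_carrier [OF k] .
    have "(A *\<^sub>v z) \<bullet>c v k - (Y *\<^sub>v z) \<bullet>c v k = \<nu> * (z \<bullet>c v k)"
      using scalar_prod_conj_simps(3) [OF Az Yz vk] scalar_prod_conj_simps(5) [OF z z vk] by (simp add: ez)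
    then show ?thesis
      unfolding coordinate_skew [OF z k] by (simp add: algebra_simps)
  qed
  \<comment> \<open>The index whose eigenvalue is nearest in height to \<nu>: for every other k the
    triangle inequality leaves half the gap, |lam k - Im \<nu>| \<ge> 2 \<beta>.\<close>
  obtain j where j: "j < n" "\<And>k. k < n \<Longrightarrow> \<bar>lam j - Im \<nu>\<bar> \<le> \<bar>lam k - Im \<nu>\<bar>"
  proof -
    let ?S = "(\<lambda>k. \<bar>lam k - Im \<nu>\<bar>) ` {..<n}"
    have "Min ?S \<in> ?S" using n_pos by (intro Min_in) auto
    then obtain j where "j < n" "Min ?S = \<bar>lam j - Im \<nu>\<bar>" by auto
    moreover have "Min ?S \<le> \<bar>lam k - Im \<nu>\<bar>" if "k < n" for k
      using that by (intro Min_le) auto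
    ultimately show thesis by (intro that) auto
  qed
  have vj: "v j \<in> carrier_vec n" using basis_carrier [OF j(1)] .
  define R where "R = (\<Sum>k\<in>{..<n} - {j}. (cmod (z \<bullet>c v k))\<^sup>2)"
  define S where "S = (\<Sum>k\<in>{..<n} - {j}. (cmod ((Y *\<^sub>v v j) \<bullet>c v k))\<^sup>2)"
  have R0: "0 \<le> R" and S0: "0 \<le> S" by (simp_all add: R_def S_def sum_nonneg)
  have zj: "(cmod (z \<bullet>c v j))\<^sup>2 = 1 - R"
    using parseval_remove [OF z j(1)] nz by (simp add: R_def)
  \<comment> \<open>As Y z = (A - \<nu>) z, coordinate k of Y z is at least 2 \<beta> times that of
    z for k \<noteq> j, whereas Y z has length at most \<beta>. So at most a quarter of the squared
    length of z lies off \<open>v j\<close>.\<close>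
  have "(2 * \<beta>)\<^sup>2 * R \<le> (\<Sum>k\<in>{..<n} - {j}. (cmod ((Y *\<^sub>v z) \<bullet>c v k))\<^sup>2)"
    unfolding R_def sum_distrib_left
  proof (rule sum_mono)
    fix k assume "k \<in> {..<n} - {j}"
    then have k: "k < n" "k \<noteq> j" by auto
    have "4 * \<beta> \<le> \<bar>lam k - lam j\<bar>" by (rule gap [OF k(1) j(1) k(2)])
    also have "\<dots> \<le> 2 * \<bar>lam k - Im \<nu>\<bar>"
      using abs_triangle_ineq4 [of "lam k - Im \<nu>" "lam j - Im \<nu>"] j(2) [OF k(1)] by simp
    also have "\<bar>lam k - Im \<nu>\<bar> \<le> cmod (\<i> * of_real (lam k) - \<nu>)"
      using abs_Im_le_cmod [of "\<i> * of_real (lam k) - \<nu>"] by simp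
    finally have "2 * \<beta> \<le> cmod (\<i> * of_real (lam k) - \<nu>)" by simp
    then have "(2 * \<beta>)\<^sup>2 \<le> (cmod (\<i> * of_real (lam k) - \<nu>))\<^sup>2"
      using \<beta> by (intro power_mono) auto
    then have "(2 * \<beta>)\<^sup>2 * (cmod (z \<bullet>c v k))\<^sup>2 \<le> (cmod (\<i> * of_real (lam k) - \<nu>))\<^sup>2 * (cmod (z \<bullet>c v k))\<^sup>2"
      by (intro mult_right_mono) auto
    then show "(2 * \<beta>)\<^sup>2 * (cmod (z \<bullet>c v k))\<^sup>2 \<le> (cmod ((Y *\<^sub>v z) \<bullet>c v k))\<^sup>2"
      by (simp only: coord [OF k(1)] norm_mult power_mult_distrib)
  qed
  also have "\<dots> \<le> nsq (Y *\<^sub>v z)" using parseval_remove [OF Yz j(1)] by simp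
  also have "\<dots> \<le> \<beta>\<^sup>2" using inverse_norm_le [OF Y pos \<beta> bound z] nz by simp
  finally have "\<beta>\<^sup>2 * (4 * R) \<le> \<beta>\<^sup>2 * 1" by (simp add: power_mult_distrib)
  then have "4 * R \<le> 1" using \<beta> by (simp only: mult_le_cancel_left_pos zero_less_power)
  then have R: "R \<le> 1 / 4" by simp
  have S: "S \<le> d\<^sup>2 / 4"
    unfolding S_def d(2) [OF j(1), symmetric]
    using inverse_off_diagonal [OF Y pos \<beta> bound gap j(1)] j(1) by blast
  define c where "c = (Y *\<^sub>v v j) \<bullet>c v j"
  define p where "p = Re c"
  have cp: "c = of_real p" unfolding p_def c_def by (rule hermitian_Im_0 [OF Y(1) vj])
  have "v j \<noteq> 0\<^sub>v n" using orthonormal [OF j(1) j(1)] vj by auto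
  then have p0: "0 \<le> p" using pos [OF vj] by (simp add: p_def c_def)
  have Yv: "Y *\<^sub>v v j \<in> carrier_vec n" using Yc vj by simp
  have pS: "p\<^sup>2 + S = d\<^sup>2"
    using parseval_remove [OF Yv j(1)] nsq_inverse_basis [OF Y j(1)] d(2) [OF j(1)] cp
    by (simp add: S_def c_def [symmetric])
  \<comment> \<open>r and s are the parts of z and Y v_j orthogonal to \<open>v j\<close>.
    Coordinate j of Y z is p times that of z plus the inner product of r and s; this is
    \<open>rs\<close>, and Cauchy-Schwarz then bounds the distance of -Re \<nu> from p.\<close>
  define r where "r = z - (z \<bullet>c v j) \<cdot>\<^sub>v v j"
  define s where "s = Y *\<^sub>v v j - c \<cdot>\<^sub>v v j"
  have r: "r \<in> carrier_vec n" and s: "s \<in> carrier_vec n" using z vj Yv by (simp_all add: r_def s_def)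
  have nr: "nsq r = R" "nsq s = S"
    unfolding r_def s_def R_def S_def c_def
    using nsq_remove_coordinate [OF z j(1)] nsq_remove_coordinate [OF Yv j(1)] by simp_all
  have vv: "v j \<bullet>c v j = 1" using orthonormal [OF j(1) j(1)] by simp
  have "r \<bullet>c s = r \<bullet>c (Y *\<^sub>v v j) - cnj c * (r \<bullet>c v j)"
    unfolding s_def using r Yv vj by (simp add: scalar_prod_conj_simps [where n = n])
  also have "r \<bullet>c v j = 0"
    unfolding r_def using z vj vv by (simp add: scalar_prod_conj_simps [where n = n])
  also have "r \<bullet>c (Y *\<^sub>v v j) = z \<bullet>c (Y *\<^sub>v v j) - (z \<bullet>c v j) * (v j \<bullet>c (Y *\<^sub>v v j))"
    unfolding r_def using z vj Yv by (simp add: scalar_prod_conj_simps [where n = n])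
  also have "z \<bullet>c (Y *\<^sub>v v j) = (Y *\<^sub>v z) \<bullet>c v j"
    using hermitian_scalar_prod_conj [OF Y(1) z vj] by simp
  also have "v j \<bullet>c (Y *\<^sub>v v j) = of_real p"
    using hermitian_scalar_prod_conj [OF Y(1) vj vj] cp by (simp add: c_def)
  finally have rs: "r \<bullet>c s = (\<i> * of_real (lam j) - \<nu> - of_real p) * (z \<bullet>c v j)"
    unfolding coord [OF j(1)] by (simp add: algebra_simps)
  have "\<bar>- Re \<nu> - p\<bar> \<le> cmod (\<i> * of_real (lam j) - \<nu> - of_real p)"
    using abs_Re_le_cmod [of "\<i> * of_real (lam j) - \<nu> - of_real p"] by simp
  then have "\<bar>- Re \<nu> - p\<bar>\<^sup>2 * (1 - R) \<le> (cmod (\<i> * of_real (lam j) - \<nu> - of_real p))\<^sup>2 * (1 - R)"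
    using R by (intro mult_right_mono power_mono) auto
  also have "\<dots> = (cmod (r \<bullet>c s))\<^sup>2"
    unfolding rs norm_mult power_mult_distrib zj ..
  also have "\<dots> \<le> R * S" using cauchy_schwarz_nsq [OF r s] nr by simp
  finally have "(- Re \<nu> - p)\<^sup>2 * (1 - R) \<le> R * S" by simp
  then show ?thesis
    by (rule gap_estimate [OF d(1) p0 pS S R0 R _ S0])
qed

text \<open>The minimum is attained, so the strict bound for single eigenvalues passes to
  it.\<close>

lemma gamma_decay_gt:
  assumes \<beta>: "0 < \<beta>"
    and bound: "\<And>y. y \<in> carrier_vec m \<Longrightarrow> nsq (B *\<^sub>v y) \<le> \<beta>\<^sup>2 * nsq y"
    and gap: "\<And>k j. k < n \<Longrightarrow> j < n \<Longrightarrow> k \<noteq> j \<Longrightarrow> 4 * \<beta> \<le> \<bar>lam k - lam j\<bar>"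
    and d: "0 < d" "\<And>j. j < n \<Longrightarrow> nsq (mat_adjoint B *\<^sub>v v j) = d\<^sup>2"
  shows "d / 2 < gamma_decay A B"
proof -
  obtain Y where Y: "hermitian n Y" "res_mat Y = 0\<^sub>m n n"
    and pos: "\<And>x. x \<in> carrier_vec n \<Longrightarrow> x \<noteq> 0\<^sub>v n \<Longrightarrow> 0 < Re ((Y *\<^sub>v x) \<bullet>c x)"
    and spec: "\<And>\<nu>. eigenvalue (closed_loop A B) \<nu> \<longleftrightarrow> eigenvalue (A - Y) \<nu>"
    using closed_loop_spectrum by blast
  have "gamma_decay A B \<in> {\<bar>Re \<nu>\<bar> | \<nu>. eigenvalue (closed_loop A B) \<nu>}"
    unfolding gamma_decay_def by (rule Min_in [OF closed_loop_spectrum_finite])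
  then obtain \<nu> where "gamma_decay A B = \<bar>Re \<nu>\<bar>" "eigenvalue (A - Y) \<nu>"
    using spec by blast
  moreover from this(2) have "d / 2 < - Re \<nu>"
    using decay_rate_lower [OF Y pos \<beta> bound gap d] by blast
  ultimately show ?thesis by simp
qed

end

section \<open>The Fourier matrix\<close>

lemma (in orthonormal_basis) nsq_basis_mat:
  assumes "x \<in> carrier_vec n"
  shows "nsq (basis_mat *\<^sub>v x) = nsq x"
proof -
  have "of_real (nsq (basis_mat *\<^sub>v x)) = x \<bullet>c (mat_adjoint basis_mat *\<^sub>v (basis_mat *\<^sub>v x))"
    using mult_mat_vec_scalar_prod_conj [OF basis_mat_carrier assms mult_mat_vec_carrier [OF basis_mat_carrier assms]]
    by (simp add: scalar_prod_conj_self)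
  also have "mat_adjoint basis_mat *\<^sub>v (basis_mat *\<^sub>v x) = x"
    using assoc_mult_mat_vec [OF mat_adjoint_carrier [OF basis_mat_carrier] basis_mat_carrier assms]
      basis_mat_unitary(1) assms by simp
  finally show ?thesis by (simp add: scalar_prod_conj_self)
qed

lemma (in orthonormal_basis) adjoint_basis_mat_basis:
  assumes "j < n"
  shows "mat_adjoint basis_mat *\<^sub>v v j = unit_vec n j"
proof (rule eq_vecI)
  fix i assume "i < dim_vec (unit_vec n j :: complex Matrix.vec)"
  then have i: "i < n" by simp
  show "(mat_adjoint basis_mat *\<^sub>v v j) $ i = unit_vec n j $ i"
    using adjoint_basis_mat_index [OF basis_carrier [OF assms] i] orthonormal [OF assms i] i assms
    by (simp add: unit_vec_def eq_commute)
qed simp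

definition fourier_mat :: "nat \<Rightarrow> nat \<Rightarrow> real \<Rightarrow> complex Matrix.mat" where
  "fourier_mat n m \<beta> = Matrix.mat n m (\<lambda>(j, l). complex_of_real (\<beta> / sqrt (real n)) *
       exp (- \<i> * complex_of_real (2 * pi / real n)) ^ (j * l))"

lemma fourier_mat_carrier [simp]: "fourier_mat n m \<beta> \<in> carrier_mat n m"
  by (simp add: fourier_mat_def)

lemma (in orthonormal_basis) fourier_input_eq: "fourier_input n m \<beta> v = basis_mat * fourier_mat n m \<beta>"
  by (simp add: fourier_input_def basis_mat_def fourier_mat_def)

lemma fourier_root_eq_cnj: "exp (- \<i> * complex_of_real t) = cnj (cis t)"
proof -
  have "cnj (cis t) = cis (- t)" by (rule cis_cnj)
  then show ?thesis by (simp add: cis_conv_exp)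
qed

text \<open>A geometric sum whose ratio z is an n-th root of unity; z = 1 only for l = k, because
  both exponents are below n.\<close>

lemma fourier_root_sum:
  assumes n: "0 < n" and l: "l < n" "k < n"
  defines "w \<equiv> exp (- \<i> * complex_of_real (2 * pi / real n))"
  shows "(\<Sum>j<n. cnj (w ^ (j * l)) * w ^ (j * k)) = (if l = k then of_nat n else 0)"
proof -
  let ?u = "cis (2 * pi / real n)"
  have w: "w = cnj ?u" unfolding w_def by (rule fourier_root_eq_cnj)
  have pow: "?u ^ j = cis (2 * pi * real j / real n)" for j
    by (simp add: DeMoivre mult.commute)
  have un: "?u ^ n = 1" using n by (simp add: pow)
  have ww: "w ^ j * ?u ^ j = 1" for j
  proof -
    have "w * ?u = 1" unfolding w by (simp add: cis_cnj cis_mult)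
    then show ?thesis by (simp flip: power_mult_distrib)
  qed
  define z where "z = ?u ^ l * w ^ k"
  have summand: "cnj (w ^ (j * l)) * w ^ (j * k) = z ^ j" for j
  proof -
    have "cnj (w ^ (j * l)) = (?u ^ l) ^ j"
      unfolding w by (simp add: mult.commute flip: power_mult)
    moreover have "w ^ (j * k) = (w ^ k) ^ j"
      by (simp add: mult.commute flip: power_mult)
    ultimately show ?thesis by (simp add: z_def power_mult_distrib)
  qed
  have "z ^ n = (?u ^ n) ^ l * cnj ((?u ^ n) ^ k)"
    unfolding z_def w by (simp add: power_mult_distrib mult.commute flip: power_mult)
  then have zn: "z ^ n = 1" by (simp add: un)
  show ?thesis
  proof (cases "l = k")
    case True
    then have "z = 1" using ww [of k] by (simp add: z_def mult.commute)
    then show ?thesis unfolding summand using True by simp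
  next
    case False
    have "z \<noteq> 1"
    proof
      assume "z = 1"
      then have "?u ^ l * (w ^ k * ?u ^ k) = ?u ^ k" by (simp add: z_def mult.assoc [symmetric])
      then have "cis (2 * pi * real l / real n) = cis (2 * pi * real k / real n)"
        unfolding ww by (simp add: pow)
      moreover have "inj_on (\<lambda>k. cis (2 * pi * real k / real n)) {..<n}"
        using Complex.bij_betw_roots_unity [OF n] by (rule bij_betw_imp_inj_on)
      ultimately show False using l False by (auto dest: inj_onD)
    qed
    then have "(\<Sum>j<n. z ^ j) = 0"
      using zn by (simp add: geometric_sum)
    then show ?thesis unfolding summand using False by simp
  qed
qed

text \<open>Since m \<le> n, distinct columns belong to distinct n-th roots of unity and are
  orthogonal. The matrix is thus \<beta> times an isometry.\<close>

lemma fourier_mat_gram: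
  assumes n: "0 < n" and m: "m \<le> n"
  shows "mat_adjoint (fourier_mat n m \<beta>) * fourier_mat n m \<beta> = complex_of_real (\<beta>\<^sup>2) \<cdot>\<^sub>m 1\<^sub>m m"
proof (rule eq_matI)
  let ?w = "exp (- \<i> * complex_of_real (2 * pi / real n))"
  let ?c = "complex_of_real (\<beta> / sqrt (real n))"
  fix l k assume "l < dim_row (complex_of_real (\<beta>\<^sup>2) \<cdot>\<^sub>m 1\<^sub>m m)" "k < dim_col (complex_of_real (\<beta>\<^sup>2) \<cdot>\<^sub>m 1\<^sub>m m)"
  then have lk: "l < m" "k < m" by auto
  have dims: "dim_row (fourier_mat n m \<beta>) = n" "dim_col (fourier_mat n m \<beta>) = m"
    by (simp_all add: fourier_mat_def)
  have entry: "fourier_mat n m \<beta> $$ (j, i) = ?c * ?w ^ (j * i)" if "j < n" "i < m" for j i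
    using that by (simp add: fourier_mat_def)
  have "(mat_adjoint (fourier_mat n m \<beta>) * fourier_mat n m \<beta>) $$ (l, k) =
      (\<Sum>j<n. cnj (fourier_mat n m \<beta> $$ (j, l)) * fourier_mat n m \<beta> $$ (j, k))"
    using lk by (auto simp: dims scalar_prod_def lessThan_atLeast0 intro!: sum.cong)
  also have "\<dots> = (\<Sum>j<n. (?c * ?c) * (cnj (?w ^ (j * l)) * ?w ^ (j * k)))"
  proof (rule sum.cong [OF refl])
    fix j assume "j \<in> {..<n}"
    then have j: "j < n" by simp
    have "cnj ?c = ?c" by (rule complex_cnj_complex_of_real)
    then show "cnj (fourier_mat n m \<beta> $$ (j, l)) * fourier_mat n m \<beta> $$ (j, k) =
        (?c * ?c) * (cnj (?w ^ (j * l)) * ?w ^ (j * k))"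
      unfolding entry [OF j lk(1)] entry [OF j lk(2)] complex_cnj_mult
      by (simp only: ac_simps)
  qed
  also have "\<dots> = (?c * ?c) * (if l = k then of_nat n else 0)"
    unfolding sum_distrib_left [symmetric]
    using fourier_root_sum [OF n, of l k] lk m by simp
  also have "\<dots> = (complex_of_real (\<beta>\<^sup>2) \<cdot>\<^sub>m 1\<^sub>m m) $$ (l, k)"
  proof -
    have "?c * ?c * of_nat n = complex_of_real ((\<beta> / sqrt (real n)) * (\<beta> / sqrt (real n)) * real n)"
      by (simp only: of_real_mult of_real_of_nat_eq)
    also have "(\<beta> / sqrt (real n)) * (\<beta> / sqrt (real n)) * real n = \<beta>\<^sup>2"
      using n by (simp add: power2_eq_square)
    finally show ?thesis using lk by simp
  qed
  finally show "(mat_adjoint (fourier_mat n m \<beta>) * fourier_mat n m \<beta>) $$ (l, k) =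
      (complex_of_real (\<beta>\<^sup>2) \<cdot>\<^sub>m 1\<^sub>m m) $$ (l, k)" .
qed (simp_all add: fourier_mat_def)

lemma nsq_fourier_mat:
  assumes n: "0 < n" and m: "m \<le> n" and x: "x \<in> carrier_vec m"
  shows "nsq (fourier_mat n m \<beta> *\<^sub>v x) = \<beta>\<^sup>2 * nsq x"
proof -
  let ?F = "fourier_mat n m \<beta>"
  have F: "?F \<in> carrier_mat n m" by simp
  have Fx: "?F *\<^sub>v x \<in> carrier_vec n" by (rule mult_mat_vec_carrier [OF F x])
  have "(mat_adjoint ?F * ?F) *\<^sub>v x = complex_of_real (\<beta>\<^sup>2) \<cdot>\<^sub>v x"
    unfolding fourier_mat_gram [OF n m] using x by (intro eq_vecI) (auto simp: scalar_prod_smult_left)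
  then have "mat_adjoint ?F *\<^sub>v (?F *\<^sub>v x) = complex_of_real (\<beta>\<^sup>2) \<cdot>\<^sub>v x"
    using assoc_mult_mat_vec [OF mat_adjoint_carrier [OF F] F x] by simp
  then have "of_real (nsq (?F *\<^sub>v x)) = complex_of_real (\<beta>\<^sup>2) * of_real (nsq x)"
    using mat_adjoint_scalar_prod_conj [OF F Fx x] scalar_prod_conj_simps(5) [OF x x x]
    by (simp add: scalar_prod_conj_self)
  then show ?thesis by (simp only: of_real_mult [symmetric] of_real_eq_iff)
qed

text \<open>All entries have modulus \<beta> / sqrt n, so the input acts equally strongly on every
  eigenvector of A. This makes d in \<open>decay_rate_lower\<close> independent of j and equal to
  the upper bound of \<open>gamma_decay_le\<close>.\<close>

lemma nsq_adjoint_fourier_mat: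
  assumes n: "0 < n" and j: "j < n"
  shows "nsq (mat_adjoint (fourier_mat n m \<beta>) *\<^sub>v unit_vec n j) = \<beta>\<^sup>2 * (real m / real n)"
proof -
  let ?F = "fourier_mat n m \<beta>"
  have F: "?F \<in> carrier_mat n m" by simp
  have dims: "dim_row ?F = n" "dim_col ?F = m" by (simp_all add: fourier_mat_def)
  have w: "cmod (exp (- \<i> * complex_of_real (2 * pi / real n))) = 1"
    unfolding fourier_root_eq_cnj by simp
  have "(cmod ((mat_adjoint ?F *\<^sub>v unit_vec n j) $ l))\<^sup>2 = \<beta>\<^sup>2 / real n" if l: "l < m" for l
  proof -
    have "(mat_adjoint ?F *\<^sub>v unit_vec n j) $ l = cnj (?F $$ (j, l))"
      using mult_unit_vec_index [OF mat_adjoint_carrier [OF F] l j] l j by (simp add: dims)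
    also have "cmod \<dots> = \<bar>\<beta> / sqrt (real n)\<bar>"
      using l j by (simp only: complex_mod_cnj fourier_mat_def) (simp add: norm_mult norm_power w norm_divide)
    finally have "(cmod ((mat_adjoint ?F *\<^sub>v unit_vec n j) $ l))\<^sup>2 = \<bar>\<beta> / sqrt (real n)\<bar>\<^sup>2"
      by (rule arg_cong)
    then show ?thesis using n by (simp add: power_divide)
  qed
  then show ?thesis by (simp add: nsq_def dims del: index_mult_mat_vec)
qed

text \<open>The supremum in \<open>op_norm\<close> is an upper bound only once the set is known to
  be bounded; the Rayleigh bound for \<open>mat_adjoint B * B\<close> provides that.\<close>

lemma op_norm_bound:
  fixes B :: "complex Matrix.mat"
  assumes B: "B \<in> carrier_mat n m" and x: "x \<in> carrier_vec m" "nsq x \<le> 1"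
  shows "nsq (B *\<^sub>v x) \<le> (op_norm B)\<^sup>2"
proof (cases "m = 0")
  case True
  then have "B *\<^sub>v x = 0\<^sub>v n" using B x by (intro eq_vecI) (auto simp: scalar_prod_def)
  then show ?thesis by (simp add: nsq_def)
next
  case False
  have Ba: "mat_adjoint B \<in> carrier_mat m n" using B by simp
  obtain \<mu> where \<mu>: "\<And>x. x \<in> carrier_vec m \<Longrightarrow>
      Re (((mat_adjoint B * mat_adjoint (mat_adjoint B)) *\<^sub>v x) \<bullet>c x) \<le> \<mu> * nsq x"
    using rayleigh_max [OF hermitian_gram [OF Ba]] False by (metis neq0_conv)
  have le: "nsq (B *\<^sub>v y) \<le> \<bar>\<mu>\<bar>" if y: "y \<in> carrier_vec m" "nsq y \<le> 1" for y
  proof -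
    have "nsq (B *\<^sub>v y) \<le> \<mu> * nsq y"
      using \<mu> [OF y(1)] gram_form [OF Ba y(1)] by simp
    also have "\<dots> \<le> \<bar>\<mu>\<bar> * 1" using y(2) by (intro mult_mono) auto
    finally show ?thesis by simp
  qed
  let ?S = "{vec_norm2 (B *\<^sub>v x) | x. x \<in> carrier_vec (dim_col B) \<and> vec_norm2 x \<le> 1}"
  have "bdd_above ?S"
    using le B by (intro bdd_aboveI [of _ "sqrt \<bar>\<mu>\<bar>"]) (auto simp: vec_norm2_nsq)
  then have "vec_norm2 (B *\<^sub>v x) \<le> op_norm B"
    unfolding op_norm_def using x B by (intro cSup_upper) (auto simp: vec_norm2_nsq)
  then show ?thesis by (simp add: vec_norm2_nsq sqrt_le_D)
qed

text \<open>If the adjoint of B annihilates v_j, then for every feedback K the range of A + B K - i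
  lam_j is orthogonal to v_j. This matrix is then singular, and the imaginary number i lam_j remains
  an eigenvalue.\<close>

lemma (in skew_basis) stabilizable_controllable:
  assumes B: "B \<in> carrier_mat n m" and stab: "stabilizable A B" and j: "j < n"
  shows "mat_adjoint B *\<^sub>v v j \<noteq> 0\<^sub>v m"
proof
  assume zero: "mat_adjoint B *\<^sub>v v j = 0\<^sub>v m"
  have vj: "v j \<in> carrier_vec n" using basis_carrier [OF j] .
  obtain K where K: "K \<in> carrier_mat m n" and stable: "stable_mat (A + B * K)"
    using stab A B by (auto simp: stabilizable_def)
  have BK: "B * K \<in> carrier_mat n n" using B K by simp
  have M: "A + B * K \<in> carrier_mat n n" using BK by simp
  define t where "t = \<i> * complex_of_real (lam j)"
  let ?N = "(A + B * K) + (- t) \<cdot>\<^sub>m 1\<^sub>m n"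
  have N: "?N \<in> carrier_mat n n" using M by simp
  have orth: "(?N *\<^sub>v y) \<bullet>c v j = 0" if y: "y \<in> carrier_vec n" for y
  proof -
    have c: "A *\<^sub>v y \<in> carrier_vec n" "K *\<^sub>v y \<in> carrier_vec m" "B *\<^sub>v (K *\<^sub>v y) \<in> carrier_vec n"
      using A B K y by auto
    have "?N *\<^sub>v y = (A *\<^sub>v y + B *\<^sub>v (K *\<^sub>v y)) + (- t) \<cdot>\<^sub>v y"
      using shift_mult_vec [OF M y] add_mult_distrib_mat_vec [OF A BK y] assoc_mult_mat_vec [OF B K y] by simp
    then have "(?N *\<^sub>v y) \<bullet>c v j = (A *\<^sub>v y) \<bullet>c v j + (B *\<^sub>v (K *\<^sub>v y)) \<bullet>c v j + (- t) * (y \<bullet>c v j)"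
      using c y vj by (simp add: scalar_prod_conj_simps [where n = n])
    moreover have "(B *\<^sub>v (K *\<^sub>v y)) \<bullet>c v j = 0"
      using mult_mat_vec_scalar_prod_conj [OF B c(2) vj] zero c(2) by simp
    ultimately show ?thesis
      using coordinate_skew [OF y j] by (simp add: t_def)
  qed
  have "\<exists>x. x \<in> carrier_vec n \<and> x \<noteq> 0\<^sub>v n \<and> ?N *\<^sub>v x = 0\<^sub>v n"
  proof (rule ccontr)
    assume "\<not> ?thesis"
    then obtain J where J: "J \<in> carrier_mat n n" "?N * J = 1\<^sub>m n"
      using injective_invertible [OF N] by blast
    have "?N *\<^sub>v (J *\<^sub>v v j) = v j"
      using assoc_mult_mat_vec [OF N J(1) vj] J(2) vj by simp
    then have "v j \<bullet>c v j = 0" using orth [of "J *\<^sub>v v j"] J(1) vj by simp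
    then show False using orthonormal [OF j j] by simp
  qed
  then obtain x where x: "x \<in> carrier_vec n" "x \<noteq> 0\<^sub>v n" "?N *\<^sub>v x = 0\<^sub>v n" by blast
  have Mx: "(A + B * K) *\<^sub>v x \<in> carrier_vec n" by (rule mult_mat_vec_carrier [OF M x(1)])
  have "(A + B * K) *\<^sub>v x + (- t) \<cdot>\<^sub>v x = 0\<^sub>v n"
    using shift_mult_vec [OF M x(1), of "- t"] x(3) by simp
  then have "((A + B * K) *\<^sub>v x + (- t) \<cdot>\<^sub>v x) $ i = 0" if "i < n" for i
    using that by simp
  moreover have "(p + (- t) \<cdot>\<^sub>v x) $ i = p $ i - (t \<cdot>\<^sub>v x) $ i" if "i < n" "p \<in> carrier_vec n" for p i
    using that x(1) by simp
  ultimately have eq: "((A + B * K) *\<^sub>v x) $ i = (t \<cdot>\<^sub>v x) $ i" if "i < n" for i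
    using that Mx by (metis eq_iff_diff_eq_0)
  have "(A + B * K) *\<^sub>v x = t \<cdot>\<^sub>v x"
    by (rule eq_vecI) (use eq Mx x(1) B in \<open>auto simp del: index_mult_mat_vec\<close>)
  then have "eigenvalue (A + B * K) t"
    using x M unfolding eigenvalue_def eigenvector_def by (metis carrier_matD(1))
  then have "Re t < 0" using stable by (simp add: stable_mat_def)
  then show False by (simp add: t_def)
qed

text \<open>16 is the square of the 4 in the gap condition. The claim amounts to 6 - 4 sqrt 2 \<le>
  6/16, for which sqrt 2 \<ge> 1.41 suffices.\<close>

lemma gap_constant: "16 \<le> 6 / (2 - sqrt 2)\<^sup>2"
proof -
  have "141 / 100 \<le> sqrt 2" by (rule real_le_rsqrt) (simp add: power2_eq_square)
  moreover have "(2 - sqrt 2)\<^sup>2 = 6 - 4 * sqrt 2" by (simp add: power2_diff)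
  ultimately have "(2 - sqrt 2)\<^sup>2 \<le> 3 / 8" by simp
  moreover have "0 < (2 - sqrt (2 :: real))\<^sup>2"
  proof -
    have "sqrt (2 :: real) < 2" by (rule real_less_lsqrt) auto
    then show ?thesis by simp
  qed
  ultimately show ?thesis by (simp add: field_simps)
qed

theorem corollary13:
  fixes n m :: nat
    and \<beta> :: real
    and A :: "complex Matrix.mat"
    and lam :: "nat \<Rightarrow> real"
    and v :: "nat \<Rightarrow> complex Matrix.vec"
  assumes "2 \<le> n" and "1 \<le> m" and "m \<le> n"
    and "0 < \<beta>"
    and "A \<in> carrier_mat n n" and "skew_hermitian A"
    and "\<And>j k. j \<le> k \<Longrightarrow> k < n \<Longrightarrow> lam j \<le> lam k"
    and "\<And>j. j < n \<Longrightarrow> v j \<in> carrier_vec n"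
    and "\<And>j k. j < n \<Longrightarrow> k < n \<Longrightarrow> v j \<bullet>c v k = (if j = k then 1 else 0)"
    and "\<And>j. j < n \<Longrightarrow> A *\<^sub>v v j = (\<i> * complex_of_real (lam j)) \<cdot>\<^sub>v v j"
    and "(eigenvalue_gap n lam)\<^sup>2 > 6 / (2 - sqrt 2)\<^sup>2 * sqrt (real n / real m) * \<beta>\<^sup>2"
  shows "ereal (gamma_decay A (fourier_input n m \<beta> v))
           > ereal (1 / 2) * (SUP B \<in> admissible_inputs A m \<beta>. ereal (gamma_decay A B))"
proof -
  have n: "0 < n" using assms(1) by simp
  define \<delta> where "\<delta> = eigenvalue_gap n lam"
  let ?S = "{\<bar>lam j - lam k\<bar> | j k. j < n \<and> k < n \<and> j \<noteq> k}"
  have fin: "finite ?S"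
    by (rule finite_subset [of _ "(\<lambda>(j, k). \<bar>lam j - lam k\<bar>) ` ({..<n} \<times> {..<n})"]) auto
  have "\<bar>lam 0 - lam 1\<bar> \<in> ?S" using assms(1) by force
  then have "\<delta> \<in> ?S" unfolding \<delta>_def eigenvalue_gap_def by (intro Min_in [OF fin]) blast
  then have "0 \<le> \<delta>" by auto
  have "1 * 1 \<le> sqrt (real n / real m)" using assms(2,3) by simp
  then have "16 * 1 \<le> 6 / (2 - sqrt 2)\<^sup>2 * sqrt (real n / real m)"
    using gap_constant by (intro mult_mono) auto
  then have "16 * \<beta>\<^sup>2 \<le> 6 / (2 - sqrt 2)\<^sup>2 * sqrt (real n / real m) * \<beta>\<^sup>2"
    by (intro mult_right_mono) auto
  then have "(4 * \<beta>)\<^sup>2 \<le> \<delta>\<^sup>2" using assms(11) by (simp add: \<delta>_def power_mult_distrib)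
  then have "4 * \<beta> \<le> \<delta>" using \<open>0 \<le> \<delta>\<close> by (rule power2_le_imp_le)
  moreover have "\<delta> \<le> \<bar>lam j - lam k\<bar>" if "j < n" "k < n" "j \<noteq> k" for j k
    unfolding \<delta>_def eigenvalue_gap_def using that by (intro Min_le [OF fin]) blast
  ultimately have gap: "4 * \<beta> \<le> \<bar>lam j - lam k\<bar>" if "j < n" "k < n" "j \<noteq> k" for j k
    using that by fastforce
  \<comment> \<open>The gap also makes the eigenvalues of A simple.\<close>
  interpret skew_basis n v A lam
  proof
    show "mat_adjoint A = - A" using assms(6) by (simp add: skew_hermitian_def)
    show "lam j \<noteq> lam k" if "j < n" "k < n" "j \<noteq> k" for j k
      using gap [OF that] assms(4) by auto
  qed (use n assms in auto)
  define d where "d = \<beta> * sqrt (real m / real n)"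
  have d: "0 < d" using assms(2,4) n by (simp add: d_def)
  have d2: "d\<^sup>2 = \<beta>\<^sup>2 * (real m / real n)" by (simp add: d_def power_mult_distrib)
  have upper: "gamma_decay A B \<le> d" if B: "B \<in> admissible_inputs A m \<beta>" for B
  proof -
    have Bc: "B \<in> carrier_mat n m" and stab: "stabilizable A B" and norm: "op_norm B = \<beta>"
      using B assms(5) by (auto simp: admissible_inputs_def)
    \<comment> \<open>Stabilizability enters as the Hautus condition
      \<open>controllable\<close>.\<close>
    interpret skew_system n v A lam B m
      by unfold_locales (use Bc stabilizable_controllable [OF Bc stab] in auto)
    have "nsq (B *\<^sub>v unit_vec m l) \<le> \<beta>\<^sup>2" if "l < m" for l
      using op_norm_bound [OF Bc, of "unit_vec m l"] that norm by simp
    then show ?thesis unfolding d_def using assms(4) by (intro gamma_decay_le) auto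
  qed
  let ?F = "fourier_mat n m \<beta>"
  let ?B = "fourier_input n m \<beta> v"
  have F: "?F \<in> carrier_mat n m" by simp
  have B: "?B \<in> carrier_mat n m"
    unfolding fourier_input_eq by (rule mult_carrier_mat [OF basis_mat_carrier F])
  have bound: "nsq (?B *\<^sub>v y) \<le> \<beta>\<^sup>2 * nsq y" if y: "y \<in> carrier_vec m" for y
    unfolding fourier_input_eq assoc_mult_mat_vec [OF basis_mat_carrier F y]
    using nsq_basis_mat [OF mult_mat_vec_carrier [OF F y]] nsq_fourier_mat [OF n assms(3) y] by simp
  have rows: "nsq (mat_adjoint ?B *\<^sub>v v j) = d\<^sup>2" if j: "j < n" for j
  proof -
    have "mat_adjoint ?B *\<^sub>v v j = mat_adjoint ?F *\<^sub>v (mat_adjoint basis_mat *\<^sub>v v j)"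
      unfolding fourier_input_eq mat_adjoint_mult [OF basis_mat_carrier F]
      by (rule assoc_mult_mat_vec [OF mat_adjoint_carrier [OF F] mat_adjoint_carrier [OF basis_mat_carrier]
            basis_carrier [OF j]])
    then show ?thesis
      using nsq_adjoint_fourier_mat [OF n j] by (simp add: adjoint_basis_mat_basis [OF j] d2)
  qed
  \<comment> \<open>Here \<open>controllable\<close> holds because all rows have length d >
    0.\<close>
  interpret skew_system n v A lam ?B m
  proof
    show "mat_adjoint ?B *\<^sub>v v j \<noteq> 0\<^sub>v m" if "j < n" for j
    proof
      assume "mat_adjoint ?B *\<^sub>v v j = 0\<^sub>v m"
      then have "nsq (0\<^sub>v m) = d\<^sup>2" using rows [OF that] by simp
      then show False using d by (simp add: nsq_def)
    qed
  qed (rule B)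
  have "d / 2 < gamma_decay A ?B"
    using gamma_decay_gt [OF assms(4) bound gap d rows] by blast
  \<comment> \<open>The supremum is bounded by d as an extended real; the strictness comes from the
    lower bound alone.\<close>
  moreover have "ereal (1 / 2) * (SUP B \<in> admissible_inputs A m \<beta>. ereal (gamma_decay A B)) \<le> ereal (1 / 2) * ereal d"
    using upper by (intro ereal_mult_left_mono SUP_least) auto
  ultimately show ?thesis
    by (auto intro: order.strict_trans1)
qed

end
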